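(* Let $S,S^*$ define a pair of second order PDE's as in the context (integrable, with $1-S_RS_R^*>0$) satisfying the generalized Wünschmann condition $M=0$. Let $\theta^i$ be the associated tetrad with the tetrad parameters $(\alpha,b,b^*,a,a^*,c)$ given in the context and with conformal parameter $\Phi$ chosen (locally) so that $\mathcal L_{e_s}g=\mathcal L_{e_{s^*}}g=0$ for $g=\eta_{ij}\theta^i\otimes\theta^j$; thus $g$ is a metric on the solution space $\mathfrak M^4$. Let $A_i$ be four arbitrary functions on $J^6$, let $A=A_i\theta^i$, and let $\omega_{ij}=\omega_{[ij]}+\eta_{ij}A$ be the torsion-free generalized Weyl connection with Weyl one-form $A$. Then: (i) There are unique one-forms $\Psi_i=\Psi_{ij}\theta^j+\Psi_{is}ds+\Psi_{is^*}ds^*$ on $J^6$ such that the two-forms $$\Omega_{ij}=d\omega_{ij}+\eta^{kl}\omega_{ik}\wedge\omega_{lj}+\eta_{il}\theta^l\wedge\Psi_j+\Psi_i\wedge\theta^l\eta_{jl}-\eta_{ij}\Psi_k\wedge\theta^k=\tfrac12\Omega_{ijLM}\theta^L\wedge\theta^M$$ satisfy $\Omega_{ijkm}=\Omega_{[ij]km}$, $\eta^{ik}\Omega_{ijkm}=0$ and $\Omega_{ijks}=\Omega_{ijks^*}=0$. (ii) With these $\Psi_i$, $\Omega_{ij}=\tfrac12C_{ijlm}\theta^l\wedge\theta^m$, where $C_{ijlm}$ are the components in the frame $\theta^i$ of the Weyl tensor of $g$, and $$\Omega_i:=d\Psi_i+\eta^{jk}\Psi_j\wedge\omega_{ki}=\tfrac12\left(\nabla^jC_{ijmn}+A^jC_{ijmn}\right)\theta^m\wedge\theta^n,$$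 where $\nabla$ is the Levi-Civita covariant derivative of $g$. (iii) The $6\times6$ matrix of one-forms $$\omega^A{}_B=\begin{pmatrix}-A&\Psi_j&0\\ \theta^i&\eta^{ik}\omega_{[kj]}&\eta^{ij}\Psi_j\\ 0&\eta_{jk}\theta^k&A\end{pmatrix}$$ takes values in the Lie algebra of $O(4,2)$ and its curvature $R^A{}_B=d\omega^A{}_B+\omega^A{}_C\wedge\omega^C{}_B$ is $$R^A{}_B=\begin{pmatrix}0&\Omega_j&0\\ 0&\eta^{ik}\Omega_{kj}&\eta^{ij}\Omega_j\\ 0&0&0\end{pmatrix}.$$
   Context: Setting. $J^6$ is (an open subset of) the space with coordinates $(Z,W,W^*,R,s,s^* )$, where $Z,R$ are real, and $(W,W^* )$, $(s,s^* )$ are complex-conjugate pairs; $^*$ denotes complex conjugation, subscripts $Z,W,W^*,R,s,s^*$ on $S,S^*,T,T^*$ denote partial derivatives (e.g. $S^*_W=\partial_W(S^* )$), and all functions are smooth. A function $S$ on $J^6$ and its conjugate $S^*$ define the pair of PDE's $Z_{ss}=S(Z,Z_s,Z_{s^*},Z_{ss^*},s,s^* )$, $Z_{s^*s^*}=S^*(Z,Z_s,Z_{s^*},Z_{ss^*},s,s^* )$ for a real function $Z(s,s^* )$, with the notation $(W,W^*,R)=(Z_s,Z_{s^*},Z_{ss^*})$. Assume $1-S_RS_R^*>0$. Define $$T=\frac{S_{s^*}+W^*S_Z+RS_W+S^*S_{W^*}+S_R(S^*_s+WS^*_Z+SS^*_W+RS^*_{W^*})}{1-S_RS_R^*},$$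 $T^*$ its conjugate, and the vector fields $$e_s=D=\partial_s+W\partial_Z+S\partial_W+R\partial_{W^*}+T\partial_R,\qquad e_{s^*}=D^*=\partial_{s^*}+W^*\partial_Z+R\partial_W+S^*\partial_{W^*}+T^*\partial_R,$$ so that $T=D^*S$, $T^*=DS^*$. Assume the integrability condition $D^2S^*=D^{*2}S$ (then $[D,D^*]=0$). The solution space $\mathfrak M^4$ is the (local) four-dimensional space of integral surfaces of $D,D^*$. Tetrad. Put $\beta^0=dZ-W\,ds-W^*ds^*$, $\beta^+=dW-S\,ds-R\,ds^*$, $\beta^-=dW^*-R\,ds-S^*ds^*$, $\beta^1=dR-T\,ds-T^*ds^*$, and $$\theta^0=\Phi\beta^0,\quad \theta^+=\Phi\alpha(\beta^++b\beta^-),\quad \theta^-=\Phi\alpha(\beta^-+b^*\beta^+),\quad \theta^1=\Phi(\beta^1+a\beta^++a^*\beta^-+c\beta^0),$$ with $\Phi$ a real nowhere-zero function and the tetrad parameters given by $$b=\frac{-1+\sqrt{1-S_RS_R^*}}{S_R^*}\ \left(=\frac{-S_R}{1+\sqrt{1-S_RS_R^*}}\right),\qquad \alpha=\frac{\sqrt{1+bb^*}}{1-bb^*},$$ $$a=\frac{(1+bb^* )\left[b^{*2}Db+Db^*+D^*(bb^* )+(1-bb^* )(b^*S_W+bS^*_W)\right]}{(1-bb^* )^3},$$ $$c=-\frac{Da+D^*a^*+T_W+T^*_{W^*}}{4}-\frac{aa^*(1+6bb^*+b^2b^{*2})}{2(1+bb^* )^2}+\frac{(1+bb^* )(bS^*_Z+b^*S_Z)}{2(1-bb^*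 )^2}+\frac{a(2ab-b^*S_{W^*})+a^*(2a^*b^*-bS^*_W)}{2(1+bb^* )},$$ $a^*,b^*$ being the conjugates of $a,b$. The generalized Wünschmann condition is $$M\equiv\frac{Db+bD^*b+S_{W^*}-bS_W+b^2S^*_{W^*}-b^3S^*_W}{1-bb^*}=0$$ together with its complex conjugate. It is known that under this condition a torsion-free generalized Weyl connection exists for the tetrad, that it is uniquely determined by $\Phi$ and the freely chosen $A_i$, and that locally $\Phi$ can be chosen so that $\mathcal L_{e_s}g=\mathcal L_{e_{s^*}}g=0$, in which case $A_s=A_{s^*}=0$. Indices and connections. $\theta^0,\theta^+,\theta^-,\theta^1,\theta^s=ds,\theta^{s^*}=ds^*$ is a coframe of $J^6$. Indices $i,j,k,l,m,n$ run over $\{0,+,-,1\}$, the form indices $L,M$ over $\{0,+,-,1,s,s^*\}$, and $A,B,C$ label the six rows/columns (block sizes $1,4,1$). $\eta_{ij}$ is the constant symmetric matrix with $\eta_{01}=\eta_{10}=1$, $\eta_{+-}=\eta_{-+}=-1$ and all other entries $0$; it raises and lowers lower-case indices. A torsion-free generalized Weyl connection is a matrix of one-forms $\omega_{ij}$ on $J^6$ with $d\theta^i+\eta^{ik}\omega_{kj}\wedge\theta^j=0$ and $\omega_{ij}=\omega_{[ij]}+\eta_{ij}A$, $A=A_i\theta^i+A_sds+A_{s^*}ds^*$. Curvature convention: with $\gamma_{ij}=\gamma_{[ij]}$ the Levi-Civita connection forms ($d\theta^i+\gamma^i{}_j\wedge\theta^j=0$), the Riemann tensor is given by $d\gamma_{ij}+\gamma_{ik}\wedge\gamma^k{}_j=\tfrac12\mathfrak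 R_{ijkm}\theta^k\wedge\theta^m$, the Ricci tensor is $\eta^{ik}\mathfrak R_{ijkm}$, and $C_{ijkm}$ is the trace-free (Weyl) part of $\mathfrak R_{ijkm}$. The Lie algebra of $O(4,2)$ is realized as the $6\times6$ matrices $X$ with $X^{\mathsf T}Q+QX=0$, $Q=\begin{pmatrix}0&0&-1\\0&\eta&0\\-1&0&0\end{pmatrix}$ (written in the complex null basis in which $\theta^+,\theta^-$ are complex conjugate). *)

theory Defs
  imports "HOL-Analysis.Analysis"
begin

section \<open>Smooth functions and complexified calculus on the six-dimensional jet space\<close>

primrec Ck_on :: "nat \<Rightarrow> 'a::real_normed_vector set \<Rightarrow> ('a \<Rightarrow> 'b::real_normed_vector) \<Rightarrow> bool" where
  "Ck_on 0 U f \<longleftrightarrow> continuous_on U f"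
| "Ck_on (Suc k) U f \<longleftrightarrow> (\<forall>x\<in>U. f differentiable (at x)) \<and>
     (\<forall>v. Ck_on k U (\<lambda>x. frechet_derivative f (at x) v))"

definition smooth_on :: "'a::real_normed_vector set \<Rightarrow> ('a \<Rightarrow> 'b::real_normed_vector) \<Rightarrow> bool" where
  "smooth_on U f \<longleftrightarrow> (\<forall>k. Ck_on k U f)"

text \<open>A point is \<open>(Z, W, R, s)\<close>; the coordinates \<open>W\<^sup>*\<close> and \<open>s\<^sup>*\<close> are the conjugates of \<open>W\<close> and \<open>s\<close>.\<close>

type_synonym J6 = "real \<times> complex \<times> real \<times> complex"

datatype coord = cZ | cW | cWs | cR | cs | css

lemma UNIV_coord: "UNIV = {cZ, cW, cWs, cR, cs, css}"
  by (auto intro: coord.exhaust)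

instance coord :: finite
  by standard (simp add: UNIV_coord)

fun crd :: "coord \<Rightarrow> J6 \<Rightarrow> complex" where
  "crd cZ (z, w, r, s) = complex_of_real z"
| "crd cW (z, w, r, s) = w"
| "crd cWs (z, w, r, s) = cnj w"
| "crd cR (z, w, r, s) = complex_of_real r"
| "crd cs (z, w, r, s) = s"
| "crd css (z, w, r, s) = cnj s"

definition cj :: "(J6 \<Rightarrow> complex) \<Rightarrow> J6 \<Rightarrow> complex" where
  "cj f = (\<lambda>p. cnj (f p))"

text \<open>Partial derivatives; those along \<open>W, W\<^sup>*, s, s\<^sup>*\<close> are Wirtinger derivatives.\<close>

fun pd :: "coord \<Rightarrow> (J6 \<Rightarrow> complex) \<Rightarrow> J6 \<Rightarrow> complex" where
  "pd cZ f p = frechet_derivative f (at p) (1, 0, 0, 0)"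
| "pd cW f p = (frechet_derivative f (at p) (0, 1, 0, 0)
      - \<i> * frechet_derivative f (at p) (0, \<i>, 0, 0)) / 2"
| "pd cWs f p = (frechet_derivative f (at p) (0, 1, 0, 0)
      + \<i> * frechet_derivative f (at p) (0, \<i>, 0, 0)) / 2"
| "pd cR f p = frechet_derivative f (at p) (0, 0, 1, 0)"
| "pd cs f p = (frechet_derivative f (at p) (0, 0, 0, 1)
      - \<i> * frechet_derivative f (at p) (0, 0, 0, \<i>)) / 2"
| "pd css f p = (frechet_derivative f (at p) (0, 0, 0, 1)
      + \<i> * frechet_derivative f (at p) (0, 0, 0, \<i>)) / 2"

text \<open>Complex-valued tensor fields are given by their components with respect to
  \<open>dZ, dW, dW\<^sup>*, dR, ds, ds\<^sup>*\<close> and the dual basis of Wirtinger vector fields. A two-form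
  \<open>\<Omega>\<close> has the components \<open>\<Omega>(\<partial>\<^sub>\<mu>, \<partial>\<^sub>\<nu>)\<close>, so that \<open>\<Omega> = 1/2 \<Omega>\<^sub>\<mu>\<^sub>\<nu> dx\<^sup>\<mu> \<and> dx\<^sup>\<nu>\<close>.\<close>

type_synonym vfield = "coord \<Rightarrow> J6 \<Rightarrow> complex"
type_synonym form1 = "coord \<Rightarrow> J6 \<Rightarrow> complex"
type_synonym form2 = "coord \<Rightarrow> coord \<Rightarrow> J6 \<Rightarrow> complex"

definition smooth_form1 :: "J6 set \<Rightarrow> form1 \<Rightarrow> bool" where
  "smooth_form1 U \<alpha> \<longleftrightarrow> (\<forall>\<mu>. smooth_on U (\<alpha> \<mu>))"

definition dcrd :: "coord \<Rightarrow> form1" where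
  "dcrd \<nu> = (\<lambda>\<mu> p. if \<mu> = \<nu> then 1 else 0)"

definition wedge :: "form1 \<Rightarrow> form1 \<Rightarrow> form2" where
  "wedge \<alpha> \<beta> = (\<lambda>\<mu> \<nu> p. \<alpha> \<mu> p * \<beta> \<nu> p - \<alpha> \<nu> p * \<beta> \<mu> p)"

definition ext_d :: "form1 \<Rightarrow> form2" where
  "ext_d \<alpha> = (\<lambda>\<mu> \<nu> p. pd \<mu> (\<alpha> \<nu>) p - pd \<nu> (\<alpha> \<mu>) p)"

definition vderiv :: "vfield \<Rightarrow> (J6 \<Rightarrow> complex) \<Rightarrow> J6 \<Rightarrow> complex" where
  "vderiv X f = (\<lambda>p. \<Sum>\<mu>\<in>UNIV. X \<mu> p * pd \<mu> f p)"

text \<open>Lie derivative of a covariant two-tensor.\<close>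

definition lie_deriv :: "vfield \<Rightarrow> form2 \<Rightarrow> form2" where
  "lie_deriv X g = (\<lambda>\<mu> \<nu> p. vderiv X (g \<mu> \<nu>) p
     + (\<Sum>\<kappa>\<in>UNIV. g \<kappa> \<nu> p * pd \<mu> (X \<kappa>) p + g \<mu> \<kappa> p * pd \<nu> (X \<kappa>) p))"

text \<open>The value of a one-form at \<open>p\<close> on a real tangent vector \<open>v\<close>. The coordinate functions are
  real-linear, so the complexified components of \<open>v\<close> are \<open>crd \<mu> v\<close>.\<close>

definition form1_at :: "form1 \<Rightarrow> J6 \<Rightarrow> J6 \<Rightarrow> complex" where
  "form1_at \<alpha> p v = (\<Sum>\<mu>\<in>UNIV. \<alpha> \<mu> p * crd \<mu> v)"


section \<open>The pair of PDEs\<close>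

definition Tfun :: "(J6 \<Rightarrow> complex) \<Rightarrow> J6 \<Rightarrow> complex" where
  "Tfun S = (\<lambda>p.
     (pd css S p + crd cWs p * pd cZ S p + crd cR p * pd cW S p + cnj (S p) * pd cWs S p
       + pd cR S p * (pd cs (cj S) p + crd cW p * pd cZ (cj S) p
           + S p * pd cW (cj S) p + crd cR p * pd cWs (cj S) p))
     / (1 - pd cR S p * pd cR (cj S) p))"

fun e_s :: "(J6 \<Rightarrow> complex) \<Rightarrow> vfield" where
  "e_s S cZ p = crd cW p"
| "e_s S cW p = S p"
| "e_s S cWs p = crd cR p"
| "e_s S cR p = Tfun S p"
| "e_s S cs p = 1"
| "e_s S css p = 0"

fun e_ss :: "(J6 \<Rightarrow> complex) \<Rightarrow> vfield" where
  "e_ss S cZ p = crd cWs p"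
| "e_ss S cW p = crd cR p"
| "e_ss S cWs p = cnj (S p)"
| "e_ss S cR p = cnj (Tfun S p)"
| "e_ss S cs p = 0"
| "e_ss S css p = 1"

abbreviation DD :: "(J6 \<Rightarrow> complex) \<Rightarrow> (J6 \<Rightarrow> complex) \<Rightarrow> J6 \<Rightarrow> complex" where
  "DD S \<equiv> vderiv (e_s S)"

abbreviation DDs :: "(J6 \<Rightarrow> complex) \<Rightarrow> (J6 \<Rightarrow> complex) \<Rightarrow> J6 \<Rightarrow> complex" where
  "DDs S \<equiv> vderiv (e_ss S)"

text \<open>Since \<open>Z\<close> and \<open>R\<close> are real, \<open>S\<^sub>R S\<^sup>*\<^sub>R = |S\<^sub>R|\<^sup>2\<close>.\<close>

definition integrable_pde :: "J6 set \<Rightarrow> (J6 \<Rightarrow> complex) \<Rightarrow> bool" where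
  "integrable_pde U S \<longleftrightarrow> smooth_on U S \<and>
     (\<forall>p\<in>U. 1 - (cmod (pd cR S p))\<^sup>2 > 0) \<and>
     (\<forall>p\<in>U. DD S (DD S (cj S)) p = DDs S (DDs S S) p)"


section \<open>Tetrad parameters\<close>

text \<open>The form of \<open>b\<close> that is also valid where \<open>S\<^sub>R = 0\<close>.\<close>

definition bfun :: "(J6 \<Rightarrow> complex) \<Rightarrow> J6 \<Rightarrow> complex" where
  "bfun S = (\<lambda>p. - pd cR S p / (1 + complex_of_real (sqrt (1 - (cmod (pd cR S p))\<^sup>2))))"

definition bbs :: "(J6 \<Rightarrow> complex) \<Rightarrow> J6 \<Rightarrow> complex" where
  "bbs S = (\<lambda>p. bfun S p * cj (bfun S) p)"

definition alphafun :: "(J6 \<Rightarrow> complex) \<Rightarrow> J6 \<Rightarrow> complex" where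
  "alphafun S = (\<lambda>p. complex_of_real (sqrt (1 + (cmod (bfun S p))\<^sup>2)) / (1 - bbs S p))"

definition afun :: "(J6 \<Rightarrow> complex) \<Rightarrow> J6 \<Rightarrow> complex" where
  "afun S = (\<lambda>p. let b = bfun S p; bs = cj (bfun S) p in
     (1 + b * bs) * (bs\<^sup>2 * DD S (bfun S) p + DD S (cj (bfun S)) p + DDs S (bbs S) p
        + (1 - b * bs) * (bs * pd cW S p + b * pd cW (cj S) p))
     / (1 - b * bs) ^ 3)"

definition cfun :: "(J6 \<Rightarrow> complex) \<Rightarrow> J6 \<Rightarrow> complex" where
  "cfun S = (\<lambda>p. let b = bfun S p; bs = cj (bfun S) p; a = afun S p; as = cj (afun S) p in
     - (DD S (afun S) p + DDs S (cj (afun S)) p + pd cW (Tfun S) p + pd cWs (cj (Tfun S)) p) / 4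
     - a * as * (1 + 6 * b * bs + b\<^sup>2 * bs\<^sup>2) / (2 * (1 + b * bs)\<^sup>2)
     + (1 + b * bs) * (b * pd cZ (cj S) p + bs * pd cZ S p) / (2 * (1 - b * bs)\<^sup>2)
     + (a * (2 * a * b - bs * pd cWs S p) + as * (2 * as * bs - b * pd cW (cj S) p))
        / (2 * (1 + b * bs)))"

definition Wuenschmann :: "(J6 \<Rightarrow> complex) \<Rightarrow> J6 \<Rightarrow> complex" where
  "Wuenschmann S = (\<lambda>p. let b = bfun S p in
     (DD S (bfun S) p + b * DDs S (bfun S) p + pd cWs S p - b * pd cW S p
        + b\<^sup>2 * pd cWs (cj S) p - b ^ 3 * pd cW (cj S) p)
     / (1 - b * cnj b))"


section \<open>Tetrad and coframe\<close>

datatype idx4 = N0 | Np | Nm | N1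

lemma UNIV_idx4: "UNIV = {N0, Np, Nm, N1}"
  by (auto intro: idx4.exhaust)

instance idx4 :: finite
  by standard (simp add: UNIV_idx4)

text \<open>The matrix \<open>\<eta>\<close> is its own inverse, so \<open>eta\<close> denotes both \<open>\<eta>\<^sub>i\<^sub>j\<close> and \<open>\<eta>\<^sup>i\<^sup>j\<close>.\<close>

fun eta :: "idx4 \<Rightarrow> idx4 \<Rightarrow> complex" where
  "eta N0 N1 = 1"
| "eta N1 N0 = 1"
| "eta Np Nm = -1"
| "eta Nm Np = -1"
| "eta _ _ = 0"

definition beta0 :: form1 where
  "beta0 = (\<lambda>\<mu> p. dcrd cZ \<mu> p - crd cW p * dcrd cs \<mu> p - crd cWs p * dcrd css \<mu> p)"

definition betap :: "(J6 \<Rightarrow> complex) \<Rightarrow> form1" where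
  "betap S = (\<lambda>\<mu> p. dcrd cW \<mu> p - S p * dcrd cs \<mu> p - crd cR p * dcrd css \<mu> p)"

definition betam :: "(J6 \<Rightarrow> complex) \<Rightarrow> form1" where
  "betam S = (\<lambda>\<mu> p. dcrd cWs \<mu> p - crd cR p * dcrd cs \<mu> p - cnj (S p) * dcrd css \<mu> p)"

definition beta1 :: "(J6 \<Rightarrow> complex) \<Rightarrow> form1" where
  "beta1 S = (\<lambda>\<mu> p. dcrd cR \<mu> p - Tfun S p * dcrd cs \<mu> p - cnj (Tfun S p) * dcrd css \<mu> p)"

fun tetrad :: "(J6 \<Rightarrow> complex) \<Rightarrow> (J6 \<Rightarrow> real) \<Rightarrow> idx4 \<Rightarrow> form1" where
  "tetrad S \<Phi> N0 \<mu> p = complex_of_real (\<Phi> p) * beta0 \<mu> p"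
| "tetrad S \<Phi> Np \<mu> p = complex_of_real (\<Phi> p) * alphafun S p *
     (betap S \<mu> p + bfun S p * betam S \<mu> p)"
| "tetrad S \<Phi> Nm \<mu> p = complex_of_real (\<Phi> p) * alphafun S p *
     (betam S \<mu> p + cnj (bfun S p) * betap S \<mu> p)"
| "tetrad S \<Phi> N1 \<mu> p = complex_of_real (\<Phi> p) *
     (beta1 S \<mu> p + afun S p * betap S \<mu> p + cnj (afun S p) * betam S \<mu> p + cfun S p * beta0 \<mu> p)"

definition tetrad_metric :: "(idx4 \<Rightarrow> form1) \<Rightarrow> form2" where
  "tetrad_metric \<theta> = (\<lambda>\<mu> \<nu> p. \<Sum>i\<in>UNIV. \<Sum>j\<in>UNIV. eta i j * \<theta> i \<mu> p * \<theta> j \<nu> p)"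

datatype idx6 = Fr idx4 | Fs | Fss

lemma UNIV_idx6: "UNIV = insert Fs (insert Fss (range Fr))"
  by (auto intro: idx6.exhaust)

instance idx6 :: finite
  by standard (simp add: UNIV_idx6)

fun coframe :: "(idx4 \<Rightarrow> form1) \<Rightarrow> idx6 \<Rightarrow> form1" where
  "coframe \<theta> (Fr i) = \<theta> i"
| "coframe \<theta> Fs = dcrd cs"
| "coframe \<theta> Fss = dcrd css"

text \<open>The frame \<open>e\<^sub>L\<close> dual to the coframe: \<open>\<theta>\<^sup>L(e\<^sub>M) = \<delta>\<^sup>L\<^sub>M\<close>. The components \<open>\<Omega>\<^sub>L\<^sub>M\<close> in
  \<open>\<Omega> = 1/2 \<Omega>\<^sub>L\<^sub>M \<theta>\<^sup>L \<and> \<theta>\<^sup>M\<close> are \<open>\<Omega>(e\<^sub>L, e\<^sub>M)\<close>.\<close>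

definition dual_frame :: "(idx4 \<Rightarrow> form1) \<Rightarrow> idx6 \<Rightarrow> vfield" where
  "dual_frame \<theta> L \<mu> p =
     matrix_inv ((\<chi> M \<nu>. coframe \<theta> M \<nu> p) :: complex^coord^idx6) $ \<mu> $ L"

definition comp1 :: "(idx4 \<Rightarrow> form1) \<Rightarrow> form1 \<Rightarrow> idx6 \<Rightarrow> J6 \<Rightarrow> complex" where
  "comp1 \<theta> \<alpha> L p = (\<Sum>\<mu>\<in>UNIV. \<alpha> \<mu> p * dual_frame \<theta> L \<mu> p)"

definition comp2 :: "(idx4 \<Rightarrow> form1) \<Rightarrow> form2 \<Rightarrow> idx6 \<Rightarrow> idx6 \<Rightarrow> J6 \<Rightarrow> complex" where
  "comp2 \<theta> \<Omega> L M p =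
     (\<Sum>\<mu>\<in>UNIV. \<Sum>\<nu>\<in>UNIV. \<Omega> \<mu> \<nu> p * dual_frame \<theta> L \<mu> p * dual_frame \<theta> M \<nu> p)"


section \<open>Connections and curvature\<close>

text \<open>A connection is given by its lowered forms \<open>\<omega>\<^sub>i\<^sub>j\<close>.\<close>

definition torsion_free :: "J6 set \<Rightarrow> (idx4 \<Rightarrow> form1) \<Rightarrow> (idx4 \<Rightarrow> idx4 \<Rightarrow> form1) \<Rightarrow> bool" where
  "torsion_free U \<theta> \<omega> \<longleftrightarrow> (\<forall>p\<in>U. \<forall>i \<mu> \<nu>.
     ext_d (\<theta> i) \<mu> \<nu> p
       + (\<Sum>k\<in>UNIV. \<Sum>j\<in>UNIV. eta i k * wedge (\<omega> k j) (\<theta> j) \<mu> \<nu> p) = 0)"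

definition skew_part :: "(idx4 \<Rightarrow> idx4 \<Rightarrow> form1) \<Rightarrow> idx4 \<Rightarrow> idx4 \<Rightarrow> form1" where
  "skew_part \<omega> i j = (\<lambda>\<mu> p. (\<omega> i j \<mu> p - \<omega> j i \<mu> p) / 2)"

definition weyl_form :: "(idx4 \<Rightarrow> form1) \<Rightarrow> (idx4 \<Rightarrow> J6 \<Rightarrow> complex) \<Rightarrow> form1" where
  "weyl_form \<theta> A = (\<lambda>\<mu> p. \<Sum>i\<in>UNIV. A i p * \<theta> i \<mu> p)"

definition weyl_connection ::
    "J6 set \<Rightarrow> (idx4 \<Rightarrow> form1) \<Rightarrow> form1 \<Rightarrow> (idx4 \<Rightarrow> idx4 \<Rightarrow> form1) \<Rightarrow> bool" where
  "weyl_connection U \<theta> A \<omega> \<longleftrightarrow> (\<forall>i j. smooth_form1 U (\<omega> i j)) \<and> torsion_free U \<theta> \<omega> \<and>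
     (\<forall>p\<in>U. \<forall>i j \<mu>. \<omega> i j \<mu> p = skew_part \<omega> i j \<mu> p + eta i j * A \<mu> p)"

definition levi_civita :: "J6 set \<Rightarrow> (idx4 \<Rightarrow> form1) \<Rightarrow> (idx4 \<Rightarrow> idx4 \<Rightarrow> form1) \<Rightarrow> bool" where
  "levi_civita U \<theta> \<gamma> \<longleftrightarrow> (\<forall>i j. smooth_form1 U (\<gamma> i j)) \<and> torsion_free U \<theta> \<gamma> \<and>
     (\<forall>p\<in>U. \<forall>i j \<mu>. \<gamma> i j \<mu> p = skew_part \<gamma> i j \<mu> p)"

definition curv :: "(idx4 \<Rightarrow> idx4 \<Rightarrow> form1) \<Rightarrow> idx4 \<Rightarrow> idx4 \<Rightarrow> form2" where
  "curv \<omega> i j = (\<lambda>\<mu> \<nu> p. ext_d (\<omega> i j) \<mu> \<nu> p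
     + (\<Sum>k\<in>UNIV. \<Sum>l\<in>UNIV. eta k l * wedge (\<omega> i k) (\<omega> l j) \<mu> \<nu> p))"

text \<open>In the following definitions \<open>\<gamma>\<close> is the Levi-Civita connection of \<open>\<theta>\<close>.\<close>

definition Riem :: "(idx4 \<Rightarrow> form1) \<Rightarrow> (idx4 \<Rightarrow> idx4 \<Rightarrow> form1)
    \<Rightarrow> idx4 \<Rightarrow> idx4 \<Rightarrow> idx4 \<Rightarrow> idx4 \<Rightarrow> J6 \<Rightarrow> complex" where
  "Riem \<theta> \<gamma> i j k m = comp2 \<theta> (curv \<gamma> i j) (Fr k) (Fr m)"

definition Ric :: "(idx4 \<Rightarrow> form1) \<Rightarrow> (idx4 \<Rightarrow> idx4 \<Rightarrow> form1) \<Rightarrow> idx4 \<Rightarrow> idx4 \<Rightarrow> J6 \<Rightarrow> complex" where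
  "Ric \<theta> \<gamma> j m = (\<lambda>p. \<Sum>i\<in>UNIV. \<Sum>k\<in>UNIV. eta i k * Riem \<theta> \<gamma> i j k m p)"

definition Scal :: "(idx4 \<Rightarrow> form1) \<Rightarrow> (idx4 \<Rightarrow> idx4 \<Rightarrow> form1) \<Rightarrow> J6 \<Rightarrow> complex" where
  "Scal \<theta> \<gamma> = (\<lambda>p. \<Sum>j\<in>UNIV. \<Sum>m\<in>UNIV. eta j m * Ric \<theta> \<gamma> j m p)"

text \<open>Trace-free part of the Riemann tensor in dimension four.\<close>

definition Weyl :: "(idx4 \<Rightarrow> form1) \<Rightarrow> (idx4 \<Rightarrow> idx4 \<Rightarrow> form1)
    \<Rightarrow> idx4 \<Rightarrow> idx4 \<Rightarrow> idx4 \<Rightarrow> idx4 \<Rightarrow> J6 \<Rightarrow> complex" where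
  "Weyl \<theta> \<gamma> i j k m = (\<lambda>p. Riem \<theta> \<gamma> i j k m p
     - (eta i k * Ric \<theta> \<gamma> j m p - eta i m * Ric \<theta> \<gamma> j k p
        - eta j k * Ric \<theta> \<gamma> i m p + eta j m * Ric \<theta> \<gamma> i k p) / 2
     + Scal \<theta> \<gamma> p * (eta i k * eta j m - eta i m * eta j k) / 6)"

text \<open>\<open>nabla4 \<theta> \<gamma> C l i j m n\<close> is \<open>\<nabla>\<^sub>l C\<^sub>i\<^sub>j\<^sub>m\<^sub>n\<close> in the frame.\<close>

definition nabla4 :: "(idx4 \<Rightarrow> form1) \<Rightarrow> (idx4 \<Rightarrow> idx4 \<Rightarrow> form1)
    \<Rightarrow> (idx4 \<Rightarrow> idx4 \<Rightarrow> idx4 \<Rightarrow> idx4 \<Rightarrow> J6 \<Rightarrow> complex)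
    \<Rightarrow> idx4 \<Rightarrow> idx4 \<Rightarrow> idx4 \<Rightarrow> idx4 \<Rightarrow> idx4 \<Rightarrow> J6 \<Rightarrow> complex" where
  "nabla4 \<theta> \<gamma> C l i j m n = (\<lambda>p.
     let \<Gamma> = (\<lambda>k i'. \<Sum>h\<in>UNIV. eta k h * comp1 \<theta> (\<gamma> h i') (Fr l) p) in
     vderiv (dual_frame \<theta> (Fr l)) (C i j m n) p
       - (\<Sum>k\<in>UNIV. \<Gamma> k i * C k j m n p + \<Gamma> k j * C i k m n p
            + \<Gamma> k m * C i j k n p + \<Gamma> k n * C i j m k p))"

text \<open>\<open>\<nabla>\<^sup>j C\<^sub>i\<^sub>j\<^sub>m\<^sub>n\<close>\<close>

definition divWeyl :: "(idx4 \<Rightarrow> form1) \<Rightarrow> (idx4 \<Rightarrow> idx4 \<Rightarrow> form1)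
    \<Rightarrow> idx4 \<Rightarrow> idx4 \<Rightarrow> idx4 \<Rightarrow> J6 \<Rightarrow> complex" where
  "divWeyl \<theta> \<gamma> i m n = (\<lambda>p.
     \<Sum>j\<in>UNIV. \<Sum>l\<in>UNIV. eta j l * nabla4 \<theta> \<gamma> (Weyl \<theta> \<gamma>) l i j m n p)"


section \<open>The conformal connection\<close>

definition Omega2 :: "(idx4 \<Rightarrow> form1) \<Rightarrow> (idx4 \<Rightarrow> idx4 \<Rightarrow> form1) \<Rightarrow> (idx4 \<Rightarrow> form1)
    \<Rightarrow> idx4 \<Rightarrow> idx4 \<Rightarrow> form2" where
  "Omega2 \<theta> \<omega> \<Psi> i j = (\<lambda>\<mu> \<nu> p. curv \<omega> i j \<mu> \<nu> p
     + (\<Sum>l\<in>UNIV. eta i l * wedge (\<theta> l) (\<Psi> j) \<mu> \<nu> p)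
     + (\<Sum>l\<in>UNIV. wedge (\<Psi> i) (\<theta> l) \<mu> \<nu> p * eta j l)
     - eta i j * (\<Sum>k\<in>UNIV. wedge (\<Psi> k) (\<theta> k) \<mu> \<nu> p))"

definition Omega1 :: "(idx4 \<Rightarrow> idx4 \<Rightarrow> form1) \<Rightarrow> (idx4 \<Rightarrow> form1) \<Rightarrow> idx4 \<Rightarrow> form2" where
  "Omega1 \<omega> \<Psi> i = (\<lambda>\<mu> \<nu> p. ext_d (\<Psi> i) \<mu> \<nu> p
     + (\<Sum>j\<in>UNIV. \<Sum>k\<in>UNIV. eta j k * wedge (\<Psi> j) (\<omega> k i) \<mu> \<nu> p))"

definition normalized :: "J6 set \<Rightarrow> (idx4 \<Rightarrow> form1) \<Rightarrow> (idx4 \<Rightarrow> idx4 \<Rightarrow> form1)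
    \<Rightarrow> (idx4 \<Rightarrow> form1) \<Rightarrow> bool" where
  "normalized U \<theta> \<omega> \<Psi> \<longleftrightarrow> (\<forall>p\<in>U.
     (\<forall>i j k m. comp2 \<theta> (Omega2 \<theta> \<omega> \<Psi> i j) (Fr k) (Fr m) p
        = (comp2 \<theta> (Omega2 \<theta> \<omega> \<Psi> i j) (Fr k) (Fr m) p
           - comp2 \<theta> (Omega2 \<theta> \<omega> \<Psi> j i) (Fr k) (Fr m) p) / 2) \<and>
     (\<forall>j m. (\<Sum>i\<in>UNIV. \<Sum>k\<in>UNIV. eta i k * comp2 \<theta> (Omega2 \<theta> \<omega> \<Psi> i j) (Fr k) (Fr m) p) = 0) \<and>
     (\<forall>i j k. comp2 \<theta> (Omega2 \<theta> \<omega> \<Psi> i j) (Fr k) Fs p = 0 \<and>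
              comp2 \<theta> (Omega2 \<theta> \<omega> \<Psi> i j) (Fr k) Fss p = 0))"

datatype cidx = Top | Mid idx4 | Bot

lemma UNIV_cidx: "UNIV = insert Top (insert Bot (range Mid))"
  by (auto intro: cidx.exhaust)

instance cidx :: finite
  by standard (simp add: UNIV_cidx)

fun cartan :: "(idx4 \<Rightarrow> form1) \<Rightarrow> (idx4 \<Rightarrow> idx4 \<Rightarrow> form1) \<Rightarrow> form1 \<Rightarrow> (idx4 \<Rightarrow> form1)
    \<Rightarrow> cidx \<Rightarrow> cidx \<Rightarrow> form1" where
  "cartan \<theta> \<omega> A \<Psi> Top Top = (\<lambda>\<mu> p. - A \<mu> p)"
| "cartan \<theta> \<omega> A \<Psi> Top (Mid j) = \<Psi> j"
| "cartan \<theta> \<omega> A \<Psi> Top Bot = (\<lambda>\<mu> p. 0)"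
| "cartan \<theta> \<omega> A \<Psi> (Mid i) Top = \<theta> i"
| "cartan \<theta> \<omega> A \<Psi> (Mid i) (Mid j) = (\<lambda>\<mu> p. \<Sum>k\<in>UNIV. eta i k * skew_part \<omega> k j \<mu> p)"
| "cartan \<theta> \<omega> A \<Psi> (Mid i) Bot = (\<lambda>\<mu> p. \<Sum>j\<in>UNIV. eta i j * \<Psi> j \<mu> p)"
| "cartan \<theta> \<omega> A \<Psi> Bot Top = (\<lambda>\<mu> p. 0)"
| "cartan \<theta> \<omega> A \<Psi> Bot (Mid j) = (\<lambda>\<mu> p. \<Sum>k\<in>UNIV. eta j k * \<theta> k \<mu> p)"
| "cartan \<theta> \<omega> A \<Psi> Bot Bot = A"

definition cartan_curv :: "(cidx \<Rightarrow> cidx \<Rightarrow> form1) \<Rightarrow> cidx \<Rightarrow> cidx \<Rightarrow> form2" where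
  "cartan_curv \<Theta> A B = (\<lambda>\<mu> \<nu> p. ext_d (\<Theta> A B) \<mu> \<nu> p
     + (\<Sum>C\<in>UNIV. wedge (\<Theta> A C) (\<Theta> C B) \<mu> \<nu> p))"

fun cartan_curv_block :: "(idx4 \<Rightarrow> idx4 \<Rightarrow> form2) \<Rightarrow> (idx4 \<Rightarrow> form2) \<Rightarrow> cidx \<Rightarrow> cidx \<Rightarrow> form2" where
  "cartan_curv_block \<Omega> \<Omega>' Top (Mid j) = \<Omega>' j"
| "cartan_curv_block \<Omega> \<Omega>' (Mid i) (Mid j) = (\<lambda>\<mu> \<nu> p. \<Sum>k\<in>UNIV. eta i k * \<Omega> k j \<mu> \<nu> p)"
| "cartan_curv_block \<Omega> \<Omega>' (Mid i) Bot = (\<lambda>\<mu> \<nu> p. \<Sum>j\<in>UNIV. eta i j * \<Omega>' j \<mu> \<nu> p)"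
| "cartan_curv_block \<Omega> \<Omega>' _ _ = (\<lambda>\<mu> \<nu> p. 0)"

definition matrix_at :: "(cidx \<Rightarrow> cidx \<Rightarrow> form1) \<Rightarrow> J6 \<Rightarrow> J6 \<Rightarrow> complex^cidx^cidx" where
  "matrix_at \<Theta> p v = (\<chi> A B. form1_at (\<Theta> A B) p v)"

fun Qform :: "cidx \<Rightarrow> cidx \<Rightarrow> complex" where
  "Qform Top Bot = -1"
| "Qform Bot Top = -1"
| "Qform (Mid i) (Mid j) = eta i j"
| "Qform _ _ = 0"

definition Qmat :: "complex^cidx^cidx" where
  "Qmat = (\<chi> A B. Qform A B)"

text \<open>\<open>o42_complex\<close> is the complexification of the Lie algebra of \<open>O(4,2)\<close>. In a complex null basis
  with \<open>\<theta>\<^sup>-\<close> conjugate to \<open>\<theta>\<^sup>+\<close>, conjugation of vectors also exchanges the indices \<open>+\<close> and \<open>-\<close>;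
  the Lie algebra \<open>o42\<close> consists of the matrices commuting with this conjugation.\<close>

definition o42_complex :: "(complex^cidx^cidx) set" where
  "o42_complex = {X. transpose X ** Qmat + Qmat ** X = 0}"

fun bar4 :: "idx4 \<Rightarrow> idx4" where
  "bar4 N0 = N0"
| "bar4 Np = Nm"
| "bar4 Nm = Np"
| "bar4 N1 = N1"

fun barc :: "cidx \<Rightarrow> cidx" where
  "barc Top = Top"
| "barc (Mid i) = Mid (bar4 i)"
| "barc Bot = Bot"

definition o42 :: "(complex^cidx^cidx) set" where
  "o42 = {X \<in> o42_complex. \<forall>A B. cnj (X $ A $ B) = X $ barc A $ barc B}"

end

theory Submission
  imports Defs
begin

text \<open>
  Write the data \<open>(\<theta>, \<omega>, A, \<Psi>)\<close> as a \<open>6 \<times> 6\<close> matrix of one-forms. For the Levi-Civita connection, with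
  \<open>A = 0\<close>, the first Bianchi identity shows that the Riemann form has no \<open>ds\<close>, \<open>ds\<^sup>*\<close> components, so
  \<open>\<Psi>\<close> must be the Schouten form. The Bianchi identity of the matrix connection then has the middle
  block \<open>DW\<^sub>i\<^sub>j = \<Omega>\<^sub>i \<and> \<theta>\<^sub>j - \<Omega>\<^sub>j \<and> \<theta>\<^sub>i\<close>, where \<open>W\<^sub>i\<^sub>j\<close> is the Weyl form, and its traces say that
  \<open>\<Omega>\<^sub>i\<close> is the divergence of the Weyl tensor. The connection for an arbitrary \<open>A\<close> is the gauge transform of
  this one by the unipotent matrix with first row \<open>(1, A\<^sub>j, A\<^sub>iA\<^sup>i/2)\<close>, and its curvature is the
  conjugate of the old one, which gives all curvature formulas at once.
\<close>

text \<open>The work takes place on the six-dimensional jet space and never on the quotient, so the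
  obstacle is the pair of vertical directions e_s and e_s^*: every curvature form has to be shown to
  have no component along them. The forms theta^k vanish on these directions, so a Bianchi identity
  with a vertical argument loses most of its terms. What remains still suffices, by two algebraic
  facts: a tensor skew in i, j and symmetric in j, k is zero, and so is y with 2 y_im + eta_im tr y
  = 0. The gauge law is used in the form g Theta' = Theta g + dg, without the inverse of g. Its
  (Top, Mid) entry determines Psi; the other entries are identities to be checked. The diagonal
  blocks of g are identities and the Levi-Civita curvature is strictly upper triangular apart from
  its Weyl block, so the change of gauge leaves the Weyl block alone and only adds the term A^j
  C_ijmn to the divergence. Reality of Psi is not computed from its formula: the conjugate family
  satisfies the same normalization, and uniqueness identifies the two.\<close>

section \<open>Closure properties of smooth functions\<close>

text \<open>\<open>frechet_derivative\<close> is a choice among the derivatives at x, and f and g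
  have the same ones; differentiability is therefore not an assumption.\<close>

lemma frechet_derivative_cong_open:
  assumes "open U" "x \<in> U" "\<And>y. y \<in> U \<Longrightarrow> f y = g y"
  shows "frechet_derivative f (at x) = frechet_derivative g (at x)"
proof -
  have "(f has_derivative D) (at x) \<longleftrightarrow> (g has_derivative D) (at x)" for D
    using assms by (metis has_derivative_transform_within_open)
  then show ?thesis by (simp add: frechet_derivative_def)
qed

lemma differentiable_cong_open:
  assumes "open U" "x \<in> U" "\<And>y. y \<in> U \<Longrightarrow> f y = g y" "f differentiable (at x)"
  shows "g differentiable (at x)"
  using assms unfolding differentiable_def by (metis has_derivative_transform_within_open)

text \<open>This is what drives the closure rules below: on the open set the derivative of a
  compound function may be replaced by its closed formula, to which the induction hypothesis
  applies.\<close>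

lemma Ck_on_cong:
  assumes "open U" "\<And>x. x \<in> U \<Longrightarrow> f x = g x" "Ck_on k U f"
  shows "Ck_on k U g"
  using assms(2,3)
proof (induction k arbitrary: f g)
  case 0
  then show ?case by (simp cong: continuous_on_cong)
next
  case (Suc k)
  have "g differentiable (at x)" if "x \<in> U" for x
    using differentiable_cong_open[OF \<open>open U\<close> that, of f g] Suc.prems that by simp
  moreover have "Ck_on k U (\<lambda>x. frechet_derivative g (at x) v)" for v
  proof (rule Suc.IH)
    show "Ck_on k U (\<lambda>x. frechet_derivative f (at x) v)" using Suc.prems by simp
    show "frechet_derivative f (at x) v = frechet_derivative g (at x) v" if "x \<in> U" for x
      by (rule fun_cong[OF frechet_derivative_cong_open[OF \<open>open U\<close> that Suc.prems(1)]])
  qed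
  ultimately show ?case by simp
qed

text \<open>\<open>Ck_on (Suc k)\<close> speaks of derivatives only, so monotonicity in k takes its
  own induction. The product, inverse and square root rules need it for the factors that are not
  differentiated.\<close>

lemma Ck_on_SucD: "Ck_on (Suc k) U f \<Longrightarrow> Ck_on k U f"
proof (induction k arbitrary: f)
  case 0
  then show ?case
    by (auto intro!: continuous_at_imp_continuous_on differentiable_imp_continuous_within)
next
  case (Suc k)
  from Suc.prems have "\<forall>v. Ck_on (Suc k) U (\<lambda>x. frechet_derivative f (at x) v)"
    unfolding Ck_on.simps(2)[of "Suc k"] by blast
  then have "\<forall>v. Ck_on k U (\<lambda>x. frechet_derivative f (at x) v)" using Suc.IH by blast
  moreover have "\<forall>x\<in>U. f differentiable (at x)" using Suc.prems by simp
  ultimately show ?case by simp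
qed

lemma Ck_on_const: "Ck_on k U (\<lambda>x. c)"
  by (induction k arbitrary: c) simp_all

lemma Ck_on_bounded_linear:
  assumes "open U" "bounded_linear h" "Ck_on k U f"
  shows "Ck_on k U (\<lambda>x. h (f x))"
  using assms(3)
proof (induction k arbitrary: f)
  case 0
  then show ?case using assms(2) by (simp add: bounded_linear.continuous_on)
next
  case (Suc k)
  have D: "((\<lambda>x. h (f x)) has_derivative (\<lambda>v. h (frechet_derivative f (at x) v))) (at x)"
    if "x \<in> U" for x
    using Suc.prems that
    by (intro bounded_linear.has_derivative[OF assms(2)]) (simp add: frechet_derivative_works[symmetric])
  have "Ck_on k U (\<lambda>x. frechet_derivative (\<lambda>x. h (f x)) (at x) v)" for v
  proof (rule Ck_on_cong[OF \<open>open U\<close>])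
    show "Ck_on k U (\<lambda>x. h (frechet_derivative f (at x) v))" using Suc by simp
    show "h (frechet_derivative f (at x) v) = frechet_derivative (\<lambda>x. h (f x)) (at x) v"
      if "x \<in> U" for x by (rule fun_cong[OF frechet_derivative_at[OF D[OF that]]])
  qed
  then show ?case using D by (auto simp: differentiable_def)
qed

lemma Ck_on_add:
  assumes "open U" "Ck_on k U f" "Ck_on k U g"
  shows "Ck_on k U (\<lambda>x. f x + g x)"
  using assms(2,3)
proof (induction k arbitrary: f g)
  case 0
  then show ?case by (simp add: continuous_on_add)
next
  case (Suc k)
  have D: "((\<lambda>x. f x + g x) has_derivative
      (\<lambda>v. frechet_derivative f (at x) v + frechet_derivative g (at x) v)) (at x)"
    if "x \<in> U" for x
    using Suc.prems that by (intro has_derivative_add) (simp_all add: frechet_derivative_works[symmetric])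
  have "Ck_on k U (\<lambda>x. frechet_derivative (\<lambda>x. f x + g x) (at x) v)" for v
  proof (rule Ck_on_cong[OF \<open>open U\<close>])
    show "Ck_on k U (\<lambda>x. frechet_derivative f (at x) v + frechet_derivative g (at x) v)"
      using Suc by simp
    show "frechet_derivative f (at x) v + frechet_derivative g (at x) v
        = frechet_derivative (\<lambda>x. f x + g x) (at x) v"
      if "x \<in> U" for x by (rule fun_cong[OF frechet_derivative_at[OF D[OF that]]])
  qed
  then show ?case using D by (auto simp: differentiable_def)
qed

lemma Ck_on_mult:
  fixes f g :: "'a::real_normed_vector \<Rightarrow> 'b::real_normed_algebra"
  assumes "open U" "Ck_on k U f" "Ck_on k U g"
  shows "Ck_on k U (\<lambda>x. f x * g x)"
  using assms(2,3)
proof (induction k arbitrary: f g)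
  case 0
  then show ?case by (simp add: continuous_on_mult)
next
  case (Suc k)
  have D: "((\<lambda>x. f x * g x) has_derivative
      (\<lambda>v. f x * frechet_derivative g (at x) v + frechet_derivative f (at x) v * g x)) (at x)"
    if "x \<in> U" for x
    using Suc.prems that by (intro has_derivative_mult) (simp_all add: frechet_derivative_works[symmetric])
  have "Ck_on k U (\<lambda>x. frechet_derivative (\<lambda>x. f x * g x) (at x) v)" for v
  proof (rule Ck_on_cong[OF \<open>open U\<close>])
    show "Ck_on k U (\<lambda>x. f x * frechet_derivative g (at x) v
        + frechet_derivative f (at x) v * g x)"
      using Suc.prems Ck_on_SucD by (intro Ck_on_add \<open>open U\<close> Suc.IH) auto
    show "f x * frechet_derivative g (at x) v + frechet_derivative f (at x) v * g x
        = frechet_derivative (\<lambda>x. f x * g x) (at x) v"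
      if "x \<in> U" for x by (rule fun_cong[OF frechet_derivative_at[OF D[OF that]]])
  qed
  then show ?case using D by (auto simp: differentiable_def)
qed

text \<open>The derivative of 1/f is again built from 1/f, which the induction hypothesis supplies
  at order k; hence f stays fixed in the induction. The square root below is treated in the same
  way.\<close>

lemma Ck_on_inverse:
  fixes f :: "'a::real_normed_vector \<Rightarrow> 'b::real_normed_field"
  assumes "open U" "Ck_on k U f" "\<And>x. x \<in> U \<Longrightarrow> f x \<noteq> 0"
  shows "Ck_on k U (\<lambda>x. inverse (f x))"
  using assms(2)
proof (induction k)
  case 0
  then show ?case using assms(3) by (simp add: continuous_on_inverse)
next
  case (Suc k)
  have D: "((\<lambda>x. inverse (f x)) has_derivative
      (\<lambda>v. - (inverse (f x) * frechet_derivative f (at x) v * inverse (f x)))) (at x)"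
    if "x \<in> U" for x
  proof -
    have "(f has_derivative frechet_derivative f (at x)) (at x)"
      using Suc.prems that by (simp add: frechet_derivative_works[symmetric])
    from Deriv.has_derivative_inverse[OF assms(3)[OF that] this] show ?thesis .
  qed
  have "Ck_on k U (\<lambda>x. frechet_derivative (\<lambda>x. inverse (f x)) (at x) v)" for v
  proof (rule Ck_on_cong[OF \<open>open U\<close>])
    have i: "Ck_on k U (\<lambda>x. inverse (f x))" by (rule Suc.IH[OF Ck_on_SucD[OF Suc.prems]])
    show "Ck_on k U (\<lambda>x. - (inverse (f x) * frechet_derivative f (at x) v * inverse (f x)))"
      using Suc.prems
      by (intro Ck_on_bounded_linear[OF \<open>open U\<close> bounded_linear_minus[OF bounded_linear_ident]]
          Ck_on_mult \<open>open U\<close> i) simp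
    show "- (inverse (f x) * frechet_derivative f (at x) v * inverse (f x))
        = frechet_derivative (\<lambda>x. inverse (f x)) (at x) v"
      if "x \<in> U" for x by (rule fun_cong[OF frechet_derivative_at[OF D[OF that]]])
  qed
  then show ?case using D by (auto simp: differentiable_def)
qed

lemma Ck_on_sqrt:
  fixes f :: "'a::real_normed_vector \<Rightarrow> real"
  assumes "open U" "Ck_on k U f" "\<And>x. x \<in> U \<Longrightarrow> f x > 0"
  shows "Ck_on k U (\<lambda>x. sqrt (f x))"
  using assms(2)
proof (induction k)
  case 0
  then show ?case by (simp add: continuous_on_real_sqrt)
next
  case (Suc k)
  have D: "((\<lambda>x. sqrt (f x)) has_derivative
      (\<lambda>v. frechet_derivative f (at x) v * (inverse (sqrt (f x)) / 2))) (at x)"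
    if "x \<in> U" for x
  proof -
    have "(f has_derivative frechet_derivative f (at x)) (at x)"
      using Suc.prems that by (simp add: frechet_derivative_works[symmetric])
    from has_derivative_real_sqrt[OF assms(3)[OF that] this] show ?thesis .
  qed
  have "Ck_on k U (\<lambda>x. frechet_derivative (\<lambda>x. sqrt (f x)) (at x) v)" for v
  proof (rule Ck_on_cong[OF \<open>open U\<close>])
    have i: "Ck_on k U (\<lambda>x. sqrt (f x))" by (rule Suc.IH[OF Ck_on_SucD[OF Suc.prems]])
    have "sqrt (f x) \<noteq> 0" if "x \<in> U" for x using assms(3)[OF that] by simp
    then have "Ck_on k U (\<lambda>x. inverse (sqrt (f x)))" using Ck_on_inverse[OF assms(1) i] by blast
    then have "Ck_on k U (\<lambda>x. inverse (sqrt (f x)) * (1 / 2))"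
      by (rule Ck_on_mult[OF assms(1) _ Ck_on_const])
    moreover have "Ck_on k U (\<lambda>x. frechet_derivative f (at x) v)" using Suc.prems by simp
    ultimately show "Ck_on k U (\<lambda>x. frechet_derivative f (at x) v * (inverse (sqrt (f x)) / 2))"
      using Ck_on_mult[OF assms(1)] by force
    show "frechet_derivative f (at x) v * (inverse (sqrt (f x)) / 2)
        = frechet_derivative (\<lambda>x. sqrt (f x)) (at x) v"
      if "x \<in> U" for x by (rule fun_cong[OF frechet_derivative_at[OF D[OF that]]])
  qed
  then show ?case using D by (auto simp: differentiable_def)
qed

section \<open>Smooth functions: algebraic operations, conjugation and derivatives\<close>

lemma smooth_on_cong:
  "open U \<Longrightarrow> (\<And>x. x \<in> U \<Longrightarrow> f x = g x) \<Longrightarrow> smooth_on U f \<Longrightarrow> smooth_on U g"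
  unfolding smooth_on_def using Ck_on_cong by blast

lemma smooth_on_const: "smooth_on U (\<lambda>x. c)"
  by (simp add: smooth_on_def Ck_on_const)

lemma smooth_on_bounded_linear_comp:
  "open U \<Longrightarrow> bounded_linear h \<Longrightarrow> smooth_on U f \<Longrightarrow> smooth_on U (\<lambda>x. h (f x))"
  by (simp add: smooth_on_def Ck_on_bounded_linear)

lemma smooth_on_add:
  "open U \<Longrightarrow> smooth_on U f \<Longrightarrow> smooth_on U g \<Longrightarrow> smooth_on U (\<lambda>x. f x + g x)"
  by (simp add: smooth_on_def Ck_on_add)

lemma smooth_on_mult:
  fixes f g :: "'a::real_normed_vector \<Rightarrow> 'b::real_normed_algebra"
  shows "open U \<Longrightarrow> smooth_on U f \<Longrightarrow> smooth_on U g \<Longrightarrow> smooth_on U (\<lambda>x. f x * g x)"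
  by (simp add: smooth_on_def Ck_on_mult)

lemma smooth_on_minus: "open U \<Longrightarrow> smooth_on U f \<Longrightarrow> smooth_on U (\<lambda>x. - f x)"
  by (rule smooth_on_bounded_linear_comp[OF _ bounded_linear_minus[OF bounded_linear_ident]])

lemma smooth_on_diff:
  "open U \<Longrightarrow> smooth_on U f \<Longrightarrow> smooth_on U g \<Longrightarrow> smooth_on U (\<lambda>x. f x - g x)"
  using smooth_on_add[OF _ _ smooth_on_minus, of U f g] by simp

lemma smooth_on_power:
  fixes f :: "'a::real_normed_vector \<Rightarrow> 'b::real_normed_algebra_1"
  shows "open U \<Longrightarrow> smooth_on U f \<Longrightarrow> smooth_on U (\<lambda>x. f x ^ n)"
  by (induction n) (simp_all add: smooth_on_const smooth_on_mult)

lemma smooth_on_inverse: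
  fixes f :: "'a::real_normed_vector \<Rightarrow> 'b::real_normed_field"
  shows "open U \<Longrightarrow> smooth_on U f \<Longrightarrow> (\<And>x. x \<in> U \<Longrightarrow> f x \<noteq> 0) \<Longrightarrow> smooth_on U (\<lambda>x. inverse (f x))"
  by (simp add: smooth_on_def Ck_on_inverse)

lemma smooth_on_divide:
  fixes f :: "'a::real_normed_vector \<Rightarrow> 'b::real_normed_field"
  shows "open U \<Longrightarrow> smooth_on U f \<Longrightarrow> smooth_on U g \<Longrightarrow> (\<And>x. x \<in> U \<Longrightarrow> g x \<noteq> 0)
    \<Longrightarrow> smooth_on U (\<lambda>x. f x / g x)"
  by (simp add: divide_inverse smooth_on_mult smooth_on_inverse)

lemma smooth_on_sqrt:
  fixes f :: "'a::real_normed_vector \<Rightarrow> real"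
  shows "open U \<Longrightarrow> smooth_on U f \<Longrightarrow> (\<And>x. x \<in> U \<Longrightarrow> f x > 0) \<Longrightarrow> smooth_on U (\<lambda>x. sqrt (f x))"
  by (simp add: smooth_on_def Ck_on_sqrt)

lemma smooth_on_sum:
  "open U \<Longrightarrow> (\<And>i. i \<in> I \<Longrightarrow> smooth_on U (f i)) \<Longrightarrow> smooth_on U (\<lambda>x. \<Sum>i\<in>I. f i x)"
  by (induction I rule: infinite_finite_induct) (simp_all add: smooth_on_const smooth_on_add)

lemma smooth_on_cnj: "open U \<Longrightarrow> smooth_on U f \<Longrightarrow> smooth_on U (\<lambda>x. cnj (f x))"
  by (rule smooth_on_bounded_linear_comp[OF _ bounded_linear_cnj])

lemma smooth_on_of_real:
  "open U \<Longrightarrow> smooth_on U f \<Longrightarrow> smooth_on U (\<lambda>x. complex_of_real (f x))"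
  by (rule smooth_on_bounded_linear_comp[OF _ bounded_linear_of_real])

text \<open>\<open>cmod\<close> itself is not differentiable at 0; its square is the real part of f
  times its conjugate.\<close>

lemma smooth_on_cmod_power2:
  assumes "open U" "smooth_on U f"
  shows "smooth_on U (\<lambda>x. (cmod (f x))\<^sup>2)"
proof -
  have "smooth_on U (\<lambda>x. Re (f x * cnj (f x)))"
    using assms by (intro smooth_on_bounded_linear_comp[OF _ bounded_linear_Re]
        smooth_on_mult smooth_on_cnj)
  then show ?thesis by (simp add: complex_norm_square[symmetric] del: of_real_power)
qed

lemma smooth_on_differentiable: "smooth_on U f \<Longrightarrow> x \<in> U \<Longrightarrow> f differentiable (at x)"
  using Ck_on.simps(2)[of 0 U f] unfolding smooth_on_def by blast

lemma smooth_on_frechet_derivative: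
  "smooth_on U f \<Longrightarrow> smooth_on U (\<lambda>x. frechet_derivative f (at x) v)"
  unfolding smooth_on_def using Ck_on.simps(2) by blast

lemma smooth_on_continuous_on: "smooth_on U f \<Longrightarrow> continuous_on U f"
  unfolding smooth_on_def using Ck_on.simps(1) by blast

lemma smooth_on_bounded_linear:
  assumes "bounded_linear h"
  shows "smooth_on U h"
proof -
  have "frechet_derivative h (at x) v = h v" for x v
    by (rule fun_cong[OF frechet_derivative_at[OF bounded_linear_imp_has_derivative[OF assms]], symmetric])
  then have "Ck_on k U h" for k
    using assms Ck_on_const
    by (cases k) (auto simp: linear_continuous_on bounded_linear_imp_differentiable)
  then show ?thesis by (simp add: smooth_on_def)
qed

section \<open>Symmetry of second derivatives\<close>

text \<open>The second difference is symmetric in v and w, while the right-hand side takes the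
  derivatives in a definite order. Using it in both orders yields the symmetry of second
  derivatives.\<close>

lemma second_difference_mvt:
  fixes f :: "'a::real_normed_vector \<Rightarrow> real"
  assumes "d > 0" and f: "smooth_on U f"
    and U: "\<And>s t. 0 \<le> s \<Longrightarrow> s \<le> d \<Longrightarrow> 0 \<le> t \<Longrightarrow> t \<le> d \<Longrightarrow> p + s *\<^sub>R v + t *\<^sub>R w \<in> U"
  obtains \<xi> \<eta> where "0 < \<xi>" "\<xi> < d" "0 < \<eta>" "\<eta> < d"
    "f (p + d *\<^sub>R v + d *\<^sub>R w) - f (p + d *\<^sub>R v) - f (p + d *\<^sub>R w) + f p
      = d * d * frechet_derivative (\<lambda>x. frechet_derivative f (at x) v)
          (at (p + \<xi> *\<^sub>R v + \<eta> *\<^sub>R w)) w"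
proof -
  have chain: "((\<lambda>s. h (q + s *\<^sub>R u)) has_real_derivative frechet_derivative h (at (q + s *\<^sub>R u)) u) (at s)"
    if "smooth_on U h" "q + s *\<^sub>R u \<in> U" for h :: "'a \<Rightarrow> real" and q u s
  proof -
    have h: "(h has_derivative frechet_derivative h (at (q + s *\<^sub>R u))) (at (q + s *\<^sub>R u))"
      using smooth_on_differentiable[OF that] by (simp add: frechet_derivative_works[symmetric])
    have "((\<lambda>s. q + s *\<^sub>R u) has_derivative (\<lambda>r. r *\<^sub>R u)) (at s)"
      by (auto intro!: derivative_eq_intros)
    from has_derivative_compose[OF this h]
    have "((\<lambda>s. h (q + s *\<^sub>R u)) has_derivative
        (\<lambda>r. frechet_derivative h (at (q + s *\<^sub>R u)) (r *\<^sub>R u))) (at s)" .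
    moreover have "linear (frechet_derivative h (at (q + s *\<^sub>R u)))"
      using h by (rule has_derivative_linear)
    then have "frechet_derivative h (at (q + s *\<^sub>R u)) (r *\<^sub>R u)
        = r * frechet_derivative h (at (q + s *\<^sub>R u)) u" for r
      by (simp add: linear_scale)
    ultimately show ?thesis by (simp add: has_field_derivative_def mult_commute_abs)
  qed
  let ?g = "\<lambda>x. frechet_derivative f (at x) v"
  let ?\<phi> = "\<lambda>s. f (p + d *\<^sub>R w + s *\<^sub>R v) - f (p + s *\<^sub>R v)"
  have "DERIV ?\<phi> s :> ?g (p + d *\<^sub>R w + s *\<^sub>R v) - ?g (p + s *\<^sub>R v)"
    if "0 \<le> s" "s \<le> d" for s
    using that U[of s d] U[of s 0] \<open>d > 0\<close>
    by (intro DERIV_diff chain[OF f]) (simp_all add: algebra_simps)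
  \<comment> \<open>First mean value theorem, in direction v, for the difference of f along the two
    opposite sides of the parallelogram; the second one is in direction w, for the derivative of f
    along v.\<close>
  from MVT2[OF \<open>d > 0\<close>, of ?\<phi>, OF this]
  obtain \<xi> where \<xi>: "0 < \<xi>" "\<xi> < d" and
    e1: "?\<phi> d - ?\<phi> 0 = d * (?g (p + d *\<^sub>R w + \<xi> *\<^sub>R v) - ?g (p + \<xi> *\<^sub>R v))"
    by auto
  let ?\<psi> = "\<lambda>t. ?g (p + \<xi> *\<^sub>R v + t *\<^sub>R w)"
  have "DERIV ?\<psi> t :> frechet_derivative ?g (at (p + \<xi> *\<^sub>R v + t *\<^sub>R w)) w"
    if "0 \<le> t" "t \<le> d" for t
    using that U[of \<xi> t] \<xi> by (intro chain smooth_on_frechet_derivative[OF f]) simp_all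
  from MVT2[OF \<open>d > 0\<close>, of ?\<psi>, OF this]
  obtain \<eta> where \<eta>: "0 < \<eta>" "\<eta> < d" and
    e2: "?\<psi> d - ?\<psi> 0 = d * frechet_derivative ?g (at (p + \<xi> *\<^sub>R v + \<eta> *\<^sub>R w)) w"
    by auto
  have "f (p + d *\<^sub>R v + d *\<^sub>R w) - f (p + d *\<^sub>R v) - f (p + d *\<^sub>R w) + f p = ?\<phi> d - ?\<phi> 0"
    by (simp add: algebra_simps)
  also have "\<dots> = d * (?\<psi> d - ?\<psi> 0)" unfolding e1 by (simp add: algebra_simps)
  also have "\<dots> = d * d * frechet_derivative ?g (at (p + \<xi> *\<^sub>R v + \<eta> *\<^sub>R w)) w"
    unfolding e2 by simp
  finally show ?thesis using that \<xi> \<eta> by blast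
qed

text \<open>If the two mixed derivatives differed at p, continuity would keep each of them, near p,
  within half their distance of its value at p. The mean value points of one and the same second
  difference lie near p and force a common value.\<close>

lemma frechet_derivative_commute_real:
  fixes f :: "'a::real_normed_vector \<Rightarrow> real"
  assumes "open U" "smooth_on U f" "p \<in> U"
  shows "frechet_derivative (\<lambda>x. frechet_derivative f (at x) v) (at p) w
    = frechet_derivative (\<lambda>x. frechet_derivative f (at x) w) (at p) v"
    (is "?A p = ?B p")
proof (rule ccontr)
  assume ne: "?A p \<noteq> ?B p"
  define e where "e = dist (?A p) (?B p) / 2"
  have "e > 0" using ne by (simp add: e_def)
  have "continuous_on U ?A" "continuous_on U ?B"
    using assms by (auto intro!: smooth_on_continuous_on smooth_on_frechet_derivative)
  then have "isCont ?A p" "isCont ?B p"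
    using assms continuous_on_eq_continuous_at by blast+
  then have "(?A \<longlongrightarrow> ?A p) (nhds p)" "(?B \<longlongrightarrow> ?B p) (nhds p)"
    using tendsto_at_iff_tendsto_nhds[of ?A p] tendsto_at_iff_tendsto_nhds[of ?B p]
    unfolding isCont_def by blast+
  then have "\<forall>\<^sub>F x in nhds p. dist (?A x) (?A p) < e" "\<forall>\<^sub>F x in nhds p. dist (?B x) (?B p) < e"
    using \<open>e > 0\<close> tendstoD by blast+
  moreover have "\<forall>\<^sub>F x in nhds p. x \<in> U" using assms eventually_nhds by blast
  ultimately have "\<forall>\<^sub>F x in nhds p. dist (?A x) (?A p) < e \<and> dist (?B x) (?B p) < e \<and> x \<in> U"
    by eventually_elim simp
  then obtain r where "r > 0" and
    r: "\<And>x. dist x p < r \<Longrightarrow> dist (?A x) (?A p) < e \<and> dist (?B x) (?B p) < e \<and> x \<in> U"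
    unfolding eventually_nhds_metric by blast
  \<comment> \<open>With this d the parallelogram spanned by d v and d w stays within r/2 of p; the
    summand 1 keeps the denominator positive when v = w = 0.\<close>
  define d where "d = r / (2 * (norm v + norm w + 1))"
  have n: "norm v + norm w + 1 > 0" by (simp add: add_nonneg_pos)
  then have "d > 0" using \<open>r > 0\<close> by (simp add: d_def)
  have near: "dist (p + s *\<^sub>R v + t *\<^sub>R w) p < r" if "0 \<le> s" "s \<le> d" "0 \<le> t" "t \<le> d" for s t
  proof -
    have "dist (p + s *\<^sub>R v + t *\<^sub>R w) p \<le> s * norm v + t * norm w"
      using norm_triangle_ineq[of "s *\<^sub>R v" "t *\<^sub>R w"] that by (simp add: dist_norm algebra_simps)
    also have "\<dots> \<le> d * norm v + d * norm w" using that by (intro add_mono mult_right_mono) auto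
    also have "\<dots> \<le> d * (norm v + norm w + 1)" using \<open>d > 0\<close> by (simp add: algebra_simps)
    also have "\<dots> = r / 2" using n unfolding d_def
      by (cases "norm v + norm w + 1 = 0") (simp_all only: divide_divide_eq_left[symmetric] mult.commute[of 2] times_divide_eq_left nonzero_mult_div_cancel_right nonzero_divide_eq_eq simp_thms less_irrefl)
    finally show ?thesis using \<open>r > 0\<close> by simp
  qed
  obtain s t where st: "0 < s" "s < d" "0 < t" "t < d" and
    1: "f (p + d *\<^sub>R v + d *\<^sub>R w) - f (p + d *\<^sub>R v) - f (p + d *\<^sub>R w) + f p
        = d * d * ?A (p + s *\<^sub>R v + t *\<^sub>R w)"
    using second_difference_mvt[OF \<open>d > 0\<close> assms(2), of p v w] near r by blast
  have near': "dist (p + s *\<^sub>R w + t *\<^sub>R v) p < r" if "0 \<le> s" "s \<le> d" "0 \<le> t" "t \<le> d" for s t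
    using near[of t s] that by (simp add: algebra_simps)
  obtain s' t' where st': "0 < s'" "s' < d" "0 < t'" "t' < d" and
    2: "f (p + d *\<^sub>R w + d *\<^sub>R v) - f (p + d *\<^sub>R w) - f (p + d *\<^sub>R v) + f p
        = d * d * ?B (p + s' *\<^sub>R w + t' *\<^sub>R v)"
    using second_difference_mvt[OF \<open>d > 0\<close> assms(2), of p w v] near' r by blast
  have "d * d * ?A (p + s *\<^sub>R v + t *\<^sub>R w) = d * d * ?B (p + s' *\<^sub>R w + t' *\<^sub>R v)"
    using 1 2 by (simp add: algebra_simps)
  then have eq: "?A (p + s *\<^sub>R v + t *\<^sub>R w) = ?B (p + s' *\<^sub>R w + t' *\<^sub>R v)"
    using \<open>d > 0\<close> by simp
  have "dist (?A p) (?A (p + s *\<^sub>R v + t *\<^sub>R w)) < e"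
    using r[OF near[of s t]] st by (simp add: dist_commute)
  moreover have "dist (?B p) (?A (p + s *\<^sub>R v + t *\<^sub>R w)) < e"
    unfolding eq using r[OF near'[of s' t']] st' by (simp add: dist_commute)
  ultimately have "dist (?A p) (?B p) < dist (?A p) (?B p)"
    unfolding e_def by (rule dist_triangle_half_l)
  then show False by simp
qed

lemma frechet_derivative_bounded_linear_comp:
  assumes "bounded_linear h" "f differentiable (at x)"
  shows "frechet_derivative (\<lambda>x. h (f x)) (at x) v = h (frechet_derivative f (at x) v)"
  by (rule fun_cong[OF frechet_derivative_at[OF bounded_linear.has_derivative[OF assms(1)]], symmetric])
    (use assms(2) in \<open>simp add: frechet_derivative_works[symmetric]\<close>)

text \<open>The mean value theorem is real, so the complex case goes through real and imaginary
  parts.\<close>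

lemma frechet_derivative_commute:
  fixes f :: "'a::real_normed_vector \<Rightarrow> complex"
  assumes "open U" "smooth_on U f" "p \<in> U"
  shows "frechet_derivative (\<lambda>x. frechet_derivative f (at x) v) (at p) w
    = frechet_derivative (\<lambda>x. frechet_derivative f (at x) w) (at p) v"
proof -
  have part: "h (frechet_derivative (\<lambda>x. frechet_derivative f (at x) v) (at p) w)
      = frechet_derivative (\<lambda>x. frechet_derivative (\<lambda>x. h (f x)) (at x) v) (at p) w"
    if "bounded_linear h" for h :: "complex \<Rightarrow> real" and v w
  proof -
    have "h (frechet_derivative (\<lambda>x. frechet_derivative f (at x) v) (at p) w)
        = frechet_derivative (\<lambda>x. h (frechet_derivative f (at x) v)) (at p) w"
      using assms
      by (intro frechet_derivative_bounded_linear_comp[OF that, symmetric]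
          smooth_on_differentiable[of U] smooth_on_frechet_derivative)
    also have "\<dots> = frechet_derivative (\<lambda>x. frechet_derivative (\<lambda>x. h (f x)) (at x) v) (at p) w"
      using smooth_on_differentiable[OF assms(2)]
      by (intro fun_cong[OF frechet_derivative_cong_open[OF assms(1,3)]])
        (simp add: frechet_derivative_bounded_linear_comp[OF that])
    finally show ?thesis .
  qed
  have comm: "frechet_derivative (\<lambda>x. frechet_derivative (\<lambda>x. h (f x)) (at x) v) (at p) w
      = frechet_derivative (\<lambda>x. frechet_derivative (\<lambda>x. h (f x)) (at x) w) (at p) v"
    if "bounded_linear h" for h :: "complex \<Rightarrow> real"
    by (rule frechet_derivative_commute_real[OF assms(1) smooth_on_bounded_linear_comp[OF assms(1) that assms(2)] assms(3)])
  show ?thesis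
    by (intro complex_eqI) (simp_all only: part[OF bounded_linear_Re] part[OF bounded_linear_Im]
        comm[OF bounded_linear_Re] comm[OF bounded_linear_Im])
qed

section \<open>Exterior calculus on the jet space\<close>

text \<open>Every \<open>pd \<mu>\<close> is a fixed complex combination of two directional derivatives.\<close>

fun pd_dir1 :: "coord \<Rightarrow> J6" where
  "pd_dir1 cZ = (1, 0, 0, 0)"
| "pd_dir1 cR = (0, 0, 1, 0)"
| "pd_dir1 cs = (0, 0, 0, 1)"
| "pd_dir1 css = (0, 0, 0, 1)"
| "pd_dir1 _ = (0, 1, 0, 0)"

text \<open>For \<open>cZ\<close> and \<open>cR\<close> the second direction is a dummy, since its
  coefficient \<open>pd_coef2\<close> is 0.\<close>

fun pd_dir2 :: "coord \<Rightarrow> J6" where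
  "pd_dir2 cs = (0, 0, 0, \<i>)"
| "pd_dir2 css = (0, 0, 0, \<i>)"
| "pd_dir2 _ = (0, \<i>, 0, 0)"

fun pd_coef1 :: "coord \<Rightarrow> complex" where
  "pd_coef1 cZ = 1"
| "pd_coef1 cR = 1"
| "pd_coef1 _ = 1 / 2"

fun pd_coef2 :: "coord \<Rightarrow> complex" where
  "pd_coef2 cW = - \<i> / 2"
| "pd_coef2 cWs = \<i> / 2"
| "pd_coef2 cs = - \<i> / 2"
| "pd_coef2 css = \<i> / 2"
| "pd_coef2 _ = 0"

section \<open>Differentiation rules for the Wirtinger derivatives\<close>

lemma pd_conv_frechet_derivative:
  "pd \<mu> f = (\<lambda>p. pd_coef1 \<mu> * frechet_derivative f (at p) (pd_dir1 \<mu>)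
     + pd_coef2 \<mu> * frechet_derivative f (at p) (pd_dir2 \<mu>))"
  by (rule ext, cases \<mu>) (simp_all add: field_simps)

lemma pd_const [simp]: "pd \<mu> (\<lambda>x. c) p = 0"
  by (simp add: pd_conv_frechet_derivative)

lemma frechet_derivative_eqI:
  "(f has_derivative f') (at x) \<Longrightarrow> frechet_derivative f (at x) = f'"
  using frechet_derivative_at by metis

lemma pd_add:
  assumes "f differentiable (at p)" "g differentiable (at p)"
  shows "pd \<mu> (\<lambda>x. f x + g x) p = pd \<mu> f p + pd \<mu> g p"
proof -
  have "((\<lambda>x. f x + g x) has_derivative
      (\<lambda>v. frechet_derivative f (at p) v + frechet_derivative g (at p) v)) (at p)"
    by (rule has_derivative_add) (use assms in \<open>simp_all add: frechet_derivative_works[symmetric]\<close>)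
  from frechet_derivative_eqI[OF this] show ?thesis
    by (simp add: pd_conv_frechet_derivative algebra_simps)
qed

lemma pd_mult:
  assumes "f differentiable (at p)" "g differentiable (at p)"
  shows "pd \<mu> (\<lambda>x. f x * g x) p = f p * pd \<mu> g p + pd \<mu> f p * g p"
proof -
  have "((\<lambda>x. f x * g x) has_derivative
      (\<lambda>v. f p * frechet_derivative g (at p) v + frechet_derivative f (at p) v * g p)) (at p)"
    by (rule has_derivative_mult) (use assms in \<open>simp_all add: frechet_derivative_works[symmetric]\<close>)
  from frechet_derivative_eqI[OF this] show ?thesis
    by (simp add: pd_conv_frechet_derivative algebra_simps)
qed

lemma pd_cmult:
  assumes "f differentiable (at p)"
  shows "pd \<mu> (\<lambda>x. c * f x) p = c * pd \<mu> f p"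
  using pd_mult[of "\<lambda>x. c" p f \<mu>] assms by simp

lemma pd_minus:
  assumes "f differentiable (at p)"
  shows "pd \<mu> (\<lambda>x. - f x) p = - pd \<mu> f p"
  using pd_cmult[of f p \<mu> "-1"] assms by simp

lemma pd_diff:
  assumes "f differentiable (at p)" "g differentiable (at p)"
  shows "pd \<mu> (\<lambda>x. f x - g x) p = pd \<mu> f p - pd \<mu> g p"
  using pd_add[of f p "\<lambda>x. - g x" \<mu>] assms by (simp add: pd_minus)

lemma pd_sum:
  assumes "finite I" "\<And>i. i \<in> I \<Longrightarrow> f i differentiable (at p)"
  shows "pd \<mu> (\<lambda>x. \<Sum>i\<in>I. f i x) p = (\<Sum>i\<in>I. pd \<mu> (f i) p)"
  using assms
proof (induction I)
  case (insert i I)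
  have "(\<lambda>x. \<Sum>i\<in>I. f i x) differentiable (at p)"
    using insert by (intro differentiable_sum) auto
  with insert show ?case by (simp add: pd_add)
qed simp

lemma pd_cong_open:
  assumes "open U" "p \<in> U" "\<And>x. x \<in> U \<Longrightarrow> f x = g x"
  shows "pd \<mu> f p = pd \<mu> g p"
  using frechet_derivative_cong_open[OF assms] by (simp add: pd_conv_frechet_derivative)

lemma smooth_on_pd: "open U \<Longrightarrow> smooth_on U f \<Longrightarrow> smooth_on U (pd \<mu> f)"
  unfolding pd_conv_frechet_derivative
  by (intro smooth_on_add smooth_on_mult smooth_on_const smooth_on_frechet_derivative)

lemma pd_commute:
  assumes "open U" "smooth_on U f" "p \<in> U"
  shows "pd \<mu> (pd \<nu> f) p = pd \<nu> (pd \<mu> f) p"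
proof -
  have d: "(\<lambda>x. frechet_derivative f (at x) v) differentiable (at p)" for v
    using assms smooth_on_differentiable smooth_on_frechet_derivative by blast
  have m: "(\<lambda>x. c * frechet_derivative f (at x) v) differentiable (at p)" for v c
    using d by (intro differentiable_mult) simp_all
  have pd2: "pd \<mu> (pd \<nu> f) p = pd_coef1 \<nu> * pd \<mu> (\<lambda>x. frechet_derivative f (at x) (pd_dir1 \<nu>)) p
      + pd_coef2 \<nu> * pd \<mu> (\<lambda>x. frechet_derivative f (at x) (pd_dir2 \<nu>)) p" for \<mu> \<nu>
    by (subst pd_conv_frechet_derivative[of \<nu>]) (simp add: pd_add[OF m m] pd_cmult[OF d])
  show ?thesis
    unfolding pd2 unfolding pd_conv_frechet_derivative
    by (simp add: frechet_derivative_commute[OF assms, of "pd_dir1 \<mu>"]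
        frechet_derivative_commute[OF assms, of "pd_dir2 \<mu>"] algebra_simps)
qed

text \<open>The exterior derivative of a two-form as a cyclic sum, which is correct for
  antisymmetric components.\<close>

definition ext_d2 :: "form2 \<Rightarrow> coord \<Rightarrow> coord \<Rightarrow> coord \<Rightarrow> J6 \<Rightarrow> complex" where
  "ext_d2 \<Omega> = (\<lambda>\<mu> \<nu> \<kappa> p. pd \<mu> (\<Omega> \<nu> \<kappa>) p + pd \<nu> (\<Omega> \<kappa> \<mu>) p + pd \<kappa> (\<Omega> \<mu> \<nu>) p)"

text \<open>This is \<open>\<Omega> \<and> \<beta>\<close> only for antisymmetric \<open>\<Omega>\<close>, hence \<open>\<alpha> \<and> d\<beta>\<close> is written \<open>wedge21 (ext_d \<beta>) \<alpha>\<close>.\<close>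

definition wedge21 :: "form2 \<Rightarrow> form1 \<Rightarrow> coord \<Rightarrow> coord \<Rightarrow> coord \<Rightarrow> J6 \<Rightarrow> complex" where
  "wedge21 \<Omega> \<beta> = (\<lambda>\<mu> \<nu> \<kappa> p. \<Omega> \<mu> \<nu> p * \<beta> \<kappa> p + \<Omega> \<nu> \<kappa> p * \<beta> \<mu> p + \<Omega> \<kappa> \<mu> p * \<beta> \<nu> p)"

definition smooth_form2 :: "J6 set \<Rightarrow> form2 \<Rightarrow> bool" where
  "smooth_form2 U \<Omega> \<longleftrightarrow> (\<forall>\<mu> \<nu>. smooth_on U (\<Omega> \<mu> \<nu>))"

lemma smooth_form1D: "smooth_form1 U \<alpha> \<Longrightarrow> smooth_on U (\<alpha> \<mu>)"
  by (simp add: smooth_form1_def)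

lemma smooth_form1_differentiable: "smooth_form1 U \<alpha> \<Longrightarrow> p \<in> U \<Longrightarrow> \<alpha> \<mu> differentiable (at p)"
  unfolding smooth_form1_def using smooth_on_differentiable by blast

lemma smooth_form2_differentiable: "smooth_form2 U \<Omega> \<Longrightarrow> p \<in> U \<Longrightarrow> \<Omega> \<mu> \<nu> differentiable (at p)"
  unfolding smooth_form2_def using smooth_on_differentiable by blast

lemma smooth_form2_ext_d: "open U \<Longrightarrow> smooth_form1 U \<alpha> \<Longrightarrow> smooth_form2 U (ext_d \<alpha>)"
  unfolding smooth_form2_def ext_d_def smooth_form1_def
  by (intro allI smooth_on_diff smooth_on_pd) blast+

lemma smooth_form2_wedge:
  "open U \<Longrightarrow> smooth_form1 U \<alpha> \<Longrightarrow> smooth_form1 U \<beta> \<Longrightarrow> smooth_form2 U (wedge \<alpha> \<beta>)"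
  unfolding smooth_form2_def wedge_def smooth_form1_def
  by (intro allI smooth_on_diff smooth_on_mult) blast+

lemma ext_d2_ext_d:
  assumes "open U" "smooth_form1 U \<alpha>" "p \<in> U"
  shows "ext_d2 (ext_d \<alpha>) \<mu> \<nu> \<kappa> p = 0"
proof -
  have d: "pd \<mu> (\<alpha> \<nu>) differentiable (at p)" for \<mu> \<nu>
    using assms smooth_form1D smooth_on_pd smooth_on_differentiable by blast
  show ?thesis
    using assms by (simp add: ext_d2_def ext_d_def pd_diff[OF d d] smooth_form1D
        pd_commute[of U _ p \<mu>] pd_commute[of U _ p \<nu> \<kappa>])
qed

lemma ext_d2_wedge:
  assumes "smooth_form1 U \<alpha>" "smooth_form1 U \<beta>" "p \<in> U"
  shows "ext_d2 (wedge \<alpha> \<beta>) \<mu> \<nu> \<kappa> p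
    = wedge21 (ext_d \<alpha>) \<beta> \<mu> \<nu> \<kappa> p - wedge21 (ext_d \<beta>) \<alpha> \<mu> \<nu> \<kappa> p"
proof -
  note d = smooth_form1_differentiable[OF assms(1,3)] smooth_form1_differentiable[OF assms(2,3)]
  have m: "(\<lambda>x. \<alpha> \<mu> x * \<beta> \<nu> x) differentiable (at p)" for \<mu> \<nu>
    using d by (intro differentiable_mult)
  show ?thesis
    by (simp add: ext_d2_def wedge_def wedge21_def ext_d_def pd_diff[OF m m] pd_mult[OF d]
        algebra_simps)
qed

lemma ext_d2_add:
  assumes "smooth_form2 U \<Omega>" "smooth_form2 U \<Omega>'" "p \<in> U"
  shows "ext_d2 (\<lambda>\<mu> \<nu> p. \<Omega> \<mu> \<nu> p + \<Omega>' \<mu> \<nu> p) \<mu> \<nu> \<kappa> p = ext_d2 \<Omega> \<mu> \<nu> \<kappa> p + ext_d2 \<Omega>' \<mu> \<nu> \<kappa> p"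
  using assms by (simp add: ext_d2_def pd_add smooth_form2_differentiable)

lemma ext_d2_sum:
  assumes "finite I" "\<And>i. i \<in> I \<Longrightarrow> smooth_form2 U (\<Omega> i)" "p \<in> U"
  shows "ext_d2 (\<lambda>\<mu> \<nu> p. \<Sum>i\<in>I. \<Omega> i \<mu> \<nu> p) \<mu> \<nu> \<kappa> p = (\<Sum>i\<in>I. ext_d2 (\<Omega> i) \<mu> \<nu> \<kappa> p)"
proof -
  have "\<Omega> i \<mu> \<nu> differentiable (at p)" if "i \<in> I" for i \<mu> \<nu>
    using assms that smooth_form2_differentiable by blast
  then show ?thesis using assms(1) by (simp add: ext_d2_def pd_sum sum.distrib)
qed

lemma smooth_form2_sum:
  "open U \<Longrightarrow> (\<And>i. i \<in> I \<Longrightarrow> smooth_form2 U (\<Omega> i)) \<Longrightarrow> smooth_form2 U (\<lambda>\<mu> \<nu> p. \<Sum>i\<in>I. \<Omega> i \<mu> \<nu> p)"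
  unfolding smooth_form2_def by (intro allI smooth_on_sum) blast+

lemma wedge21_add:
  "wedge21 (\<lambda>\<mu> \<nu> p. \<Omega> \<mu> \<nu> p + \<Omega>' \<mu> \<nu> p) \<beta> \<mu> \<nu> \<kappa> p = wedge21 \<Omega> \<beta> \<mu> \<nu> \<kappa> p + wedge21 \<Omega>' \<beta> \<mu> \<nu> \<kappa> p"
  by (simp add: wedge21_def algebra_simps)

lemma wedge21_sum:
  "wedge21 (\<lambda>\<mu> \<nu> p. \<Sum>i\<in>I. \<Omega> i \<mu> \<nu> p) \<beta> \<mu> \<nu> \<kappa> p = (\<Sum>i\<in>I. wedge21 (\<Omega> i) \<beta> \<mu> \<nu> \<kappa> p)"
  by (simp add: wedge21_def sum.distrib sum_distrib_right)

lemma wedge21_wedge_rotate: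
  "wedge21 (wedge \<alpha> \<beta>) \<gamma> \<mu> \<nu> \<kappa> p = wedge21 (wedge \<beta> \<gamma>) \<alpha> \<mu> \<nu> \<kappa> p"
  by (simp add: wedge21_def wedge_def algebra_simps)

text \<open>The identity dR = R \<and> Theta - Theta \<and> R for a matrix of one-forms. The terms
  with d Theta come from the graded Leibniz rule, and the cubic terms cancel on the right. The first
  Bianchi identity and the one for the Weyl form are both entries of it.\<close>

lemma cartan_curv_bianchi:
  assumes "open U" "\<And>A B. smooth_form1 U (\<Theta> A B)" "p \<in> U"
  shows "ext_d2 (cartan_curv \<Theta> A B) \<mu> \<nu> \<kappa> p
    = (\<Sum>C\<in>UNIV. wedge21 (cartan_curv \<Theta> A C) (\<Theta> C B) \<mu> \<nu> \<kappa> p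
        - wedge21 (cartan_curv \<Theta> C B) (\<Theta> A C) \<mu> \<nu> \<kappa> p)"
proof -
  note sm = smooth_form2_ext_d[OF assms(1,2)] smooth_form2_wedge[OF assms(1,2,2)]
  have "ext_d2 (cartan_curv \<Theta> A B) \<mu> \<nu> \<kappa> p
      = ext_d2 (ext_d (\<Theta> A B)) \<mu> \<nu> \<kappa> p + (\<Sum>C\<in>UNIV. ext_d2 (wedge (\<Theta> A C) (\<Theta> C B)) \<mu> \<nu> \<kappa> p)"
    unfolding cartan_curv_def
    using assms(3) sm
    by (subst ext_d2_add[where U = U]) (auto simp: ext_d2_sum[where U = U] intro!: smooth_form2_sum assms(1))
  also have "\<dots> = (\<Sum>C\<in>UNIV. wedge21 (ext_d (\<Theta> A C)) (\<Theta> C B) \<mu> \<nu> \<kappa> p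
      - wedge21 (ext_d (\<Theta> C B)) (\<Theta> A C) \<mu> \<nu> \<kappa> p)"
    using assms by (simp add: ext_d2_ext_d ext_d2_wedge[where U = U])
  finally have 1: "ext_d2 (cartan_curv \<Theta> A B) \<mu> \<nu> \<kappa> p = \<dots>" .
  \<comment> \<open>Associativity of Theta \<and> Theta \<and> Theta: the cubic parts of R \<and>
    Theta and Theta \<and> R agree.\<close>
  have "(\<Sum>C\<in>UNIV. \<Sum>D\<in>UNIV. wedge21 (wedge (\<Theta> A D) (\<Theta> D C)) (\<Theta> C B) \<mu> \<nu> \<kappa> p)
      = (\<Sum>D\<in>UNIV. \<Sum>C\<in>UNIV. wedge21 (wedge (\<Theta> D C) (\<Theta> C B)) (\<Theta> A D) \<mu> \<nu> \<kappa> p)"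
    by (subst sum.swap) (simp add: wedge21_wedge_rotate)
  then have "(\<Sum>C\<in>UNIV. wedge21 (cartan_curv \<Theta> A C) (\<Theta> C B) \<mu> \<nu> \<kappa> p
      - wedge21 (cartan_curv \<Theta> C B) (\<Theta> A C) \<mu> \<nu> \<kappa> p)
    = (\<Sum>C\<in>UNIV. wedge21 (ext_d (\<Theta> A C)) (\<Theta> C B) \<mu> \<nu> \<kappa> p
      - wedge21 (ext_d (\<Theta> C B)) (\<Theta> A C) \<mu> \<nu> \<kappa> p)"
    unfolding cartan_curv_def
    by (simp add: wedge21_add wedge21_sum sum.distrib sum_subtractf)
  with 1 show ?thesis by simp
qed

text \<open>From g Theta' = Theta g + dg follows g R' = R g. Differentiating the hypothesis produces
  terms in dg, and moving g through Theta' \<and> Theta' produces the opposite ones.\<close>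

lemma cartan_curv_gauge:
  assumes U: "open U" "p \<in> U"
    and sm: "\<And>A B. smooth_on U (g A B)" "\<And>A B. smooth_form1 U (\<Theta> A B)" "\<And>A B. smooth_form1 U (\<Theta>' A B)"
    and gauge: "\<And>q A B \<mu>. q \<in> U \<Longrightarrow> (\<Sum>C\<in>UNIV. g A C q * \<Theta>' C B \<mu> q)
      = (\<Sum>C\<in>UNIV. \<Theta> A C \<mu> q * g C B q) + pd \<mu> (g A B) q"
  shows "(\<Sum>C\<in>UNIV. g A C p * cartan_curv \<Theta>' C B \<mu> \<nu> p)
    = (\<Sum>C\<in>UNIV. cartan_curv \<Theta> A C \<mu> \<nu> p * g C B p)"
proof -
  note dg = smooth_on_differentiable[OF sm(1) U(2)]
  note dT = smooth_form1_differentiable[OF sm(2) U(2)] smooth_form1_differentiable[OF sm(3) U(2)]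
  have dpd: "pd \<mu> (g A B) differentiable (at p)" for \<mu> A B
    using U smooth_on_pd[OF U(1) sm(1)] smooth_on_differentiable by blast
  have d1: "(\<Sum>C\<in>UNIV. g A C p * pd \<mu> (\<Theta>' C B \<nu>) p + pd \<mu> (g A C) p * \<Theta>' C B \<nu> p)
      = (\<Sum>C\<in>UNIV. \<Theta> A C \<nu> p * pd \<mu> (g C B) p + pd \<mu> (\<Theta> A C \<nu>) p * g C B p)
        + pd \<mu> (pd \<nu> (g A B)) p" for A B \<mu> \<nu>
  proof -
    have "pd \<mu> (\<lambda>q. \<Sum>C\<in>UNIV. g A C q * \<Theta>' C B \<nu> q) p
        = pd \<mu> (\<lambda>q. (\<Sum>C\<in>UNIV. \<Theta> A C \<nu> q * g C B q) + pd \<nu> (g A B) q) p"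
      using U gauge by (intro pd_cong_open)
    then show ?thesis
      using dg dT dpd by (simp add: pd_sum pd_add pd_mult differentiable_mult)
  qed
  \<comment> \<open>Antisymmetrizing \<open>d1\<close> removes the second derivatives of g, as d(dg)
    = 0.\<close>
  have d2: "(\<Sum>C\<in>UNIV. g A C p * ext_d (\<Theta>' C B) \<mu> \<nu> p)
      = (\<Sum>C\<in>UNIV. ext_d (\<Theta> A C) \<mu> \<nu> p * g C B p)
      + (\<Sum>C\<in>UNIV. \<Theta> A C \<nu> p * pd \<mu> (g C B) p - \<Theta> A C \<mu> p * pd \<nu> (g C B) p
          - pd \<mu> (g A C) p * \<Theta>' C B \<nu> p + pd \<nu> (g A C) p * \<Theta>' C B \<mu> p)"
    using d1[of A \<mu> B \<nu>] d1[of A \<nu> B \<mu>] pd_commute[OF U(1) sm(1) U(2), of \<mu> \<nu> A B]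
    by (simp add: ext_d_def sum.distrib sum_subtractf algebra_simps)
  \<comment> \<open>The gauge equation is applied to the left factor and then to the right one. The
    products are not yet antisymmetrized; that happens when the identity is used for both orders of
    the indices.\<close>
  have quad: "(\<Sum>C\<in>UNIV. g A C p * (\<Sum>D\<in>UNIV. \<Theta>' C D \<mu> p * \<Theta>' D B \<nu> p))
      = (\<Sum>C\<in>UNIV. (\<Sum>D\<in>UNIV. \<Theta> A D \<mu> p * \<Theta> D C \<nu> p) * g C B p)
      + (\<Sum>C\<in>UNIV. \<Theta> A C \<mu> p * pd \<nu> (g C B) p + pd \<mu> (g A C) p * \<Theta>' C B \<nu> p)" for \<mu> \<nu>
  proof -
    have "(\<Sum>C\<in>UNIV. g A C p * (\<Sum>D\<in>UNIV. \<Theta>' C D \<mu> p * \<Theta>' D B \<nu> p))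
        = (\<Sum>D\<in>UNIV. (\<Sum>C\<in>UNIV. g A C p * \<Theta>' C D \<mu> p) * \<Theta>' D B \<nu> p)"
      unfolding sum_distrib_left sum_distrib_right by (subst sum.swap) (simp add: mult.assoc)
    also have "\<dots> = (\<Sum>D\<in>UNIV. (\<Sum>C\<in>UNIV. \<Theta> A C \<mu> p * g C D p) * \<Theta>' D B \<nu> p)
        + (\<Sum>D\<in>UNIV. pd \<mu> (g A D) p * \<Theta>' D B \<nu> p)"
      by (simp add: gauge[OF U(2)] algebra_simps sum.distrib)
    also have "(\<Sum>D\<in>UNIV. (\<Sum>C\<in>UNIV. \<Theta> A C \<mu> p * g C D p) * \<Theta>' D B \<nu> p)
        = (\<Sum>C\<in>UNIV. \<Theta> A C \<mu> p * (\<Sum>D\<in>UNIV. g C D p * \<Theta>' D B \<nu> p))"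
      unfolding sum_distrib_left sum_distrib_right by (subst sum.swap) (simp add: mult.assoc)
    also have "\<dots> = (\<Sum>C\<in>UNIV. \<Theta> A C \<mu> p * (\<Sum>D\<in>UNIV. \<Theta> C D \<nu> p * g D B p))
        + (\<Sum>C\<in>UNIV. \<Theta> A C \<mu> p * pd \<nu> (g C B) p)"
      by (simp add: gauge[OF U(2)] algebra_simps sum.distrib)
    also have "(\<Sum>C\<in>UNIV. \<Theta> A C \<mu> p * (\<Sum>D\<in>UNIV. \<Theta> C D \<nu> p * g D B p))
        = (\<Sum>C\<in>UNIV. (\<Sum>D\<in>UNIV. \<Theta> A D \<mu> p * \<Theta> D C \<nu> p) * g C B p)"
      unfolding sum_distrib_left sum_distrib_right by (subst sum.swap) (simp add: mult.assoc)
    finally show ?thesis by (simp add: sum.distrib)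
  qed
  show ?thesis
    unfolding cartan_curv_def wedge_def
    using d2 quad[of \<mu> \<nu>] quad[of \<nu> \<mu>]
    by (simp add: distrib_left distrib_right sum.distrib sum_subtractf right_diff_distrib left_diff_distrib)
qed

section \<open>The curvature of the conformal connection, block by block\<close>

lemma sum_cidx: "(\<Sum>C\<in>UNIV. f C) = f Top + f Bot + (\<Sum>i\<in>UNIV. f (Mid i))"
proof -
  have "(\<Sum>C\<in>range Mid. f C) = (\<Sum>i\<in>UNIV. f (Mid i))"
    by (subst sum.reindex) (auto simp: inj_on_def)
  moreover have "Top \<notin> insert Bot (range Mid)" "Bot \<notin> range Mid" by auto
  ultimately show ?thesis
    unfolding UNIV_cidx by (simp add: add.assoc)
qed

lemma sum_idx6: "(\<Sum>L\<in>UNIV. f L) = f Fs + f Fss + (\<Sum>i\<in>UNIV. f (Fr i))"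
proof -
  have "(\<Sum>L\<in>range Fr. f L) = (\<Sum>i\<in>UNIV. f (Fr i))"
    by (subst sum.reindex) (auto simp: inj_on_def)
  moreover have "Fs \<notin> insert Fss (range Fr)" "Fss \<notin> range Fr" by auto
  ultimately show ?thesis
    unfolding UNIV_idx6 by (simp add: add.assoc)
qed

lemma sum_idx4: "(\<Sum>i\<in>UNIV. f i) = f N0 + f Np + f Nm + f N1"
  by (simp add: UNIV_idx4 add.assoc)

lemma eta_commute: "eta i j = eta j i"
  by (cases i; cases j) simp_all

text \<open>Since eta is its own inverse, contracting with it once more lowers a raised index. The
  matrix blocks give identities with a raised index; the tensor identities are wanted with lowered
  ones.\<close>

lemma eta_eta_contract: "(\<Sum>k\<in>UNIV. eta i k * (\<Sum>l\<in>UNIV. eta k l * f l)) = f i"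
  by (cases i) (simp_all add: sum_idx4)

text \<open>Oriented so that simplification brings index pairs into the order \<open>N0\<close>,
  \<open>Np\<close>, \<open>Nm\<close>, \<open>N1\<close>; the general rule
  \<open>skew_part_swap\<close> would rewrite forever.\<close>

lemma skew_part_skew:
  "skew_part \<omega> i i \<mu> p = 0"
  "skew_part \<omega> Np N0 \<mu> p = - skew_part \<omega> N0 Np \<mu> p"
  "skew_part \<omega> Nm N0 \<mu> p = - skew_part \<omega> N0 Nm \<mu> p"
  "skew_part \<omega> N1 N0 \<mu> p = - skew_part \<omega> N0 N1 \<mu> p"
  "skew_part \<omega> Nm Np \<mu> p = - skew_part \<omega> Np Nm \<mu> p"
  "skew_part \<omega> N1 Np \<mu> p = - skew_part \<omega> Np N1 \<mu> p"
  "skew_part \<omega> N1 Nm \<mu> p = - skew_part \<omega> Nm N1 \<mu> p"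
  by (simp_all add: skew_part_def field_simps)

lemma skew_part_swap: "skew_part \<omega> i j \<mu> p = - skew_part \<omega> j i \<mu> p"
  by (simp add: skew_part_def field_simps)

lemma ext_d_lincomb:
  assumes "finite I" "\<And>k \<mu>. k \<in> I \<Longrightarrow> \<alpha> k \<mu> differentiable (at p)"
  shows "ext_d (\<lambda>\<mu> p. \<Sum>k\<in>I. c k * \<alpha> k \<mu> p) \<mu> \<nu> p = (\<Sum>k\<in>I. c k * ext_d (\<alpha> k) \<mu> \<nu> p)"
proof -
  have "(\<lambda>p. c k * \<alpha> k \<mu> p) differentiable (at p)" if "k \<in> I" for k \<mu>
    using assms that by (intro differentiable_mult) simp_all
  then show ?thesis
    using assms by (simp add: ext_d_def pd_sum pd_cmult sum_subtractf right_diff_distrib)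
qed

lemma ext_d_uminus:
  assumes "\<And>\<mu>. \<alpha> \<mu> differentiable (at p)"
  shows "ext_d (\<lambda>\<mu> p. - \<alpha> \<mu> p) \<mu> \<nu> p = - ext_d \<alpha> \<mu> \<nu> p"
  using assms by (simp add: ext_d_def pd_minus)

lemma ext_d_zero: "ext_d (\<lambda>\<mu> p. 0) \<mu> \<nu> p = 0"
  by (simp add: ext_d_def)

lemma ext_d_cong_open:
  assumes "open U" "p \<in> U" "\<And>\<mu> q. q \<in> U \<Longrightarrow> \<alpha> \<mu> q = \<beta> \<mu> q"
  shows "ext_d \<alpha> \<mu> \<nu> p = ext_d \<beta> \<mu> \<nu> p"
  using pd_cong_open[OF assms(1,2), of "\<alpha> \<mu>" "\<beta> \<mu>" \<nu>]
    pd_cong_open[OF assms(1,2), of "\<alpha> \<nu>" "\<beta> \<nu>" \<mu>] assms(3)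
  by (simp add: ext_d_def)

lemma smooth_form1_skew_part:
  assumes "open U" "\<And>i j. smooth_form1 U (\<omega> i j)"
  shows "smooth_form1 U (skew_part \<omega> i j)"
  using assms unfolding smooth_form1_def skew_part_def
  by (intro allI smooth_on_divide smooth_on_diff smooth_on_const) simp_all

lemma smooth_form1_cartan:
  assumes "open U" "\<And>i. smooth_form1 U (\<theta> i)" "smooth_form1 U A" "\<And>i. smooth_form1 U (\<Psi> i)"
    "\<And>i j. smooth_form1 U (\<omega> i j)"
  shows "smooth_form1 U (cartan \<theta> \<omega> A \<Psi> B C)"
  using assms smooth_form1_skew_part[OF assms(1,5)]
  unfolding smooth_form1_def
  by (cases B; cases C) (auto intro!: smooth_on_minus smooth_on_const smooth_on_sum smooth_on_mult)

text \<open>The trace part of the connection is A times the identity. Its cross terms with the skew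
  part cancel by antisymmetry of the wedge product, A \<and> A is 0, and only dA survives.\<close>

lemma curv_skew_part:
  assumes "open U" "p \<in> U" "smooth_form1 U A" "weyl_connection U \<theta> A \<omega>"
  shows "curv \<omega> i j \<mu> \<nu> p = curv (skew_part \<omega>) i j \<mu> \<nu> p + eta i j * ext_d A \<mu> \<nu> p"
proof -
  have sm: "smooth_form1 U (\<omega> i j)" for i j using assms(4) by (simp add: weyl_connection_def)
  have \<omega>: "\<omega> i j \<mu> q = skew_part \<omega> i j \<mu> q + eta i j * A \<mu> q" if "q \<in> U" for i j \<mu> q
    using assms(4) that by (simp add: weyl_connection_def)
  note d = smooth_form1_differentiable[OF smooth_form1_skew_part[OF assms(1) sm] assms(2)]
  note dA = smooth_form1_differentiable[OF assms(3,2)]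
  have dA': "(\<lambda>p. eta i j * A \<mu> p) differentiable (at p)" for \<mu>
    using dA by (intro differentiable_mult) simp_all
  have "ext_d (\<omega> i j) \<mu> \<nu> p = ext_d (\<lambda>\<mu> q. skew_part \<omega> i j \<mu> q + eta i j * A \<mu> q) \<mu> \<nu> p"
    using \<omega> by (intro ext_d_cong_open[OF assms(1,2)])
  also have "\<dots> = ext_d (skew_part \<omega> i j) \<mu> \<nu> p + eta i j * ext_d A \<mu> \<nu> p"
    by (simp add: ext_d_def pd_add[OF d dA'] pd_cmult[OF dA] right_diff_distrib)
  finally have 1: "ext_d (\<omega> i j) \<mu> \<nu> p = \<dots>" .
  have "(\<Sum>k\<in>UNIV. \<Sum>l\<in>UNIV. eta k l * wedge (\<omega> i k) (\<omega> l j) \<mu> \<nu> p)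
      = (\<Sum>k\<in>UNIV. \<Sum>l\<in>UNIV. eta k l * wedge (skew_part \<omega> i k) (skew_part \<omega> l j) \<mu> \<nu> p)"
    unfolding wedge_def \<omega>[OF assms(2)]
    by (cases i; cases j) (simp_all add: sum_idx4 algebra_simps)
  with 1 show ?thesis by (simp add: curv_def)
qed

text \<open>Sign with which the scalar two-form dA - Psi_k \<and> theta^k enters each diagonal block
  in the next lemma.\<close>

fun cidx_weight :: "cidx \<Rightarrow> complex" where
  "cidx_weight Bot = -1"
| "cidx_weight _ = 1"

text \<open>Psi is arbitrary here. Vanishing torsion clears the blocks (Mid, Top) and (Bot, Mid),
  and the only obstruction to the desired shape is the scalar two-form dA - Psi_k \<and> theta^k on
  the diagonal. It is 0 for the two families to which the lemma is applied with curvature: the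
  Schouten forms with A = 0, and the final Psi.\<close>

lemma cartan_curv_eq_block:
  fixes \<theta> :: "idx4 \<Rightarrow> form1" and \<omega> :: "idx4 \<Rightarrow> idx4 \<Rightarrow> form1"
  assumes U: "open U" "p \<in> U"
    and sm: "\<And>i. smooth_form1 U (\<theta> i)" "smooth_form1 U A" "\<And>i. smooth_form1 U (\<Psi> i)"
    and weyl: "weyl_connection U \<theta> A \<omega>"
  shows "cartan_curv (cartan \<theta> \<omega> A \<Psi>) B C \<mu> \<nu> p
    = cartan_curv_block (Omega2 \<theta> \<omega> \<Psi>) (Omega1 \<omega> \<Psi>) B C \<mu> \<nu> p
      - (if B = C then cidx_weight B else 0)
        * (ext_d A \<mu> \<nu> p - (\<Sum>k\<in>UNIV. wedge (\<Psi> k) (\<theta> k) \<mu> \<nu> p))"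
proof -
  have sm\<omega>: "smooth_form1 U (\<omega> i j)" for i j using weyl by (simp add: weyl_connection_def)
  have \<omega>: "\<omega> i j \<mu> p = skew_part \<omega> i j \<mu> p + eta i j * A \<mu> p" for i j \<mu>
    using weyl U by (simp add: weyl_connection_def)
  have tors: "ext_d (\<theta> i) \<mu> \<nu> p = - (\<Sum>k\<in>UNIV. \<Sum>j\<in>UNIV. eta i k * wedge (\<omega> k j) (\<theta> j) \<mu> \<nu> p)" for i
    using weyl U by (simp add: weyl_connection_def torsion_free_def eq_neg_iff_add_eq_0)
  note d\<theta> = smooth_form1_differentiable[OF sm(1) U(2)]
  note dA = smooth_form1_differentiable[OF sm(2) U(2)]
  note d\<Psi> = smooth_form1_differentiable[OF sm(3) U(2)]
  note d\<sigma> = smooth_form1_differentiable[OF smooth_form1_skew_part[OF U(1) sm\<omega>] U(2)]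
  note lin = ext_d_lincomb[OF _ d\<theta>] ext_d_lincomb[OF _ d\<Psi>] ext_d_lincomb[OF _ d\<sigma>]
    ext_d_uminus[OF dA] ext_d_zero
  note curv_\<omega> = curv_skew_part[OF U sm(2) weyl, unfolded curv_def[of "skew_part \<omega>"]]
  show ?thesis
  proof (cases B)
    case Top
    show ?thesis
    proof (cases C)
      case (Mid j)
      with Top show ?thesis
        unfolding cartan_curv_def sum_cidx
        by (simp add: lin Omega1_def wedge_def \<omega>) (cases j; simp add: sum_idx4 algebra_simps)
    qed (use Top in \<open>simp_all add: cartan_curv_def sum_cidx lin wedge_def sum_idx4 algebra_simps\<close>)
  next
    case (Mid i)
    show ?thesis
    proof (cases C)
      case Top
      with Mid show ?thesis
        unfolding cartan_curv_def sum_cidx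
        by (simp add: tors wedge_def \<omega>) (cases i; simp add: sum_idx4 algebra_simps)
    next
      case (Mid j)
      with \<open>B = Mid i\<close> show ?thesis
        unfolding cartan_curv_def sum_cidx
        by (simp add: lin Omega2_def curv_\<omega> wedge_def)
          (cases i; cases j; simp add: sum_idx4 algebra_simps)
    next
      case Bot
      with Mid show ?thesis
        unfolding cartan_curv_def sum_cidx
        by (simp add: lin Omega1_def wedge_def \<omega>)
          (cases i; simp add: sum_idx4 skew_part_skew algebra_simps)
    qed
  next
    case Bot
    show ?thesis
    proof (cases C)
      case (Mid j)
      with Bot show ?thesis
        unfolding cartan_curv_def sum_cidx
        by (simp add: lin tors wedge_def \<omega>) (cases j; simp add: sum_idx4 skew_part_skew algebra_simps)
    qed (use Bot in \<open>simp_all add: cartan_curv_def sum_cidx lin wedge_def sum_idx4 algebra_simps\<close>)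
  qed
qed

section \<open>Components in a coframe\<close>

definition comp3 ::
    "(idx4 \<Rightarrow> form1) \<Rightarrow> (coord \<Rightarrow> coord \<Rightarrow> coord \<Rightarrow> J6 \<Rightarrow> complex) \<Rightarrow> idx6 \<Rightarrow> idx6 \<Rightarrow> idx6 \<Rightarrow> J6 \<Rightarrow> complex" where
  "comp3 \<theta> \<Lambda> L M N p = (\<Sum>\<mu>\<in>UNIV. \<Sum>\<nu>\<in>UNIV. \<Sum>\<kappa>\<in>UNIV. \<Lambda> \<mu> \<nu> \<kappa> p
     * dual_frame \<theta> L \<mu> p * dual_frame \<theta> M \<nu> p * dual_frame \<theta> N \<kappa> p)"

section \<open>Frame components of one-, two- and three-forms\<close>

lemma comp1_scale: "comp1 \<theta> (\<lambda>\<mu> p. f p * \<alpha> \<mu> p) L p = f p * comp1 \<theta> \<alpha> L p"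
  by (simp add: comp1_def sum_distrib_left mult.assoc)

lemma comp1_sum: "comp1 \<theta> (\<lambda>\<mu> p. \<Sum>i\<in>I. \<alpha> i \<mu> p) L p = (\<Sum>i\<in>I. comp1 \<theta> (\<alpha> i) L p)"
  unfolding comp1_def sum_distrib_right by (rule sum.swap)

lemma comp2_add:
  "comp2 \<theta> (\<lambda>\<mu> \<nu> p. \<Omega> \<mu> \<nu> p + \<Omega>' \<mu> \<nu> p) L M p = comp2 \<theta> \<Omega> L M p + comp2 \<theta> \<Omega>' L M p"
  by (simp add: comp2_def distrib_right sum.distrib)

lemma comp2_diff:
  "comp2 \<theta> (\<lambda>\<mu> \<nu> p. \<Omega> \<mu> \<nu> p - \<Omega>' \<mu> \<nu> p) L M p = comp2 \<theta> \<Omega> L M p - comp2 \<theta> \<Omega>' L M p"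
  by (simp add: comp2_def left_diff_distrib sum_subtractf)

lemma comp2_scale: "comp2 \<theta> (\<lambda>\<mu> \<nu> p. f p * \<Omega> \<mu> \<nu> p) L M p = f p * comp2 \<theta> \<Omega> L M p"
  by (simp add: comp2_def sum_distrib_left mult.assoc)

lemma comp2_scale_right: "comp2 \<theta> (\<lambda>\<mu> \<nu> p. \<Omega> \<mu> \<nu> p * f p) L M p = comp2 \<theta> \<Omega> L M p * f p"
  using comp2_scale[of \<theta> f \<Omega> L M p] by (simp add: mult.commute)

lemma comp2_sum: "comp2 \<theta> (\<lambda>\<mu> \<nu> p. \<Sum>i\<in>I. \<Omega> i \<mu> \<nu> p) L M p = (\<Sum>i\<in>I. comp2 \<theta> (\<Omega> i) L M p)"
proof -
  have "comp2 \<theta> (\<lambda>\<mu> \<nu> p. \<Sum>i\<in>I. \<Omega> i \<mu> \<nu> p) L M p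
      = (\<Sum>\<mu>\<in>UNIV. \<Sum>i\<in>I. \<Sum>\<nu>\<in>UNIV. \<Omega> i \<mu> \<nu> p * dual_frame \<theta> L \<mu> p * dual_frame \<theta> M \<nu> p)"
    unfolding comp2_def sum_distrib_right by (intro sum.cong refl sum.swap)
  also have "\<dots> = (\<Sum>i\<in>I. comp2 \<theta> (\<Omega> i) L M p)"
    unfolding comp2_def by (rule sum.swap)
  finally show ?thesis .
qed

lemma comp2_cong: "(\<And>\<mu> \<nu>. \<Omega> \<mu> \<nu> p = \<Omega>' \<mu> \<nu> p) \<Longrightarrow> comp2 \<theta> \<Omega> L M p = comp2 \<theta> \<Omega>' L M p"
  by (simp add: comp2_def)

lemma comp3_cong: "(\<And>\<mu> \<nu> \<kappa>. \<Lambda> \<mu> \<nu> \<kappa> p = \<Lambda>' \<mu> \<nu> \<kappa> p) \<Longrightarrow> comp3 \<theta> \<Lambda> L M N p = comp3 \<theta> \<Lambda>' L M N p"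
  by (simp add: comp3_def)

lemma comp2_wedge:
  "comp2 \<theta> (wedge \<alpha> \<beta>) L M p
    = comp1 \<theta> \<alpha> L p * comp1 \<theta> \<beta> M p - comp1 \<theta> \<alpha> M p * comp1 \<theta> \<beta> L p"
proof -
  have "comp1 \<theta> \<alpha> M p * comp1 \<theta> \<beta> L p
      = (\<Sum>\<mu>\<in>UNIV. \<Sum>\<nu>\<in>UNIV. \<alpha> \<nu> p * \<beta> \<mu> p * dual_frame \<theta> L \<mu> p * dual_frame \<theta> M \<nu> p)"
    unfolding comp1_def sum_product by (subst sum.swap) (simp add: mult_ac)
  moreover have "comp1 \<theta> \<alpha> L p * comp1 \<theta> \<beta> M p
      = (\<Sum>\<mu>\<in>UNIV. \<Sum>\<nu>\<in>UNIV. \<alpha> \<mu> p * \<beta> \<nu> p * dual_frame \<theta> L \<mu> p * dual_frame \<theta> M \<nu> p)"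
    unfolding comp1_def sum_product by (simp add: mult_ac)
  ultimately show ?thesis
    by (simp add: comp2_def wedge_def left_diff_distrib sum_subtractf)
qed

lemma comp3_add: "comp3 \<theta> (\<lambda>\<mu> \<nu> \<kappa> p. \<Lambda> \<mu> \<nu> \<kappa> p + \<Lambda>' \<mu> \<nu> \<kappa> p) L M N p
    = comp3 \<theta> \<Lambda> L M N p + comp3 \<theta> \<Lambda>' L M N p"
  by (simp add: comp3_def distrib_right sum.distrib)

lemma comp3_diff: "comp3 \<theta> (\<lambda>\<mu> \<nu> \<kappa> p. \<Lambda> \<mu> \<nu> \<kappa> p - \<Lambda>' \<mu> \<nu> \<kappa> p) L M N p
    = comp3 \<theta> \<Lambda> L M N p - comp3 \<theta> \<Lambda>' L M N p"
  by (simp add: comp3_def left_diff_distrib sum_subtractf)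

lemma comp3_scale: "comp3 \<theta> (\<lambda>\<mu> \<nu> \<kappa> p. f p * \<Lambda> \<mu> \<nu> \<kappa> p) L M N p = f p * comp3 \<theta> \<Lambda> L M N p"
  by (simp add: comp3_def sum_distrib_left mult.assoc)

lemma comp3_zero: "comp3 \<theta> (\<lambda>\<mu> \<nu> \<kappa> p. 0) L M N p = 0"
  by (simp add: comp3_def)

lemma comp3_sum:
  "finite I \<Longrightarrow> comp3 \<theta> (\<lambda>\<mu> \<nu> \<kappa> p. \<Sum>i\<in>I. \<Lambda> i \<mu> \<nu> \<kappa> p) L M N p = (\<Sum>i\<in>I. comp3 \<theta> (\<Lambda> i) L M N p)"
  by (induction I rule: finite_induct) (simp_all add: comp3_zero comp3_add)

lemma comp3_wedge21:
  "comp3 \<theta> (wedge21 \<Omega> \<beta>) L M N p = comp2 \<theta> \<Omega> L M p * comp1 \<theta> \<beta> N p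
    + comp2 \<theta> \<Omega> M N p * comp1 \<theta> \<beta> L p + comp2 \<theta> \<Omega> N L p * comp1 \<theta> \<beta> M p"
proof -
  let ?e = "dual_frame \<theta>"
  have "comp2 \<theta> \<Omega> L M p * comp1 \<theta> \<beta> N p
      = (\<Sum>\<mu>\<in>UNIV. \<Sum>\<nu>\<in>UNIV. \<Sum>\<kappa>\<in>UNIV. \<Omega> \<mu> \<nu> p * \<beta> \<kappa> p * ?e L \<mu> p * ?e M \<nu> p * ?e N \<kappa> p)"
    unfolding comp1_def comp2_def sum_distrib_right unfolding sum_distrib_left by (simp add: mult_ac)
  moreover have "comp2 \<theta> \<Omega> M N p * comp1 \<theta> \<beta> L p
      = (\<Sum>\<mu>\<in>UNIV. \<Sum>\<nu>\<in>UNIV. \<Sum>\<kappa>\<in>UNIV. \<Omega> \<nu> \<kappa> p * \<beta> \<mu> p * ?e L \<mu> p * ?e M \<nu> p * ?e N \<kappa> p)"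
    unfolding comp1_def comp2_def sum_distrib_left unfolding sum_distrib_right by (simp add: mult_ac)
  moreover have "comp2 \<theta> \<Omega> N L p * comp1 \<theta> \<beta> M p
      = (\<Sum>\<mu>\<in>UNIV. \<Sum>\<nu>\<in>UNIV. \<Sum>\<kappa>\<in>UNIV. \<Omega> \<kappa> \<mu> p * \<beta> \<nu> p * ?e L \<mu> p * ?e M \<nu> p * ?e N \<kappa> p)"
  proof -
    have "comp2 \<theta> \<Omega> N L p * comp1 \<theta> \<beta> M p
      = (\<Sum>\<kappa>\<in>UNIV. \<Sum>\<mu>\<in>UNIV. \<Sum>\<nu>\<in>UNIV. \<Omega> \<kappa> \<mu> p * \<beta> \<nu> p * ?e L \<mu> p * ?e M \<nu> p * ?e N \<kappa> p)"
      unfolding comp1_def comp2_def sum_distrib_right unfolding sum_distrib_left by (simp add: mult_ac)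
    also have "\<dots> = (\<Sum>\<mu>\<in>UNIV. \<Sum>\<kappa>\<in>UNIV. \<Sum>\<nu>\<in>UNIV. \<Omega> \<kappa> \<mu> p * \<beta> \<nu> p * ?e L \<mu> p * ?e M \<nu> p * ?e N \<kappa> p)"
      by (rule sum.swap)
    also have "\<dots> = (\<Sum>\<mu>\<in>UNIV. \<Sum>\<nu>\<in>UNIV. \<Sum>\<kappa>\<in>UNIV. \<Omega> \<kappa> \<mu> p * \<beta> \<nu> p * ?e L \<mu> p * ?e M \<nu> p * ?e N \<kappa> p)"
      by (intro sum.cong refl sum.swap)
    finally show ?thesis .
  qed
  ultimately show ?thesis
    by (simp add: comp3_def wedge21_def distrib_right sum.distrib)
qed

lemma ext_d2_scale:
  assumes "f differentiable (at p)" "\<And>\<mu> \<nu>. \<Omega> \<mu> \<nu> differentiable (at p)"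
  shows "ext_d2 (\<lambda>\<mu> \<nu> p. f p * \<Omega> \<mu> \<nu> p) \<mu> \<nu> \<kappa> p
    = wedge21 \<Omega> (\<lambda>\<mu>. pd \<mu> f) \<mu> \<nu> \<kappa> p + f p * ext_d2 \<Omega> \<mu> \<nu> \<kappa> p"
  using assms by (simp add: ext_d2_def wedge21_def pd_mult algebra_simps)

lemma ext_d2_cong_open:
  assumes "open U" "p \<in> U" "\<And>\<mu> \<nu> q. q \<in> U \<Longrightarrow> \<Omega> \<mu> \<nu> q = \<Omega>' \<mu> \<nu> q"
  shows "ext_d2 \<Omega> \<mu> \<nu> \<kappa> p = ext_d2 \<Omega>' \<mu> \<nu> \<kappa> p"
proof -
  have "pd \<mu> (\<Omega> \<nu> \<kappa>) p = pd \<mu> (\<Omega>' \<nu> \<kappa>) p" for \<mu> \<nu> \<kappa>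
    by (rule pd_cong_open[OF assms(1,2)]) (rule assms(3))
  then show ?thesis by (simp add: ext_d2_def)
qed

lemma comp1_pd: "comp1 \<theta> (\<lambda>\<mu>. pd \<mu> f) L p = vderiv (dual_frame \<theta> L) f p"
  by (simp add: comp1_def vderiv_def mult.commute)

text \<open>The geometry is developed for any smooth coframe completed by ds and ds^* and having a
  smooth dual frame; the explicit tetrad is shown to be an instance only later. Both duality
  relations are listed: one evaluates forms on the frame, the other expands a form in the
  coframe.\<close>

locale smooth_coframe =
  fixes U :: "J6 set" and \<theta> :: "idx4 \<Rightarrow> form1"
  assumes open_U: "open U"
    and smooth_theta: "smooth_form1 U (\<theta> i)"
    and smooth_dual_frame: "smooth_on U (dual_frame \<theta> L \<mu>)"
    and coframe_dual_frame:
      "p \<in> U \<Longrightarrow> (\<Sum>\<mu>\<in>UNIV. coframe \<theta> L \<mu> p * dual_frame \<theta> M \<mu> p) = (if L = M then 1 else 0)"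
    and dual_frame_coframe:
      "p \<in> U \<Longrightarrow> (\<Sum>L\<in>UNIV. dual_frame \<theta> L \<mu> p * coframe \<theta> L \<nu> p) = (if \<mu> = \<nu> then 1 else 0)"
begin

lemma comp1_theta: "p \<in> U \<Longrightarrow> comp1 \<theta> (\<theta> i) L p = (if L = Fr i then 1 else 0)"
  using coframe_dual_frame[of p "Fr i" L] by (auto simp: comp1_def)

lemma form1_expand:
  assumes "p \<in> U"
  shows "\<alpha> \<mu> p = (\<Sum>L\<in>UNIV. comp1 \<theta> \<alpha> L p * coframe \<theta> L \<mu> p)"
proof -
  have "(\<Sum>L\<in>UNIV. comp1 \<theta> \<alpha> L p * coframe \<theta> L \<mu> p)
      = (\<Sum>\<nu>\<in>UNIV. \<alpha> \<nu> p * (\<Sum>L\<in>UNIV. dual_frame \<theta> L \<nu> p * coframe \<theta> L \<mu> p))"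
    unfolding comp1_def sum_distrib_left sum_distrib_right
    by (subst sum.swap) (simp add: mult.assoc)
  also have "\<dots> = \<alpha> \<mu> p" using assms
    by (simp add: dual_frame_coframe if_distrib[where f="\<lambda>x. _ * x"] cong: if_cong)
  finally show ?thesis ..
qed

lemma form1_eqI:
  assumes "p \<in> U" "\<And>L. comp1 \<theta> \<alpha> L p = comp1 \<theta> \<beta> L p"
  shows "\<alpha> \<mu> p = \<beta> \<mu> p"
  unfolding form1_expand[OF assms(1), of \<alpha>] form1_expand[OF assms(1), of \<beta>] assms(2) ..

lemma form2_eqI:
  assumes p: "p \<in> U" and eq: "\<And>L M. comp2 \<theta> \<Omega> L M p = comp2 \<theta> \<Omega>' L M p"
  shows "\<Omega> \<mu> \<nu> p = \<Omega>' \<mu> \<nu> p"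
proof -
  \<comment> \<open>With one slot contracted with a frame vector, the two-form is a one-form in the
    remaining slot, so \<open>form1_eqI\<close> can be applied to one slot at a time.\<close>
  have row: "comp1 \<theta> (\<lambda>\<nu> q. comp1 \<theta> (\<lambda>\<mu> r. \<Omega> \<mu> \<nu> p) L q) M p = comp2 \<theta> \<Omega> L M p" for L M \<Omega>
    unfolding comp1_def comp2_def sum_distrib_right by (rule sum.swap)
  have "comp1 \<theta> (\<lambda>\<mu> r. \<Omega> \<mu> \<nu> p) L p = comp1 \<theta> (\<lambda>\<mu> r. \<Omega>' \<mu> \<nu> p) L p" for L \<nu>
    by (rule form1_eqI[OF p, of "\<lambda>\<nu> q. comp1 \<theta> (\<lambda>\<mu> r. \<Omega> \<mu> \<nu> p) L q"
          "\<lambda>\<nu> q. comp1 \<theta> (\<lambda>\<mu> r. \<Omega>' \<mu> \<nu> p) L q"]) (simp add: row eq)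
  then show ?thesis
    by (rule form1_eqI[OF p, of "\<lambda>\<mu> r. \<Omega> \<mu> \<nu> p" "\<lambda>\<mu> r. \<Omega>' \<mu> \<nu> p"])
qed

lemma smooth_comp2: "smooth_form2 U \<Omega> \<Longrightarrow> smooth_on U (comp2 \<theta> \<Omega> L M)"
  unfolding comp2_def[abs_def] smooth_form2_def
  by (intro smooth_on_sum smooth_on_mult open_U smooth_dual_frame) blast

lemma comp2_horizontal:
  assumes "p \<in> U" "\<And>l m. C l m = - C m l"
  shows "comp2 \<theta> (\<lambda>\<mu> \<nu> q. 1/2 * (\<Sum>l\<in>UNIV. \<Sum>m\<in>UNIV. C l m * wedge (\<theta> l) (\<theta> m) \<mu> \<nu> q)) L M p
    = (case (L, M) of (Fr l, Fr m) \<Rightarrow> C l m | _ \<Rightarrow> 0)"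
proof -
  have "comp2 \<theta> (\<lambda>\<mu> \<nu> q. 1/2 * (\<Sum>l\<in>UNIV. \<Sum>m\<in>UNIV. C l m * wedge (\<theta> l) (\<theta> m) \<mu> \<nu> q)) L M p
     = 1/2 * (\<Sum>l\<in>UNIV. \<Sum>m\<in>UNIV. C l m * comp2 \<theta> (wedge (\<theta> l) (\<theta> m)) L M p)"
    by (simp only: comp2_scale comp2_sum)
  also have "\<dots> = 1/2 * (\<Sum>l\<in>UNIV. \<Sum>m\<in>UNIV. C l m * ((if L = Fr l then 1 else 0) * (if M = Fr m then 1 else 0)
      - (if M = Fr l then 1 else 0) * (if L = Fr m then 1 else 0)))"
    using assms(1) by (simp add: comp2_wedge comp1_theta)
  also have "\<dots> = (case (L, M) of (Fr l, Fr m) \<Rightarrow> C l m | _ \<Rightarrow> 0)"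
  proof -
    have 1: "(\<Sum>l\<in>UNIV. \<Sum>m\<in>UNIV. C l m * ((if l' = l then 1 else 0) * (if m' = m then 1 else 0)
        - (if m' = l then 1 else 0) * (if l' = m then 1 else 0))) = C l' m' - C m' l'" for l' m'
      by (simp add: right_diff_distrib sum_subtractf if_distrib[where f="\<lambda>x. _ * x"] cong: if_cong)
    have "1/2 * (C l m - C m l) = C l m" for l m
      by (subst assms(2)[of m l]) simp
    then show ?thesis by (cases L; cases M) (simp_all only: 1 idx6.simps idx6.inject prod.case, simp_all)
  qed
  finally show ?thesis .
qed

text \<open>The uniqueness argument for the Levi-Civita connection: the horizontal components of d
  are skew in i, j and symmetric in j, k, hence equal to their own negatives. A vertical component
  stands alone in the torsion equation and vanishes at once. The lemma serves to compute the Weyl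
  connection and to prove its reality.\<close>

lemma wedge_theta_unique:
  fixes d :: "idx4 \<Rightarrow> idx4 \<Rightarrow> form1"
  assumes "p \<in> U" "\<And>i j \<mu>. d i j \<mu> p = - d j i \<mu> p"
    and "\<And>i \<mu> \<nu>. (\<Sum>j\<in>UNIV. wedge (d i j) (\<theta> j) \<mu> \<nu> p) = 0"
  shows "d i j \<mu> p = 0"
proof -
  let ?d = "\<lambda>i j L. comp1 \<theta> (d i j) L p"
  have skew: "?d i j L = - ?d j i L" for i j L
    unfolding comp1_def by (subst assms(2)) (simp add: sum_negf)
  have eq: "(\<Sum>j\<in>UNIV. ?d i j L * (if M = Fr j then 1 else 0) - ?d i j M * (if L = Fr j then 1 else 0)) = 0" for i L M
  proof -
    have "comp2 \<theta> (\<lambda>\<mu> \<nu> q. \<Sum>j\<in>UNIV. wedge (d i j) (\<theta> j) \<mu> \<nu> q) L M p = 0"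
      by (simp add: comp2_def assms(3))
    then show ?thesis using assms(1) by (simp add: comp2_sum comp2_wedge comp1_theta)
  qed
  have sym: "?d i j (Fr k) = ?d i k (Fr j)" for i j k
    using eq[of i "Fr k" "Fr j"] by (simp add: sum_subtractf if_distrib[where f="\<lambda>x. _ * x"] cong: if_cong)
  have "?d i j (Fr k) = - ?d i j (Fr k)" for k
    by (metis skew sym minus_minus)
  then have "?d i j (Fr k) = 0" for k by (metis eq_neg_iff_add_eq_0 mult_2 mult_eq_0_iff zero_neq_numeral)
  moreover have "?d i j Fs = 0" "?d i j Fss = 0"
    using eq[of i Fs "Fr j"] eq[of i Fss "Fr j"]
    by (simp_all add: if_distrib[where f="\<lambda>x. _ * x"] cong: if_cong)
  ultimately have "?d i j L = 0" for L by (cases L) auto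
  then show ?thesis using form1_expand[OF assms(1), of "d i j" \<mu>] by simp
qed

end

section \<open>The Levi-Civita connection\<close>

text \<open>Minus the usual four-dimensional Schouten tensor (Ric - Scal eta / 6) / 2; this is the
  sign with which Psi enters \<open>Omega2\<close>.\<close>

definition schouten :: "(idx4 \<Rightarrow> form1) \<Rightarrow> (idx4 \<Rightarrow> idx4 \<Rightarrow> form1) \<Rightarrow> idx4 \<Rightarrow> idx4 \<Rightarrow> J6 \<Rightarrow> complex" where
  "schouten \<theta> \<gamma> i j = (\<lambda>p. Scal \<theta> \<gamma> p * eta i j / 12 - Ric \<theta> \<gamma> i j p / 2)"

definition schouten_form :: "(idx4 \<Rightarrow> form1) \<Rightarrow> (idx4 \<Rightarrow> idx4 \<Rightarrow> form1) \<Rightarrow> idx4 \<Rightarrow> form1" where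
  "schouten_form \<theta> \<gamma> i = (\<lambda>\<mu> p. \<Sum>j\<in>UNIV. schouten \<theta> \<gamma> i j p * \<theta> j \<mu> p)"

definition horizontal_form :: "(idx4 \<Rightarrow> form1) \<Rightarrow> (idx4 \<Rightarrow> idx4 \<Rightarrow> J6 \<Rightarrow> complex) \<Rightarrow> form2" where
  "horizontal_form \<theta> C = (\<lambda>\<mu> \<nu> p. 1/2 * (\<Sum>l\<in>UNIV. \<Sum>m\<in>UNIV. C l m p * wedge (\<theta> l) (\<theta> m) \<mu> \<nu> p))"

lemma comp2_Omega2:
  "comp2 \<theta> (Omega2 \<theta> \<omega> \<Psi> i j) L M p = comp2 \<theta> (curv \<omega> i j) L M p
     + (\<Sum>l\<in>UNIV. eta i l * comp2 \<theta> (wedge (\<theta> l) (\<Psi> j)) L M p)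
     + (\<Sum>l\<in>UNIV. comp2 \<theta> (wedge (\<Psi> i) (\<theta> l)) L M p * eta j l)
     - eta i j * (\<Sum>k\<in>UNIV. comp2 \<theta> (wedge (\<Psi> k) (\<theta> k)) L M p)"
  unfolding Omega2_def by (simp only: comp2_add comp2_diff comp2_sum comp2_scale comp2_scale_right)

lemma comp2_swap:
  assumes "\<And>\<mu> \<nu>. \<Omega> \<mu> \<nu> p = - \<Omega> \<nu> \<mu> p"
  shows "comp2 \<theta> \<Omega> L M p = - comp2 \<theta> \<Omega> M L p"
proof -
  have "comp2 \<theta> \<Omega> M L p = (\<Sum>\<nu>\<in>UNIV. \<Sum>\<mu>\<in>UNIV. \<Omega> \<mu> \<nu> p * dual_frame \<theta> M \<mu> p * dual_frame \<theta> L \<nu> p)"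
    unfolding comp2_def by (rule sum.swap)
  also have "\<dots> = - comp2 \<theta> \<Omega> L M p"
    unfolding comp2_def sum_negf[symmetric]
    by (intro sum.cong refl, subst assms) (simp add: mult_ac)
  finally show ?thesis by simp
qed

lemma ext_d_swap: "ext_d \<alpha> \<mu> \<nu> p = - ext_d \<alpha> \<nu> \<mu> p"
  by (simp add: ext_d_def)

lemma wedge_swap: "wedge \<alpha> \<beta> \<mu> \<nu> p = - wedge \<alpha> \<beta> \<nu> \<mu> p"
  by (simp add: wedge_def)

lemma curv_swap: "curv \<omega> i j \<mu> \<nu> p = - curv \<omega> i j \<nu> \<mu> p"
  unfolding curv_def
  by (subst ext_d_swap, subst wedge_swap) (simp add: sum_negf)

lemma smooth_form1_zero: "smooth_form1 U (\<lambda>\<mu> p. 0)"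
  by (simp add: smooth_form1_def smooth_on_const)

lemma ext_d2_zero: "ext_d2 (\<lambda>\<mu> \<nu> p. 0) \<mu> \<nu> \<kappa> p = 0"
  by (simp add: ext_d2_def)

lemma (in smooth_coframe) comp2_horizontal_form:
  assumes "p \<in> U" "\<And>l m. C l m p = - C m l p"
  shows "comp2 \<theta> (horizontal_form \<theta> C) L M p = (case (L, M) of (Fr l, Fr m) \<Rightarrow> C l m p | _ \<Rightarrow> 0)"
  using comp2_horizontal[of p "\<lambda>l m. C l m p", OF assms]
  by (simp only: horizontal_form_def comp2_def)

text \<open>Trace of the Kulkarni-Nomizu product of eta and r; the factor 2 is n - 2 for n = 4. It
  gives the trace of the Weyl tensor and, together with \<open>trace_adjusted_eq_0\<close>, the
  uniqueness of Psi.\<close>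

lemma trace_kulkarni:
  fixes r :: "idx4 \<Rightarrow> idx4 \<Rightarrow> complex"
  shows "(\<Sum>i\<in>UNIV. \<Sum>k\<in>UNIV. eta i k * (eta i k * r j m - eta i m * r j k - eta j k * r i m + eta j m * r i k))
    = 2 * r j m + eta j m * (\<Sum>i\<in>UNIV. \<Sum>k\<in>UNIV. eta i k * r i k)"
  by (cases j; cases m) (simp_all add: sum_idx4 algebra_simps)

locale lc_coframe = smooth_coframe +
  fixes \<gamma> :: "idx4 \<Rightarrow> idx4 \<Rightarrow> form1"
  assumes lc: "levi_civita U \<theta> \<gamma>"
begin

lemma smooth_gamma: "smooth_form1 U (\<gamma> i j)"
  using lc by (simp add: levi_civita_def)

lemma gamma_skew_part: "p \<in> U \<Longrightarrow> \<gamma> i j \<mu> p = skew_part \<gamma> i j \<mu> p"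
  using lc by (simp add: levi_civita_def)

lemma gamma_skew: "p \<in> U \<Longrightarrow> \<gamma> i j \<mu> p = - \<gamma> j i \<mu> p"
  using gamma_skew_part[of p i j \<mu>] gamma_skew_part[of p j i \<mu>] skew_part_swap[of \<gamma> i j \<mu> p] by simp

lemma gamma_weyl: "weyl_connection U \<theta> (\<lambda>\<mu> p. 0) \<gamma>"
  using lc by (simp add: levi_civita_def weyl_connection_def)

lemma smooth_curv: "smooth_form2 U (curv \<gamma> i j)"
  using smooth_form2_ext_d[OF open_U smooth_gamma] smooth_form2_wedge[OF open_U smooth_gamma smooth_gamma]
  unfolding smooth_form2_def curv_def
  by (intro allI smooth_on_add smooth_on_sum smooth_on_mult smooth_on_const open_U) blast+

lemma curv_skew:
  assumes "p \<in> U"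
  shows "curv \<gamma> i j \<mu> \<nu> p = - curv \<gamma> j i \<mu> \<nu> p"
proof -
  have "ext_d (\<gamma> i j) \<mu> \<nu> p = ext_d (\<lambda>\<mu> q. - \<gamma> j i \<mu> q) \<mu> \<nu> p"
    by (rule ext_d_cong_open[OF open_U assms]) (rule gamma_skew)
  then have 1: "ext_d (\<gamma> i j) \<mu> \<nu> p = - ext_d (\<gamma> j i) \<mu> \<nu> p"
    by (simp add: ext_d_uminus[OF smooth_form1_differentiable[OF smooth_gamma assms]])
  have "(\<Sum>k\<in>UNIV. \<Sum>l\<in>UNIV. eta k l * wedge (\<gamma> i k) (\<gamma> l j) \<mu> \<nu> p)
      = - (\<Sum>k\<in>UNIV. \<Sum>l\<in>UNIV. eta k l * wedge (\<gamma> j k) (\<gamma> l i) \<mu> \<nu> p)"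
    unfolding wedge_def gamma_skew_part[OF assms]
    by (cases i; cases j) (simp_all add: sum_idx4 skew_part_skew algebra_simps)
  with 1 show ?thesis by (simp add: curv_def)
qed

text \<open>The entry (Mid i, Top) of the matrix Bianchi identity for A = 0 and Psi = 0. This
  curvature entry is the torsion, which vanishes on all of U, and so its exterior derivative
  vanishes as well.\<close>

lemma first_bianchi:
  assumes "p \<in> U"
  shows "(\<Sum>k\<in>UNIV. wedge21 (curv \<gamma> i k) (\<theta> k) \<mu> \<nu> \<kappa> p) = 0"
proof -
  let ?\<Theta> = "cartan \<theta> \<gamma> (\<lambda>\<mu> p. 0) (\<lambda>i \<mu> p. 0)"
  have O2: "Omega2 \<theta> \<gamma> (\<lambda>i \<mu> p. 0) i j \<mu> \<nu> q = curv \<gamma> i j \<mu> \<nu> q" for i j \<mu> \<nu> q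
    by (simp add: Omega2_def wedge_def)
  have O1: "Omega1 \<gamma> (\<lambda>i \<mu> p. 0) i \<mu> \<nu> q = 0" for i \<mu> \<nu> q
    by (simp add: Omega1_def wedge_def ext_d_zero)
  have cc: "cartan_curv ?\<Theta> B C \<mu> \<nu> q = cartan_curv_block (curv \<gamma>) (\<lambda>i \<mu> \<nu> p. 0) B C \<mu> \<nu> q"
    if "q \<in> U" for B C \<mu> \<nu> q
    unfolding cartan_curv_eq_block[OF open_U that smooth_theta smooth_form1_zero smooth_form1_zero gamma_weyl]
    by (cases B; cases C) (simp_all add: O2 O1 ext_d_zero wedge_def)
  have z: "(\<Sum>k\<in>UNIV. eta i k * (\<Sum>j\<in>UNIV. wedge21 (curv \<gamma> k j) (\<theta> j) \<mu> \<nu> \<kappa> p)) = 0" for i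
  proof -
    have "0 = ext_d2 (cartan_curv ?\<Theta> (Mid i) Top) \<mu> \<nu> \<kappa> p"
      using ext_d2_cong_open[OF open_U assms, of "cartan_curv ?\<Theta> (Mid i) Top" "\<lambda>\<mu> \<nu> p. 0"]
      by (simp add: cc ext_d2_zero)
    also have "\<dots> = (\<Sum>C\<in>UNIV. wedge21 (cartan_curv ?\<Theta> (Mid i) C) (?\<Theta> C Top) \<mu> \<nu> \<kappa> p
        - wedge21 (cartan_curv ?\<Theta> C Top) (?\<Theta> (Mid i) C) \<mu> \<nu> \<kappa> p)"
      by (intro cartan_curv_bianchi[OF open_U _ assms] smooth_form1_cartan open_U smooth_theta
          smooth_form1_zero smooth_gamma)
    also have "\<dots> = (\<Sum>j\<in>UNIV. \<Sum>k\<in>UNIV. eta i k * wedge21 (curv \<gamma> k j) (\<theta> j) \<mu> \<nu> \<kappa> p)"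
      using assms by (simp add: sum_cidx wedge21_def cc sum_distrib_left sum_distrib_right sum.distrib algebra_simps)
    also have "\<dots> = (\<Sum>k\<in>UNIV. eta i k * (\<Sum>j\<in>UNIV. wedge21 (curv \<gamma> k j) (\<theta> j) \<mu> \<nu> \<kappa> p))"
      unfolding sum_distrib_left by (rule sum.swap)
    finally show ?thesis by simp
  qed
  show ?thesis
    using eta_eta_contract[of i "\<lambda>l. \<Sum>j\<in>UNIV. wedge21 (curv \<gamma> l j) (\<theta> j) \<mu> \<nu> \<kappa> p"]
    by (simp add: z)
qed

text \<open>A term is dropped when the argument of theta^k in it is vertical; this is what the case
  distinctions record.\<close>

lemma first_bianchi_comp:
  assumes "p \<in> U"
  shows "(case N of Fr k \<Rightarrow> comp2 \<theta> (curv \<gamma> i k) L M p | _ \<Rightarrow> 0)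
    + (case L of Fr k \<Rightarrow> comp2 \<theta> (curv \<gamma> i k) M N p | _ \<Rightarrow> 0)
    + (case M of Fr k \<Rightarrow> comp2 \<theta> (curv \<gamma> i k) N L p | _ \<Rightarrow> 0) = 0"
proof -
  have c: "(\<Sum>k\<in>UNIV. comp2 \<theta> (curv \<gamma> i k) L M p * comp1 \<theta> (\<theta> k) N p)
      = (case N of Fr k \<Rightarrow> comp2 \<theta> (curv \<gamma> i k) L M p | _ \<Rightarrow> 0)" for L M N
    using assms by (cases N) (simp_all add: comp1_theta if_distrib[where f="\<lambda>x. _ * x"] cong: if_cong)
  have "0 = comp3 \<theta> (\<lambda>\<mu> \<nu> \<kappa> p. \<Sum>k\<in>UNIV. wedge21 (curv \<gamma> i k) (\<theta> k) \<mu> \<nu> \<kappa> p) L M N p"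
    using assms by (simp add: comp3_def first_bianchi)
  also have "\<dots> = (\<Sum>k\<in>UNIV. comp2 \<theta> (curv \<gamma> i k) L M p * comp1 \<theta> (\<theta> k) N p)
      + (\<Sum>k\<in>UNIV. comp2 \<theta> (curv \<gamma> i k) M N p * comp1 \<theta> (\<theta> k) L p)
      + (\<Sum>k\<in>UNIV. comp2 \<theta> (curv \<gamma> i k) N L p * comp1 \<theta> (\<theta> k) M p)"
    by (simp add: comp3_sum comp3_wedge21 sum.distrib)
  finally show ?thesis by (simp only: c)
qed

lemma comp2_curv_skew: "p \<in> U \<Longrightarrow> comp2 \<theta> (curv \<gamma> i j) L M p = - comp2 \<theta> (curv \<gamma> j i) L M p"
  unfolding comp2_def sum_negf[symmetric] by (intro sum.cong refl, subst curv_skew) simp_all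

lemma comp2_curv_swap: "comp2 \<theta> (curv \<gamma> i j) L M p = - comp2 \<theta> (curv \<gamma> i j) M L p"
  by (rule comp2_swap) (rule curv_swap)

text \<open>With one vertical argument the first Bianchi identity becomes symmetry in j, k, which
  contradicts skewness in i, j unless the component is 0. With two vertical arguments a single term
  of the identity is left.\<close>

lemma comp2_curv:
  assumes "p \<in> U"
  shows "comp2 \<theta> (curv \<gamma> i j) L M p = (case (L, M) of (Fr k, Fr m) \<Rightarrow> Riem \<theta> \<gamma> i j k m p | _ \<Rightarrow> 0)"
proof -
  have mixed: "comp2 \<theta> (curv \<gamma> i j) (Fr k) M p = 0" if M: "M = Fs \<or> M = Fss" for i j k M
  proof -
    let ?t = "\<lambda>i j k. comp2 \<theta> (curv \<gamma> i j) (Fr k) M p"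
    have sym: "?t i j k = ?t i k j" for i j k
      using first_bianchi_comp[OF assms, where N = "Fr j" and i = i and L = "Fr k" and M = M] comp2_curv_swap[of i k M "Fr j" p] M by auto
    have "?t i j k = - ?t i j k"
      by (metis sym comp2_curv_skew[OF assms] minus_minus)
    then show ?thesis by (metis eq_neg_iff_add_eq_0 mult_2 mult_eq_0_iff zero_neq_numeral)
  qed
  moreover have "comp2 \<theta> (curv \<gamma> i j) M (Fr k) p = 0" if "M = Fs \<or> M = Fss" for k M
    using mixed[OF that, of i j k] comp2_curv_swap[of i j M "Fr k" p] by simp
  moreover have "comp2 \<theta> (curv \<gamma> i j) M M p = 0" for M
    using comp2_curv_swap[of i j M M p] by (metis eq_neg_iff_add_eq_0 mult_2 mult_eq_0_iff zero_neq_numeral)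
  moreover have "comp2 \<theta> (curv \<gamma> i j) Fs Fss p = 0"
    using first_bianchi_comp[OF assms, where N = "Fr j" and i = i and L = Fs and M = Fss] by simp
  moreover from this have "comp2 \<theta> (curv \<gamma> i j) Fss Fs p = 0"
    using comp2_curv_swap[of i j Fss Fs p] by simp
  ultimately show ?thesis by (cases L; cases M) (simp_all add: Riem_def)
qed

section \<open>Algebraic symmetries of the Riemann, Ricci and Weyl tensors\<close>

lemma Riem_skew12: "p \<in> U \<Longrightarrow> Riem \<theta> \<gamma> i j k m p = - Riem \<theta> \<gamma> j i k m p"
  unfolding Riem_def by (rule comp2_curv_skew)

lemma Riem_skew34: "Riem \<theta> \<gamma> i j k m p = - Riem \<theta> \<gamma> i j m k p"
  unfolding Riem_def by (rule comp2_curv_swap)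

lemma Riem_cyclic:
  "p \<in> U \<Longrightarrow> Riem \<theta> \<gamma> i j k m p + Riem \<theta> \<gamma> i k m j p + Riem \<theta> \<gamma> i m j k p = 0"
  using first_bianchi_comp[of p, where N = "Fr j" and i = i and L = "Fr k" and M = "Fr m"] by (simp add: Riem_def)

text \<open>By the cyclic identity the skew part of Ric is a trace of Riem over its first index
  pair, in which Riem is skew.\<close>

lemma Ric_commute:
  assumes "p \<in> U"
  shows "Ric \<theta> \<gamma> j m p = Ric \<theta> \<gamma> m j p"
proof -
  have "Riem \<theta> \<gamma> i j k m p - Riem \<theta> \<gamma> i m k j p = - Riem \<theta> \<gamma> i k m j p" for i k
    using Riem_cyclic[OF assms, of i j k m] Riem_skew34[of i m j k p] by (simp add: algebra_simps eq_neg_iff_add_eq_0)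
  then have "Ric \<theta> \<gamma> j m p - Ric \<theta> \<gamma> m j p = - (\<Sum>i\<in>UNIV. \<Sum>k\<in>UNIV. eta i k * Riem \<theta> \<gamma> i k m j p)"
    by (simp add: Ric_def sum_subtractf[symmetric] right_diff_distrib[symmetric] sum_negf)
  also have "(\<Sum>i\<in>UNIV. \<Sum>k\<in>UNIV. eta i k * Riem \<theta> \<gamma> i k m j p) = 0"
    using Riem_skew12[OF assms, of N0 N1 m j] Riem_skew12[OF assms, of Np Nm m j] by (simp add: sum_idx4)
  finally show ?thesis by simp
qed

lemma Weyl_skew12: "p \<in> U \<Longrightarrow> Weyl \<theta> \<gamma> i j k m p = - Weyl \<theta> \<gamma> j i k m p"
  unfolding Weyl_def using Riem_skew12[of p i j k m] by (simp add: field_simps)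

lemma Weyl_skew34: "Weyl \<theta> \<gamma> i j k m p = - Weyl \<theta> \<gamma> i j m k p"
  unfolding Weyl_def using Riem_skew34[of i j k m p] by (simp add: field_simps)

lemma Weyl_eq_schouten:
  "Weyl \<theta> \<gamma> i j k m p = Riem \<theta> \<gamma> i j k m p
    + (eta i k * schouten \<theta> \<gamma> j m p - eta i m * schouten \<theta> \<gamma> j k p
       - eta j k * schouten \<theta> \<gamma> i m p + eta j m * schouten \<theta> \<gamma> i k p)"
  by (simp add: Weyl_def schouten_def field_simps)

lemma Weyl_trace: "(\<Sum>i\<in>UNIV. \<Sum>k\<in>UNIV. eta i k * Weyl \<theta> \<gamma> i j k m p) = 0"
proof -
  have tr: "(\<Sum>i\<in>UNIV. \<Sum>k\<in>UNIV. eta i k * schouten \<theta> \<gamma> i k p) = - Scal \<theta> \<gamma> p / 6"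
  proof -
    have "(\<Sum>i\<in>UNIV. \<Sum>k\<in>UNIV. eta i k * schouten \<theta> \<gamma> i k p)
        = Scal \<theta> \<gamma> p / 12 * (\<Sum>i\<in>UNIV. \<Sum>k\<in>UNIV. eta i k * eta i k)
          - (\<Sum>i\<in>UNIV. \<Sum>k\<in>UNIV. eta i k * Ric \<theta> \<gamma> i k p) / 2"
      by (simp add: schouten_def right_diff_distrib sum_subtractf sum_distrib_left sum_divide_distrib mult_ac)
    also have "(\<Sum>i\<in>UNIV. \<Sum>k\<in>UNIV. eta i k * eta i k) = 4" by (simp add: sum_idx4)
    finally show ?thesis by (simp add: Scal_def)
  qed
  have "(\<Sum>i\<in>UNIV. \<Sum>k\<in>UNIV. eta i k * Weyl \<theta> \<gamma> i j k m p)
      = Ric \<theta> \<gamma> j m p + (2 * schouten \<theta> \<gamma> j m p + eta j m * (- Scal \<theta> \<gamma> p / 6))"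
    unfolding tr[symmetric]
    by (simp only: Weyl_eq_schouten Ric_def sum.distrib trace_kulkarni[of "\<lambda>i k. schouten \<theta> \<gamma> i k p"]
        distrib_left[of "eta i k" "Riem \<theta> \<gamma> i j k m p" for i k])
  then show ?thesis by (simp add: schouten_def field_simps)
qed

section \<open>Smoothness of the curvature tensors and the Schouten form\<close>

lemma smooth_Riem: "smooth_on U (Riem \<theta> \<gamma> i j k m)"
  unfolding Riem_def by (intro smooth_comp2 smooth_curv)

lemma smooth_Ric: "smooth_on U (Ric \<theta> \<gamma> i j)"
  unfolding Ric_def by (intro smooth_on_sum smooth_on_mult smooth_on_const smooth_Riem open_U)

lemma smooth_Scal: "smooth_on U (Scal \<theta> \<gamma>)"
  unfolding Scal_def by (intro smooth_on_sum smooth_on_mult smooth_on_const smooth_Ric open_U)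

lemma smooth_schouten: "smooth_on U (schouten \<theta> \<gamma> i j)"
  unfolding schouten_def
  by (intro smooth_on_diff smooth_on_divide smooth_on_mult smooth_on_const smooth_Ric smooth_Scal open_U) simp_all

lemma smooth_Weyl: "smooth_on U (Weyl \<theta> \<gamma> i j k m)"
  unfolding Weyl_eq_schouten[abs_def]
  by (intro smooth_on_add smooth_on_diff smooth_on_mult smooth_on_const smooth_Riem smooth_schouten open_U)

lemma smooth_schouten_form: "smooth_form1 U (schouten_form \<theta> \<gamma> i)"
  using smooth_theta unfolding smooth_form1_def schouten_form_def
  by (intro allI smooth_on_sum smooth_on_mult smooth_schouten open_U) blast

lemma comp1_schouten_form:
  "p \<in> U \<Longrightarrow> comp1 \<theta> (schouten_form \<theta> \<gamma> i) L p = (case L of Fr j \<Rightarrow> schouten \<theta> \<gamma> i j p | _ \<Rightarrow> 0)"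
  unfolding schouten_form_def comp1_sum comp1_scale
  by (cases L) (simp_all add: comp1_theta if_distrib[where f="\<lambda>x. _ * x"] cong: if_cong)

lemma schouten_commute: "p \<in> U \<Longrightarrow> schouten \<theta> \<gamma> i j p = schouten \<theta> \<gamma> j i p"
  using Ric_commute[of p i j] by (simp add: schouten_def eta_commute[of i j])

text \<open>Symmetry of the Schouten tensor makes the scalar obstruction of
  \<open>cartan_curv_eq_block\<close> vanish in the case A = 0.\<close>

lemma schouten_form_wedge_theta:
  assumes "p \<in> U"
  shows "(\<Sum>k\<in>UNIV. wedge (schouten_form \<theta> \<gamma> k) (\<theta> k) \<mu> \<nu> p) = 0"
proof -
  have "(\<Sum>k\<in>UNIV. \<Sum>j\<in>UNIV. schouten \<theta> \<gamma> k j p * \<theta> j \<mu> p * \<theta> k \<nu> p)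
      = (\<Sum>j\<in>UNIV. \<Sum>k\<in>UNIV. schouten \<theta> \<gamma> k j p * \<theta> j \<mu> p * \<theta> k \<nu> p)"
    by (rule sum.swap)
  also have "\<dots> = (\<Sum>j\<in>UNIV. \<Sum>k\<in>UNIV. schouten \<theta> \<gamma> j k p * \<theta> k \<nu> p * \<theta> j \<mu> p)"
    by (intro sum.cong refl, subst schouten_commute[OF assms]) (simp add: mult_ac)
  finally show ?thesis
    by (simp add: wedge_def schouten_form_def sum_subtractf sum_distrib_right)
qed

lemma Omega2_schouten_form:
  assumes "p \<in> U"
  shows "Omega2 \<theta> \<gamma> (schouten_form \<theta> \<gamma>) i j \<mu> \<nu> p = horizontal_form \<theta> (Weyl \<theta> \<gamma> i j) \<mu> \<nu> p"
proof (rule form2_eqI[OF assms])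
  fix L M
  note delta = if_distrib[where f="\<lambda>x. _ * x"] if_distrib[where f="\<lambda>x. x * _"]
  have tr: "(\<Sum>k\<in>UNIV. comp2 \<theta> (wedge (schouten_form \<theta> \<gamma> k) (\<theta> k)) L M p) = 0"
    unfolding comp2_sum[symmetric] by (simp add: comp2_def schouten_form_wedge_theta[OF assms])
  show "comp2 \<theta> (Omega2 \<theta> \<gamma> (schouten_form \<theta> \<gamma>) i j) L M p
      = comp2 \<theta> (horizontal_form \<theta> (Weyl \<theta> \<gamma> i j)) L M p"
    unfolding comp2_Omega2 tr unfolding comp2_horizontal_form[OF assms, of "Weyl \<theta> \<gamma> i j", OF Weyl_skew34] comp2_wedge
    by (cases L; cases M)
      (simp_all add: assms comp1_theta comp1_schouten_form comp2_curv Weyl_eq_schouten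
        right_diff_distrib left_diff_distrib sum_subtractf delta mult.commute[of "schouten _ _ _ _ _"] cong: if_cong)
qed

end

section \<open>The second Bianchi identity and the divergence of the Weyl tensor\<close>

text \<open>Unlike \<open>nabla4\<close>, this allows the directions \<open>e\<^sub>s\<close>, \<open>e\<^sub>s\<^sub>*\<close>.\<close>

definition cov_deriv :: "(idx4 \<Rightarrow> form1) \<Rightarrow> (idx4 \<Rightarrow> idx4 \<Rightarrow> form1)
    \<Rightarrow> (idx4 \<Rightarrow> idx4 \<Rightarrow> idx4 \<Rightarrow> idx4 \<Rightarrow> J6 \<Rightarrow> complex)
    \<Rightarrow> idx6 \<Rightarrow> idx4 \<Rightarrow> idx4 \<Rightarrow> idx4 \<Rightarrow> idx4 \<Rightarrow> J6 \<Rightarrow> complex" where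
  "cov_deriv \<theta> \<gamma> C N i j m n = (\<lambda>p.
     let \<Gamma> = (\<lambda>k i'. \<Sum>h\<in>UNIV. eta k h * comp1 \<theta> (\<gamma> h i') N p) in
     vderiv (dual_frame \<theta> N) (C i j m n) p
       - (\<Sum>k\<in>UNIV. \<Gamma> k i * C k j m n p + \<Gamma> k j * C i k m n p
            + \<Gamma> k m * C i j k n p + \<Gamma> k n * C i j m k p))"

lemma nabla4_eq_cov_deriv: "nabla4 \<theta> \<gamma> C l i j m n = cov_deriv \<theta> \<gamma> C (Fr l) i j m n"
  by (simp add: nabla4_def cov_deriv_def)

definition lower_theta :: "(idx4 \<Rightarrow> form1) \<Rightarrow> idx4 \<Rightarrow> form1" where
  "lower_theta \<theta> i = (\<lambda>\<mu> p. \<Sum>k\<in>UNIV. eta i k * \<theta> k \<mu> p)"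

lemma vderiv_cong_open:
  assumes "open U" "p \<in> U" "\<And>q. q \<in> U \<Longrightarrow> f q = g q"
  shows "vderiv X f p = vderiv X g p"
  unfolding vderiv_def by (subst pd_cong_open[OF assms]) simp_all

lemma vderiv_minus: "f differentiable (at p) \<Longrightarrow> vderiv X (\<lambda>q. - f q) p = - vderiv X f p"
  by (simp add: vderiv_def pd_minus sum_negf)

lemma vderiv_const: "vderiv X (\<lambda>q. c) p = 0"
  by (simp add: vderiv_def)

lemma vderiv_lincomb:
  assumes "finite I" "\<And>k. k \<in> I \<Longrightarrow> f k differentiable (at p)"
  shows "vderiv X (\<lambda>q. \<Sum>k\<in>I. c k * f k q) p = (\<Sum>k\<in>I. c k * vderiv X (f k) p)"
proof -
  have "(\<lambda>p. c k * f k p) differentiable (at p)" if "k \<in> I" for k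
    using assms that by (intro differentiable_mult) simp_all
  then have "vderiv X (\<lambda>q. \<Sum>k\<in>I. c k * f k q) p = (\<Sum>\<mu>\<in>UNIV. \<Sum>k\<in>I. c k * (X \<mu> p * pd \<mu> (f k) p))"
    using assms by (simp add: vderiv_def pd_sum pd_cmult sum_distrib_left mult_ac)
  also have "\<dots> = (\<Sum>k\<in>I. c k * vderiv X (f k) p)"
    unfolding vderiv_def sum_distrib_left by (rule sum.swap)
  finally show ?thesis .
qed

lemma ext_d2_lincomb:
  assumes "finite I" "\<And>k \<mu> \<nu>. k \<in> I \<Longrightarrow> \<Omega> k \<mu> \<nu> differentiable (at p)"
  shows "ext_d2 (\<lambda>\<mu> \<nu> p. \<Sum>k\<in>I. c k * \<Omega> k \<mu> \<nu> p) \<mu> \<nu> \<kappa> p = (\<Sum>k\<in>I. c k * ext_d2 (\<Omega> k) \<mu> \<nu> \<kappa> p)"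
proof -
  have "(\<lambda>p. c k * \<Omega> k \<mu> \<nu> p) differentiable (at p)" if "k \<in> I" for k \<mu> \<nu>
    using assms that by (intro differentiable_mult) simp_all
  then show ?thesis
    using assms by (simp add: ext_d2_def pd_sum pd_cmult sum.distrib distrib_left)
qed

text \<open>Taking the trace of the hypothesis gives 6 t = 0 for the trace t of y, since eta has
  trace 4 with itself; then 2 y = 0.\<close>

lemma trace_adjusted_eq_0:
  fixes y :: "idx4 \<Rightarrow> idx4 \<Rightarrow> complex"
  assumes "\<And>i m. 2 * y i m + eta i m * (\<Sum>j\<in>UNIV. \<Sum>n\<in>UNIV. eta j n * y j n) = 0"
  shows "y i m = 0"
proof -
  define t where "t = (\<Sum>j\<in>UNIV. \<Sum>n\<in>UNIV. eta j n * y j n)"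
  have y: "y i m = - (eta i m * t) / 2" for i m
    using assms[of i m] unfolding t_def[symmetric] by (simp add: eq_neg_iff_add_eq_0 field_simps)
  have "t = (\<Sum>j\<in>UNIV. \<Sum>n\<in>UNIV. eta j n * (- (eta j n * t) / 2))"
    unfolding y[symmetric] by (simp add: t_def)
  also have "\<dots> = - 2 * t" by (simp add: sum_idx4)
  finally have "t = 0" by simp
  with y show ?thesis by simp
qed

lemma eta_trace_contract:
  shows "(\<Sum>j\<in>UNIV. \<Sum>l\<in>UNIV. eta j l * (f l * eta j n)) = f n"
    and "(\<Sum>j\<in>UNIV. \<Sum>l\<in>UNIV. eta j l * (f j * eta n l)) = f n"
    and "(\<Sum>j\<in>UNIV. \<Sum>l\<in>UNIV. eta j l * (c * eta j l)) = 4 * c"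
    and "(\<Sum>j\<in>UNIV. \<Sum>l\<in>UNIV. eta j l * (g j l * c)) = (\<Sum>j\<in>UNIV. \<Sum>l\<in>UNIV. eta j l * g j l) * c"
  by (cases n; simp add: sum_idx4; fail)+ (simp_all add: sum_idx4 algebra_simps)

text \<open>Infinitesimal orthogonal transformations preserve the trace; this is why the covariant
  derivative commutes with contraction.\<close>

lemma trace_skew_action:
  fixes g c :: "idx4 \<Rightarrow> idx4 \<Rightarrow> complex"
  assumes "\<And>h i. g h i = - g i h"
  shows "(\<Sum>i\<in>UNIV. \<Sum>m\<in>UNIV. eta i m * (\<Sum>k\<in>UNIV. (\<Sum>h\<in>UNIV. eta k h * g h i) * c k m
      + (\<Sum>h\<in>UNIV. eta k h * g h m) * c i k)) = 0"
proof -
  have d: "g i i = 0" for i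
    using assms[of i i] by (metis eq_neg_iff_add_eq_0 mult_2 mult_eq_0_iff zero_neq_numeral)
  note r = assms[of Np N0] assms[of Nm N0] assms[of N1 N0] assms[of Nm Np] assms[of N1 Np] assms[of N1 Nm]
  show ?thesis by (simp add: sum_idx4 d r algebra_simps)
qed

context smooth_coframe
begin

lemma comp1_lower_theta: "p \<in> U \<Longrightarrow> comp1 \<theta> (lower_theta \<theta> i) L p = (case L of Fr k \<Rightarrow> eta i k | _ \<Rightarrow> 0)"
  unfolding lower_theta_def comp1_sum comp1_scale
  by (cases L) (simp_all add: comp1_theta if_distrib[where f="\<lambda>x. _ * x"] cong: if_cong)

lemma smooth_horizontal_form:
  "(\<And>l m. smooth_on U (C l m)) \<Longrightarrow> smooth_form2 U (horizontal_form \<theta> C)"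
  using smooth_form2_wedge[OF open_U smooth_theta smooth_theta]
  unfolding smooth_form2_def horizontal_form_def
  by (intro allI smooth_on_mult smooth_on_const smooth_on_sum open_U) blast+

lemma ext_d2_horizontal_form:
  assumes p: "p \<in> U" and C: "\<And>l m. smooth_on U (C l m)"
  shows "ext_d2 (horizontal_form \<theta> C) \<mu> \<nu> \<kappa> p = 1/2 * (\<Sum>l\<in>UNIV. \<Sum>m\<in>UNIV.
      wedge21 (wedge (\<theta> l) (\<theta> m)) (\<lambda>\<mu>. pd \<mu> (C l m)) \<mu> \<nu> \<kappa> p
      + C l m p * (wedge21 (ext_d (\<theta> l)) (\<theta> m) \<mu> \<nu> \<kappa> p - wedge21 (ext_d (\<theta> m)) (\<theta> l) \<mu> \<nu> \<kappa> p))"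
proof -
  have dC: "C l m differentiable (at p)" for l m using C p smooth_on_differentiable by blast
  have sw: "smooth_form2 U (wedge (\<theta> l) (\<theta> m))" for l m
    by (intro smooth_form2_wedge open_U smooth_theta)
  have st: "smooth_form2 U (\<lambda>\<mu> \<nu> p. C l m p * wedge (\<theta> l) (\<theta> m) \<mu> \<nu> p)" for l m
    using sw C unfolding smooth_form2_def by (intro allI smooth_on_mult open_U) blast+
  have ss: "smooth_form2 U (\<lambda>\<mu> \<nu> p. \<Sum>m\<in>UNIV. C l m p * wedge (\<theta> l) (\<theta> m) \<mu> \<nu> p)" for l
    by (intro smooth_form2_sum open_U st)
  have sss: "smooth_form2 U (\<lambda>\<mu> \<nu> p. \<Sum>l\<in>UNIV. \<Sum>m\<in>UNIV. C l m p * wedge (\<theta> l) (\<theta> m) \<mu> \<nu> p)"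
    by (intro smooth_form2_sum open_U ss)
  have "ext_d2 (horizontal_form \<theta> C) \<mu> \<nu> \<kappa> p
      = 1/2 * ext_d2 (\<lambda>\<mu> \<nu> p. \<Sum>l\<in>UNIV. \<Sum>m\<in>UNIV. C l m p * wedge (\<theta> l) (\<theta> m) \<mu> \<nu> p) \<mu> \<nu> \<kappa> p"
    unfolding horizontal_form_def
    using ext_d2_scale[of "\<lambda>p. 1/2" p, OF _ smooth_form2_differentiable[OF sss p]]
    by (simp add: wedge21_def)
  also have "\<dots> = 1/2 * (\<Sum>l\<in>UNIV. \<Sum>m\<in>UNIV. ext_d2 (\<lambda>\<mu> \<nu> p. C l m p * wedge (\<theta> l) (\<theta> m) \<mu> \<nu> p) \<mu> \<nu> \<kappa> p)"
    by (simp add: ext_d2_sum[OF _ ss p] ext_d2_sum[OF _ st p])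
  also have "\<dots> = 1/2 * (\<Sum>l\<in>UNIV. \<Sum>m\<in>UNIV.
      wedge21 (wedge (\<theta> l) (\<theta> m)) (\<lambda>\<mu>. pd \<mu> (C l m)) \<mu> \<nu> \<kappa> p
      + C l m p * (wedge21 (ext_d (\<theta> l)) (\<theta> m) \<mu> \<nu> \<kappa> p - wedge21 (ext_d (\<theta> m)) (\<theta> l) \<mu> \<nu> \<kappa> p))"
    by (simp add: ext_d2_scale[OF dC smooth_form2_differentiable[OF sw p]] ext_d2_wedge[OF smooth_theta smooth_theta p])
  finally show ?thesis .
qed

text \<open>\<open>dC\<close> collects the derivatives of the coefficients and \<open>K\<close> the
  contribution of the d theta^l. Skewness of C makes the two halves of each sum equal and absorbs
  the factor 1/2.\<close>

lemma comp3_ext_d2_horizontal_form: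
  assumes p: "p \<in> U" and C: "\<And>l m. smooth_on U (C l m)" and skew: "\<And>l m q. C l m q = - C m l q"
  defines "dC \<equiv> \<lambda>L M N. case (L, M) of (Fr l, Fr m) \<Rightarrow> vderiv (dual_frame \<theta> N) (C l m) p | _ \<Rightarrow> 0"
    and "K \<equiv> \<lambda>L M N. \<Sum>l\<in>UNIV. (case N of Fr n \<Rightarrow> C l n p | _ \<Rightarrow> 0) * comp2 \<theta> (ext_d (\<theta> l)) L M p"
  shows "comp3 \<theta> (ext_d2 (horizontal_form \<theta> C)) L M N p
    = dC L M N + dC M N L + dC N L M + (K L M N + K M N L + K N L M)"
proof -
  note delta = if_distrib[where f="\<lambda>x. _ * x"] if_distrib[where f="\<lambda>x. x * _"]
  let ?d = "\<lambda>L l. if L = Fr l then 1 else 0 :: complex"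
  let ?A = "\<lambda>L M N. 1/2 * (\<Sum>l\<in>UNIV. \<Sum>m\<in>UNIV. (?d L l * ?d M m - ?d M l * ?d L m)
      * vderiv (dual_frame \<theta> N) (C l m) p)"
  let ?B = "\<lambda>L M N. 1/2 * (\<Sum>l\<in>UNIV. \<Sum>m\<in>UNIV. C l m p *
      (comp2 \<theta> (ext_d (\<theta> l)) L M p * ?d N m - comp2 \<theta> (ext_d (\<theta> m)) L M p * ?d N l))"
  have "comp3 \<theta> (ext_d2 (horizontal_form \<theta> C)) L M N p
      = comp3 \<theta> (\<lambda>\<mu> \<nu> \<kappa> p. 1/2 * (\<Sum>l\<in>UNIV. \<Sum>m\<in>UNIV.
      wedge21 (wedge (\<theta> l) (\<theta> m)) (\<lambda>\<mu>. pd \<mu> (C l m)) \<mu> \<nu> \<kappa> p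
      + C l m p * (wedge21 (ext_d (\<theta> l)) (\<theta> m) \<mu> \<nu> \<kappa> p - wedge21 (ext_d (\<theta> m)) (\<theta> l) \<mu> \<nu> \<kappa> p))) L M N p"
    by (rule comp3_cong) (rule ext_d2_horizontal_form[OF p C])
  also have "\<dots> = ?A L M N + ?A M N L + ?A N L M + (?B L M N + ?B M N L + ?B N L M)"
    unfolding comp3_scale
    by (simp add: comp3_sum comp3_add comp3_scale comp3_diff comp3_wedge21 comp2_wedge
        comp1_theta[OF p] comp1_pd sum.distrib[symmetric] distrib_left[symmetric] del: sum.distrib)
      (simp add: algebra_simps)
  finally have expand: "comp3 \<theta> (ext_d2 (horizontal_form \<theta> C)) L M N p
      = ?A L M N + ?A M N L + ?A N L M + (?B L M N + ?B M N L + ?B N L M)" .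
  have A: "?A L M N = dC L M N" for L M N
  proof -
    have "vderiv (dual_frame \<theta> N) (C l m) p = vderiv (dual_frame \<theta> N) (\<lambda>q. - C m l q) p" for l m
      by (rule vderiv_cong_open[OF open_U p]) (rule skew)
    then have v: "vderiv (dual_frame \<theta> N) (C l m) p = - vderiv (dual_frame \<theta> N) (C m l) p" for l m
      using C p smooth_on_differentiable vderiv_minus by metis
    have half: "1/2 * (vderiv (dual_frame \<theta> N) (C l m) p - vderiv (dual_frame \<theta> N) (C m l) p)
        = vderiv (dual_frame \<theta> N) (C l m) p" for l m
      by (subst v[of m l]) simp
    have 1: "?A (Fr l) (Fr m) N = 1/2 * (vderiv (dual_frame \<theta> N) (C l m) p - vderiv (dual_frame \<theta> N) (C m l) p)" for l m
      by (simp add: left_diff_distrib sum_subtractf delta cong: if_cong)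
    show ?thesis
      by (cases L; cases M) (simp_all only: 1 half dC_def prod.case idx6.case, simp_all)
  qed
  have B: "?B L M N = K L M N" for L M N
  proof (cases N)
    case (Fr n)
    let ?T = "\<lambda>l. comp2 \<theta> (ext_d (\<theta> l)) L M p"
    have "?B L M N = 1/2 * ((\<Sum>l\<in>UNIV. C l n p * ?T l) - (\<Sum>m\<in>UNIV. C n m p * ?T m))"
      using Fr by (simp add: right_diff_distrib sum_subtractf delta sum_distrib_left cong: if_cong)
        (simp add: sum.swap[of _ UNIV UNIV] sum_subtractf delta cong: if_cong)
    also have "(\<Sum>m\<in>UNIV. C n m p * ?T m) = - (\<Sum>l\<in>UNIV. C l n p * ?T l)"
      unfolding sum_negf[symmetric] by (intro sum.cong refl, subst skew) simp
    finally show ?thesis using Fr by (simp add: K_def)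
  qed (simp_all add: K_def)
  show ?thesis unfolding expand A B ..
qed

end

context lc_coframe
begin

lemma comp2_ext_d_theta:
  assumes "p \<in> U"
  shows "comp2 \<theta> (ext_d (\<theta> m)) L M p
    = (case L of Fr l \<Rightarrow> \<Sum>h\<in>UNIV. eta m h * comp1 \<theta> (\<gamma> h l) M p | _ \<Rightarrow> 0)
      - (case M of Fr l \<Rightarrow> \<Sum>h\<in>UNIV. eta m h * comp1 \<theta> (\<gamma> h l) L p | _ \<Rightarrow> 0)"
proof -
  note delta = if_distrib[where f="\<lambda>x. _ * x"] if_distrib[where f="\<lambda>x. x * _"]
  have "ext_d (\<theta> m) \<mu> \<nu> p = - (\<Sum>h\<in>UNIV. \<Sum>j\<in>UNIV. eta m h * wedge (\<gamma> h j) (\<theta> j) \<mu> \<nu> p)" for \<mu> \<nu>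
    using lc assms by (simp add: levi_civita_def torsion_free_def eq_neg_iff_add_eq_0)
  then have "comp2 \<theta> (ext_d (\<theta> m)) L M p
      = comp2 \<theta> (\<lambda>\<mu> \<nu> p. (- 1) * (\<Sum>h\<in>UNIV. \<Sum>j\<in>UNIV. eta m h * wedge (\<gamma> h j) (\<theta> j) \<mu> \<nu> p)) L M p"
    by (intro comp2_cong) simp
  also have "\<dots> = - (\<Sum>h\<in>UNIV. eta m h * (\<Sum>j\<in>UNIV. comp2 \<theta> (wedge (\<gamma> h j) (\<theta> j)) L M p))"
    unfolding comp2_scale by (simp add: comp2_sum comp2_scale sum_distrib_left sum_negf)
  also have "\<dots> = (case L of Fr l \<Rightarrow> \<Sum>h\<in>UNIV. eta m h * comp1 \<theta> (\<gamma> h l) M p | _ \<Rightarrow> 0)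
      - (case M of Fr l \<Rightarrow> \<Sum>h\<in>UNIV. eta m h * comp1 \<theta> (\<gamma> h l) L p | _ \<Rightarrow> 0)"
    using assms
    by (cases L; cases M)
      (simp_all add: comp2_wedge comp1_theta sum_subtractf sum_negf right_diff_distrib delta cong: if_cong)
  finally show ?thesis .
qed

lemma cartan_curv_schouten:
  assumes "p \<in> U"
  shows "cartan_curv (cartan \<theta> \<gamma> (\<lambda>\<mu> p. 0) (schouten_form \<theta> \<gamma>)) B C \<mu> \<nu> p
    = cartan_curv_block (\<lambda>i j. horizontal_form \<theta> (Weyl \<theta> \<gamma> i j)) (Omega1 \<gamma> (schouten_form \<theta> \<gamma>)) B C \<mu> \<nu> p"
  unfolding cartan_curv_eq_block[OF open_U assms smooth_theta smooth_form1_zero smooth_schouten_form gamma_weyl]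
  by (cases B; cases C)
    (simp_all add: assms Omega2_schouten_form ext_d_zero schouten_form_wedge_theta)

text \<open>The (\<open>Mid i\<close>, \<open>Mid j\<close>) entry of the Bianchi identity for the Cartan connection, with \<open>i\<close> lowered.\<close>

lemma weyl_bianchi:
  assumes p: "p \<in> U"
  defines "W \<equiv> \<lambda>i j. horizontal_form \<theta> (Weyl \<theta> \<gamma> i j)" and "Y \<equiv> Omega1 \<gamma> (schouten_form \<theta> \<gamma>)"
  shows "ext_d2 (W i j) \<mu> \<nu> \<kappa> p
    = wedge21 (Y i) (lower_theta \<theta> j) \<mu> \<nu> \<kappa> p - wedge21 (Y j) (lower_theta \<theta> i) \<mu> \<nu> \<kappa> p
      + (\<Sum>k\<in>UNIV. \<Sum>l\<in>UNIV. eta k l * (wedge21 (W i k) (\<gamma> l j) \<mu> \<nu> \<kappa> p - wedge21 (W k j) (\<gamma> i l) \<mu> \<nu> \<kappa> p))"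
    (is "_ = ?X i j")
proof -
  let ?\<Theta> = "cartan \<theta> \<gamma> (\<lambda>\<mu> p. 0) (schouten_form \<theta> \<gamma>)"
  have cc: "cartan_curv ?\<Theta> B C \<mu> \<nu> q = cartan_curv_block W Y B C \<mu> \<nu> q" if "q \<in> U" for B C \<mu> \<nu> q
    unfolding W_def Y_def by (rule cartan_curv_schouten[OF that])
  have "(\<Sum>k\<in>UNIV. eta i k * ext_d2 (W k j) \<mu> \<nu> \<kappa> p) = (\<Sum>k\<in>UNIV. eta i k * ?X k j)" for i
  proof -
    have "(\<Sum>k\<in>UNIV. eta i k * ext_d2 (W k j) \<mu> \<nu> \<kappa> p)
        = ext_d2 (\<lambda>\<mu> \<nu> p. \<Sum>k\<in>UNIV. eta i k * W k j \<mu> \<nu> p) \<mu> \<nu> \<kappa> p"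
      unfolding W_def
      by (rule ext_d2_lincomb[symmetric])
        (simp_all add: smooth_form2_differentiable[OF smooth_horizontal_form[OF smooth_Weyl] p])
    also have "\<dots> = ext_d2 (cartan_curv ?\<Theta> (Mid i) (Mid j)) \<mu> \<nu> \<kappa> p"
      by (rule ext_d2_cong_open[OF open_U p]) (simp add: cc)
    also have "\<dots> = (\<Sum>C\<in>UNIV. wedge21 (cartan_curv ?\<Theta> (Mid i) C) (?\<Theta> C (Mid j)) \<mu> \<nu> \<kappa> p
        - wedge21 (cartan_curv ?\<Theta> C (Mid j)) (?\<Theta> (Mid i) C) \<mu> \<nu> \<kappa> p)"
      by (intro cartan_curv_bianchi[OF open_U _ p] smooth_form1_cartan open_U smooth_theta
          smooth_form1_zero smooth_gamma smooth_schouten_form)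
    also have "\<dots> = (\<Sum>k\<in>UNIV. eta i k * ?X k j)"
      unfolding sum_cidx wedge21_def cc[OF p] lower_theta_def cartan.simps cartan_curv_block.simps
        gamma_skew_part[OF p, symmetric]
      by (cases i) (simp_all add: sum_idx4 algebra_simps)
    finally show ?thesis .
  qed
  then have "(\<Sum>k\<in>UNIV. eta i k * (\<Sum>l\<in>UNIV. eta k l * ext_d2 (W l j) \<mu> \<nu> \<kappa> p))
      = (\<Sum>k\<in>UNIV. eta i k * (\<Sum>l\<in>UNIV. eta k l * ?X l j))" by simp
  then show ?thesis by (simp only: eta_eta_contract)
qed

text \<open>Splits the connection terms by origin: those on i, j come from the gamma terms in
  \<open>weyl_bianchi\<close>, those on m, n from d theta. The last term is flipped to match the
  index order in \<open>comp3_ext_d2_horizontal_form\<close>.\<close>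

lemma weyl_cov_deriv_skew34:
  "cov_deriv \<theta> \<gamma> (Weyl \<theta> \<gamma>) N i j m n p
    = vderiv (dual_frame \<theta> N) (Weyl \<theta> \<gamma> i j m n) p
      - (\<Sum>k\<in>UNIV. (\<Sum>h\<in>UNIV. eta k h * comp1 \<theta> (\<gamma> h i) N p) * Weyl \<theta> \<gamma> k j m n p
          + (\<Sum>h\<in>UNIV. eta k h * comp1 \<theta> (\<gamma> h j) N p) * Weyl \<theta> \<gamma> i k m n p)
      - (\<Sum>k\<in>UNIV. (\<Sum>h\<in>UNIV. eta k h * comp1 \<theta> (\<gamma> h m) N p) * Weyl \<theta> \<gamma> i j k n p
          - (\<Sum>h\<in>UNIV. eta k h * comp1 \<theta> (\<gamma> h n) N p) * Weyl \<theta> \<gamma> i j k m p)"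
proof -
  have "x * Weyl \<theta> \<gamma> i j m k p = - (x * Weyl \<theta> \<gamma> i j k m p)" for k x
    by (subst Weyl_skew34) simp
  then show ?thesis
    unfolding cov_deriv_def Let_def by (simp add: sum.distrib sum_subtractf sum_negf)
qed

lemma cov_deriv_Weyl_skew12:
  assumes p: "p \<in> U"
  shows "cov_deriv \<theta> \<gamma> (Weyl \<theta> \<gamma>) N i j m n p = - cov_deriv \<theta> \<gamma> (Weyl \<theta> \<gamma>) N j i m n p"
proof -
  have "vderiv X (Weyl \<theta> \<gamma> i j m n) p = vderiv X (\<lambda>q. - Weyl \<theta> \<gamma> j i m n q) p" for X
    by (rule vderiv_cong_open[OF open_U p]) (rule Weyl_skew12)
  then have 1: "vderiv X (Weyl \<theta> \<gamma> i j m n) p = - vderiv X (Weyl \<theta> \<gamma> j i m n) p" for X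
    using vderiv_minus[OF smooth_on_differentiable[OF smooth_Weyl p]] by simp
  have 2: "x * Weyl \<theta> \<gamma> k i m n p = - (x * Weyl \<theta> \<gamma> i k m n p)"
    "x * Weyl \<theta> \<gamma> k j m n p = - (x * Weyl \<theta> \<gamma> j k m n p)"
    "x * Weyl \<theta> \<gamma> i j m n p = - (x * Weyl \<theta> \<gamma> j i m n p)" for k x m n
    by (subst Weyl_skew12[OF p]; simp)+
  have 3: "(\<Sum>k\<in>UNIV. x k * Weyl \<theta> \<gamma> k j m n p + y k * Weyl \<theta> \<gamma> i k m n p)
      = - (\<Sum>k\<in>UNIV. y k * Weyl \<theta> \<gamma> k i m n p + x k * Weyl \<theta> \<gamma> j k m n p)" for x y
    unfolding sum_negf[symmetric] 2(1,2) by (intro sum.cong refl) simp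
  have 4: "(\<Sum>k\<in>UNIV. x k * Weyl \<theta> \<gamma> i j k n p - y k * Weyl \<theta> \<gamma> i j k m p)
      = - (\<Sum>k\<in>UNIV. x k * Weyl \<theta> \<gamma> j i k n p - y k * Weyl \<theta> \<gamma> j i k m p)" for x y
    unfolding sum_negf[symmetric] 2(3) by (intro sum.cong refl) simp
  show ?thesis
    unfolding weyl_cov_deriv_skew34 1 3 4 by simp
qed

lemma cov_deriv_Weyl_skew34:
  assumes p: "p \<in> U"
  shows "cov_deriv \<theta> \<gamma> (Weyl \<theta> \<gamma>) N i j m n p = - cov_deriv \<theta> \<gamma> (Weyl \<theta> \<gamma>) N i j n m p"
proof -
  have "vderiv X (Weyl \<theta> \<gamma> i j m n) p = vderiv X (\<lambda>q. - Weyl \<theta> \<gamma> i j n m q) p" for X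
    by (rule vderiv_cong_open[OF open_U p]) (rule Weyl_skew34)
  then have 1: "vderiv X (Weyl \<theta> \<gamma> i j m n) p = - vderiv X (Weyl \<theta> \<gamma> i j n m) p" for X
    using vderiv_minus[OF smooth_on_differentiable[OF smooth_Weyl p]] by simp
  have 2: "x * Weyl \<theta> \<gamma> i j m n p = - (x * Weyl \<theta> \<gamma> i j n m p)" for x i j
    by (subst Weyl_skew34) simp
  have 3: "(\<Sum>k\<in>UNIV. x k * Weyl \<theta> \<gamma> k j m n p + y k * Weyl \<theta> \<gamma> i k m n p)
      = - (\<Sum>k\<in>UNIV. x k * Weyl \<theta> \<gamma> k j n m p + y k * Weyl \<theta> \<gamma> i k n m p)" for x y
    unfolding sum_negf[symmetric] 2 by (intro sum.cong refl) simp
  have 4: "(\<Sum>k\<in>UNIV. x k * Weyl \<theta> \<gamma> i j k n p - y k * Weyl \<theta> \<gamma> i j k m p)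
      = - (\<Sum>k\<in>UNIV. y k * Weyl \<theta> \<gamma> i j k m p - x k * Weyl \<theta> \<gamma> i j k n p)" for x y
    unfolding sum_negf[symmetric] by (intro sum.cong refl) simp
  show ?thesis
    unfolding weyl_cov_deriv_skew34 1 3 by (subst 4) simp
qed

lemma comp1_gamma_skew: "p \<in> U \<Longrightarrow> comp1 \<theta> (\<gamma> i j) N p = - comp1 \<theta> (\<gamma> j i) N p"
  unfolding comp1_def sum_negf[symmetric] by (intro sum.cong refl, subst gamma_skew) simp_all

text \<open>The connection terms on the contracted pair cancel by \<open>trace_skew_action\<close>;
  those on the free indices, and the derivative itself, contain the trace of the Weyl
  tensor.\<close>

lemma cov_deriv_Weyl_trace13:
  assumes p: "p \<in> U"
  shows "(\<Sum>i\<in>UNIV. \<Sum>m\<in>UNIV. eta i m * cov_deriv \<theta> \<gamma> (Weyl \<theta> \<gamma>) N i j m n p) = 0"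
proof -
  let ?C = "\<lambda>i j m n. Weyl \<theta> \<gamma> i j m n p"
  let ?G = "\<lambda>k i. \<Sum>h\<in>UNIV. eta k h * comp1 \<theta> (\<gamma> h i) N p"
  note d = smooth_on_differentiable[OF smooth_Weyl p]
  have dv: "(\<Sum>i\<in>UNIV. \<Sum>m\<in>UNIV. eta i m * vderiv X (Weyl \<theta> \<gamma> i j m n) p) = 0" for X
  proof -
    have ds: "(\<lambda>q. \<Sum>m\<in>UNIV. eta i m * Weyl \<theta> \<gamma> i j m n q) differentiable (at p)" for i
      using d by (intro differentiable_sum differentiable_mult) simp_all
    have "(\<Sum>i\<in>UNIV. \<Sum>m\<in>UNIV. eta i m * vderiv X (Weyl \<theta> \<gamma> i j m n) p)
      = (\<Sum>i\<in>UNIV. 1 * vderiv X (\<lambda>q. \<Sum>m\<in>UNIV. eta i m * Weyl \<theta> \<gamma> i j m n q) p)"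
      by (simp add: vderiv_lincomb d)
    also have "\<dots> = vderiv X (\<lambda>q. \<Sum>i\<in>UNIV. 1 * (\<Sum>m\<in>UNIV. eta i m * Weyl \<theta> \<gamma> i j m n q)) p"
      by (rule vderiv_lincomb[symmetric]) (simp_all only: ds finite)
    also have "\<dots> = 0" by (simp add: Weyl_trace vderiv_const)
    finally show ?thesis .
  qed
  have 2: "(\<Sum>i\<in>UNIV. \<Sum>m\<in>UNIV. eta i m * (\<Sum>k\<in>UNIV. ?G k j * ?C i k m n)) = 0"
  proof -
    have "(\<Sum>i\<in>UNIV. \<Sum>m\<in>UNIV. eta i m * (\<Sum>k\<in>UNIV. ?G k j * ?C i k m n))
        = (\<Sum>k\<in>UNIV. ?G k j * (\<Sum>i\<in>UNIV. \<Sum>m\<in>UNIV. eta i m * ?C i k m n))"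
      by (simp add: sum_idx4 algebra_simps)
    then show ?thesis by (simp add: Weyl_trace)
  qed
  have 4: "(\<Sum>i\<in>UNIV. \<Sum>m\<in>UNIV. eta i m * (\<Sum>k\<in>UNIV. ?G k n * ?C i j m k)) = 0"
  proof -
    have "(\<Sum>i\<in>UNIV. \<Sum>m\<in>UNIV. eta i m * (\<Sum>k\<in>UNIV. ?G k n * ?C i j m k))
        = (\<Sum>k\<in>UNIV. ?G k n * (\<Sum>i\<in>UNIV. \<Sum>m\<in>UNIV. eta i m * ?C i j m k))"
      by (simp add: sum_idx4 algebra_simps)
    then show ?thesis by (simp add: Weyl_trace)
  qed
  have "(\<Sum>i\<in>UNIV. \<Sum>m\<in>UNIV. eta i m * cov_deriv \<theta> \<gamma> (Weyl \<theta> \<gamma>) N i j m n p)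
      = (\<Sum>i\<in>UNIV. \<Sum>m\<in>UNIV. eta i m * vderiv (dual_frame \<theta> N) (Weyl \<theta> \<gamma> i j m n) p)
        - (\<Sum>i\<in>UNIV. \<Sum>m\<in>UNIV. eta i m * (\<Sum>k\<in>UNIV. ?G k i * ?C k j m n + ?G k m * ?C i j k n))
        - (\<Sum>i\<in>UNIV. \<Sum>m\<in>UNIV. eta i m * (\<Sum>k\<in>UNIV. ?G k j * ?C i k m n))
        - (\<Sum>i\<in>UNIV. \<Sum>m\<in>UNIV. eta i m * (\<Sum>k\<in>UNIV. ?G k n * ?C i j m k))"
    unfolding sum_subtractf[symmetric] right_diff_distrib[symmetric]
    by (intro sum.cong refl arg_cong[where f = "\<lambda>x. eta _ _ * x"])
      (simp add: cov_deriv_def sum.distrib)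
  also have "(\<Sum>i\<in>UNIV. \<Sum>m\<in>UNIV. eta i m * (\<Sum>k\<in>UNIV. ?G k i * ?C k j m n + ?G k m * ?C i j k n)) = 0"
    by (rule trace_skew_action[of "\<lambda>h i. comp1 \<theta> (\<gamma> h i) N p" "\<lambda>k m. ?C k j m n"])
      (rule comp1_gamma_skew[OF p])
  finally show ?thesis by (simp add: dv 2 4)
qed

text \<open>The Bianchi identity of the Weyl form as a tensor equation. The directions range over
  all six frame vectors, because the vertical cases are what shows that the forms \<Omega>_i are
  horizontal.\<close>

lemma weyl_bianchi_comp:
  fixes i j :: idx4 and L M N :: idx6
  assumes p: "p \<in> U"
  defines "DW \<equiv> \<lambda>N L M. case (L, M) of (Fr m, Fr n) \<Rightarrow> cov_deriv \<theta> \<gamma> (Weyl \<theta> \<gamma>) N i j m n p | _ \<Rightarrow> 0"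
    and "y \<equiv> \<lambda>i L M. comp2 \<theta> (Omega1 \<gamma> (schouten_form \<theta> \<gamma>) i) L M p"
    and "t \<equiv> \<lambda>j N. case N of Fr n \<Rightarrow> eta j n | _ \<Rightarrow> 0"
  shows "DW N L M + DW L M N + DW M N L
    = y i L M * t j N + y i M N * t j L + y i N L * t j M
      - (y j L M * t i N + y j M N * t i L + y j N L * t i M)"
proof -
  let ?G = "\<lambda>k i N. \<Sum>h\<in>UNIV. eta k h * comp1 \<theta> (\<gamma> h i) N p"
  let ?W = "\<lambda>i j. horizontal_form \<theta> (Weyl \<theta> \<gamma> i j)"
  let ?C = "\<lambda>i j L M. case (L, M) of (Fr l, Fr m) \<Rightarrow> Weyl \<theta> \<gamma> i j l m p | _ \<Rightarrow> 0"
  have W: "comp2 \<theta> (?W i j) L M p = ?C i j L M" for i j L M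
    by (rule comp2_horizontal_form[OF p Weyl_skew34])
  \<comment> \<open>Skewness of gamma turns the matrix commutator into the connection terms on i and
    j.\<close>
  have conn: "(\<Sum>k\<in>UNIV. \<Sum>l\<in>UNIV. eta k l * (?C i k L M * comp1 \<theta> (\<gamma> l j) N p - ?C k j L M * comp1 \<theta> (\<gamma> i l) N p))
      = (\<Sum>k\<in>UNIV. ?G k i N * ?C k j L M + ?G k j N * ?C i k L M)" for L M N
  proof (rule sum.cong[OF refl])
    fix k
    have "(\<Sum>l\<in>UNIV. eta k l * (?C i k L M * comp1 \<theta> (\<gamma> l j) N p - ?C k j L M * comp1 \<theta> (\<gamma> i l) N p))
        = (\<Sum>l\<in>UNIV. eta k l * comp1 \<theta> (\<gamma> l i) N p * ?C k j L M + eta k l * comp1 \<theta> (\<gamma> l j) N p * ?C i k L M)"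
      by (intro sum.cong refl, subst comp1_gamma_skew[OF p, of i]) (simp add: algebra_simps)
    then show "(\<Sum>l\<in>UNIV. eta k l * (?C i k L M * comp1 \<theta> (\<gamma> l j) N p - ?C k j L M * comp1 \<theta> (\<gamma> i l) N p))
        = ?G k i N * ?C k j L M + ?G k j N * ?C i k L M"
      by (simp add: sum.distrib sum_distrib_right)
  qed
  have "comp3 \<theta> (ext_d2 (?W i j)) L M N p
      = comp3 \<theta> (\<lambda>\<mu> \<nu> \<kappa> p. wedge21 (Omega1 \<gamma> (schouten_form \<theta> \<gamma>) i) (lower_theta \<theta> j) \<mu> \<nu> \<kappa> p
        - wedge21 (Omega1 \<gamma> (schouten_form \<theta> \<gamma>) j) (lower_theta \<theta> i) \<mu> \<nu> \<kappa> p
        + (\<Sum>k\<in>UNIV. \<Sum>l\<in>UNIV. eta k l * (wedge21 (?W i k) (\<gamma> l j) \<mu> \<nu> \<kappa> p - wedge21 (?W k j) (\<gamma> i l) \<mu> \<nu> \<kappa> p))) L M N p"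
    by (rule comp3_cong) (rule weyl_bianchi[OF p])
  also have "\<dots> = y i L M * t j N + y i M N * t j L + y i N L * t j M
      - (y j L M * t i N + y j M N * t i L + y j N L * t i M)
      + ((\<Sum>k\<in>UNIV. \<Sum>l\<in>UNIV. eta k l * (?C i k L M * comp1 \<theta> (\<gamma> l j) N p - ?C k j L M * comp1 \<theta> (\<gamma> i l) N p))
       + (\<Sum>k\<in>UNIV. \<Sum>l\<in>UNIV. eta k l * (?C i k M N * comp1 \<theta> (\<gamma> l j) L p - ?C k j M N * comp1 \<theta> (\<gamma> i l) L p))
       + (\<Sum>k\<in>UNIV. \<Sum>l\<in>UNIV. eta k l * (?C i k N L * comp1 \<theta> (\<gamma> l j) M p - ?C k j N L * comp1 \<theta> (\<gamma> i l) M p)))"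
    unfolding y_def t_def
    by (simp only: comp3_add comp3_diff comp3_sum finite comp3_scale comp3_wedge21 W comp1_lower_theta[OF p]
        sum.distrib[symmetric] distrib_left[symmetric])
      (simp only: algebra_simps)
  finally have rhs: "comp3 \<theta> (ext_d2 (?W i j)) L M N p = \<dots>" .
  show ?thesis
    using rhs unfolding comp3_ext_d2_horizontal_form[OF p smooth_Weyl Weyl_skew34] comp2_ext_d_theta[OF p] conn
    unfolding DW_def weyl_cov_deriv_skew34
    by (cases L; cases M; cases N)
      (simp_all add: sum_subtractf sum.distrib sum_negf right_diff_distrib algebra_simps)
qed

lemma comp2_Omega1_schouten_swap:
  "comp2 \<theta> (Omega1 \<gamma> (schouten_form \<theta> \<gamma>) i) L M p = - comp2 \<theta> (Omega1 \<gamma> (schouten_form \<theta> \<gamma>) i) M L p"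
proof (rule comp2_swap)
  fix \<mu> \<nu>
  show "Omega1 \<gamma> (schouten_form \<theta> \<gamma>) i \<mu> \<nu> p = - Omega1 \<gamma> (schouten_form \<theta> \<gamma>) i \<nu> \<mu> p"
    unfolding Omega1_def by (subst ext_d_swap, subst wedge_swap) (simp add: sum_negf)
qed

text \<open>Each case of \<open>weyl_bianchi_comp\<close> is used: two vertical arguments, one
  vertical argument, none. In the last two the trace-free property of the covariant derivative of
  the Weyl tensor isolates the wanted component.\<close>

lemma comp2_Omega1_schouten:
  assumes p: "p \<in> U"
  shows "comp2 \<theta> (Omega1 \<gamma> (schouten_form \<theta> \<gamma>) i) L M p
    = (case (L, M) of (Fr m, Fr n) \<Rightarrow> divWeyl \<theta> \<gamma> i m n p | _ \<Rightarrow> 0)"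
proof -
  let ?y = "\<lambda>i L M. comp2 \<theta> (Omega1 \<gamma> (schouten_form \<theta> \<gamma>) i) L M p"
  let ?D = "\<lambda>N i j m n. cov_deriv \<theta> \<gamma> (Weyl \<theta> \<gamma>) N i j m n p"
  note B = weyl_bianchi_comp[OF p]
  note swap = comp2_Omega1_schouten_swap
  have self: "?y i L L = 0" for i L
    using swap[of i L L p] by (metis eq_neg_iff_add_eq_0 mult_2 mult_eq_0_iff zero_neq_numeral)
  have tr24: "(\<Sum>j\<in>UNIV. \<Sum>n\<in>UNIV. eta j n * ?D N i j m n) = 0" for N i m
    using cov_deriv_Weyl_trace13[OF p, of N i m]
    by (simp add: cov_deriv_Weyl_skew12[OF p, of N i] cov_deriv_Weyl_skew34[OF p, of N _ i m])
  have tr23: "(\<Sum>j\<in>UNIV. \<Sum>l\<in>UNIV. eta j l * ?D N i j l m) = 0" for N i m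
    using tr24[of N i m] by (subst cov_deriv_Weyl_skew34[OF p]) (simp add: sum_negf)
  have ss: "?y i Fs Fss = 0" for i
  proof -
    have 1: "?y i Fs Fss * eta j n = ?y j Fs Fss * eta i n" for j n
      using B[where L = Fs and M = Fss and N = "Fr n" and i = i and j = j] by simp
    show ?thesis
      \<comment> \<open>For every i one of the two pairs has eta j n nonzero while eta i n is
        0.\<close>
      using 1[of Np Nm] 1[of N0 N1] by (cases i) simp_all
  qed
  have s: "?y i S (Fr m) = 0" if S: "S = Fs \<or> S = Fss" for i m S
  proof (rule trace_adjusted_eq_0[of "\<lambda>i m. ?y i S (Fr m)"])
    fix i m
    \<comment> \<open>Of the three cyclic terms on the left only the derivative along S has two
      horizontal form indices.\<close>
    have e: "?D S i j m n = ?y i S (Fr m) * eta j n + ?y i (Fr n) S * eta j m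
        - (?y j S (Fr m) * eta i n + ?y j (Fr n) S * eta i m)" for j n
      using B[where L = "Fr m" and M = "Fr n" and N = S and i = i and j = j] B[where L = S and M = "Fr m" and N = "Fr n" and i = i and j = j] S by auto
    have "0 = (\<Sum>j\<in>UNIV. \<Sum>n\<in>UNIV. eta j n * (?y i S (Fr m) * eta j n + ?y i (Fr n) S * eta j m
        - (?y j S (Fr m) * eta i n + ?y j (Fr n) S * eta i m)))"
      using tr24[of S i m] by (simp only: e)
    also have "\<dots> = 4 * ?y i S (Fr m) + ?y i (Fr m) S
        - (?y i S (Fr m) + (\<Sum>j\<in>UNIV. \<Sum>n\<in>UNIV. eta j n * ?y j (Fr n) S) * eta i m)"
      by (simp only: right_diff_distrib distrib_left sum_subtractf sum.distrib eta_trace_contract)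
    also have "(\<Sum>j\<in>UNIV. \<Sum>n\<in>UNIV. eta j n * ?y j (Fr n) S) = - (\<Sum>j\<in>UNIV. \<Sum>n\<in>UNIV. eta j n * ?y j S (Fr n))"
      unfolding sum_negf[symmetric] by (intro sum.cong refl, subst swap) simp
    also have "?y i (Fr m) S = - ?y i S (Fr m)" by (rule swap)
    finally show "2 * ?y i S (Fr m) + eta i m * (\<Sum>j\<in>UNIV. \<Sum>n\<in>UNIV. eta j n * ?y j S (Fr n)) = 0"
      by (simp add: algebra_simps)
  qed
  have d: "divWeyl \<theta> \<gamma> i m n p = ?y i (Fr m) (Fr n)" for i m n
  proof -
    define tr where "tr m = (\<Sum>j\<in>UNIV. \<Sum>l\<in>UNIV. eta j l * ?y j (Fr l) (Fr m))" for m
    \<comment> \<open>Contracting the identity over j and l, the two terms in which the derivative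
      index is not contracted vanish by \<open>tr24\<close> and \<open>tr23\<close>; the remaining
      one is the divergence.\<close>
    have div: "divWeyl \<theta> \<gamma> i m n p = ?y i (Fr m) (Fr n) - tr m * eta i n + tr n * eta i m" for i m n
    proof -
      have "(\<Sum>j\<in>UNIV. \<Sum>l\<in>UNIV. eta j l * (?D (Fr l) i j m n + ?D (Fr m) i j n l + ?D (Fr n) i j l m))
          = divWeyl \<theta> \<gamma> i m n p + 0 + 0"
        unfolding divWeyl_def nabla4_eq_cov_deriv
        by (simp only: distrib_left sum.distrib tr24 tr23)
      moreover have "?D (Fr l) i j m n + ?D (Fr m) i j n l + ?D (Fr n) i j l m
        = ?y i (Fr m) (Fr n) * eta j l + ?y i (Fr n) (Fr l) * eta j m + ?y i (Fr l) (Fr m) * eta j n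
        - (?y j (Fr m) (Fr n) * eta i l + ?y j (Fr n) (Fr l) * eta i m + ?y j (Fr l) (Fr m) * eta i n)" for j l
        using B[where L = "Fr m" and M = "Fr n" and N = "Fr l" and i = i and j = j] by simp
      ultimately have "divWeyl \<theta> \<gamma> i m n p = (\<Sum>j\<in>UNIV. \<Sum>l\<in>UNIV. eta j l *
          (?y i (Fr m) (Fr n) * eta j l + ?y i (Fr n) (Fr l) * eta j m + ?y i (Fr l) (Fr m) * eta j n
        - (?y j (Fr m) (Fr n) * eta i l + ?y j (Fr n) (Fr l) * eta i m + ?y j (Fr l) (Fr m) * eta i n)))"
        by simp
      also have "\<dots> = 4 * ?y i (Fr m) (Fr n) + ?y i (Fr n) (Fr m) + ?y i (Fr n) (Fr m)
        - (?y i (Fr m) (Fr n) + (\<Sum>j\<in>UNIV. \<Sum>l\<in>UNIV. eta j l * ?y j (Fr n) (Fr l)) * eta i m + tr m * eta i n)"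
        unfolding tr_def
        by (simp only: right_diff_distrib distrib_left sum_subtractf sum.distrib eta_trace_contract)
      also have "(\<Sum>j\<in>UNIV. \<Sum>l\<in>UNIV. eta j l * ?y j (Fr n) (Fr l)) = - tr n"
        unfolding tr_def sum_negf[symmetric] by (intro sum.cong refl, subst swap) simp
      also have "?y i (Fr n) (Fr m) = - ?y i (Fr m) (Fr n)" by (rule swap)
      finally show ?thesis by (simp add: algebra_simps)
    qed
    \<comment> \<open>The trace of the divergence over i, m is 0 because the Weyl tensor is
      trace-free; by \<open>div\<close> it also equals 4 tr n.\<close>
    have "tr n = 0" for n
    proof -
      have "0 = (\<Sum>j\<in>UNIV. \<Sum>l\<in>UNIV. eta j l * (\<Sum>i\<in>UNIV. \<Sum>m\<in>UNIV. eta i m * ?D (Fr l) i j m n))"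
        by (simp add: cov_deriv_Weyl_trace13[OF p])
      also have "\<dots> = (\<Sum>i\<in>UNIV. \<Sum>m\<in>UNIV. eta i m * divWeyl \<theta> \<gamma> i m n p)"
        unfolding divWeyl_def nabla4_eq_cov_deriv by (simp add: sum_idx4 algebra_simps)
      also have "\<dots> = (\<Sum>i\<in>UNIV. \<Sum>m\<in>UNIV. eta i m * (?y i (Fr m) (Fr n) - tr m * eta i n + tr n * eta i m))"
        by (simp only: div)
      also have "\<dots> = tr n - tr n + 4 * tr n"
        by (simp only: right_diff_distrib distrib_left sum_subtractf sum.distrib eta_trace_contract tr_def[symmetric])
      finally show ?thesis by simp
    qed
    then show ?thesis by (simp add: div)
  qed
  have s': "?y i (Fr m) S = 0" if "S = Fs \<or> S = Fss" for m S
    using s[OF that, of i m] swap[of i "Fr m" S p] by simp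
  have ss': "?y i Fss Fs = 0" using ss[of i] swap[of i Fss Fs p] by simp
  show ?thesis
    by (cases L; cases M) (simp_all add: s s' ss ss' self d)
qed

lemma divWeyl_skew: "p \<in> U \<Longrightarrow> divWeyl \<theta> \<gamma> i m n p = - divWeyl \<theta> \<gamma> i n m p"
  using comp2_Omega1_schouten[of p i "Fr m" "Fr n"] comp2_Omega1_schouten[of p i "Fr n" "Fr m"]
    comp2_Omega1_schouten_swap[of i "Fr m" "Fr n" p] by simp

lemma Omega1_schouten_form:
  assumes p: "p \<in> U"
  shows "Omega1 \<gamma> (schouten_form \<theta> \<gamma>) i \<mu> \<nu> p = horizontal_form \<theta> (divWeyl \<theta> \<gamma> i) \<mu> \<nu> p"
  by (rule form2_eqI[OF p])
    (simp add: comp2_Omega1_schouten[OF p] comp2_horizontal_form[OF p, of "divWeyl \<theta> \<gamma> i", OF divWeyl_skew[OF p]])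

end

section \<open>Changing the Weyl one-form\<close>

definition norm_sq :: "(idx4 \<Rightarrow> J6 \<Rightarrow> complex) \<Rightarrow> J6 \<Rightarrow> complex" where
  "norm_sq Ai = (\<lambda>p. \<Sum>i\<in>UNIV. \<Sum>k\<in>UNIV. eta i k * (Ai i p * Ai k p))"

text \<open>The exponential of the nilpotent matrix with A_j in the place of Psi_j in
  \<open>cartan\<close> and zeros in the independent remaining blocks; the entry with 1/2 is its
  quadratic term.\<close>

fun gauge :: "(idx4 \<Rightarrow> J6 \<Rightarrow> complex) \<Rightarrow> cidx \<Rightarrow> cidx \<Rightarrow> J6 \<Rightarrow> complex" where
  "gauge Ai Top Top = (\<lambda>p. 1)"
| "gauge Ai Top (Mid j) = Ai j"
| "gauge Ai Top Bot = (\<lambda>p. 1 / 2 * norm_sq Ai p)"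
| "gauge Ai (Mid i) (Mid j) = (\<lambda>p. if i = j then 1 else 0)"
| "gauge Ai (Mid i) Bot = (\<lambda>p. \<Sum>k\<in>UNIV. eta i k * Ai k p)"
| "gauge Ai Bot Bot = (\<lambda>p. 1)"
| "gauge Ai _ _ = (\<lambda>p. 0)"

text \<open>Found by solving the (Top, Mid j) entry of the gauge equation for the new Psi_j.\<close>

definition weyl_schouten_form :: "(idx4 \<Rightarrow> form1) \<Rightarrow> (idx4 \<Rightarrow> idx4 \<Rightarrow> form1) \<Rightarrow> (idx4 \<Rightarrow> idx4 \<Rightarrow> form1)
    \<Rightarrow> (idx4 \<Rightarrow> J6 \<Rightarrow> complex) \<Rightarrow> idx4 \<Rightarrow> form1" where
  "weyl_schouten_form \<theta> \<gamma> \<omega> Ai j = (\<lambda>\<mu> p. schouten_form \<theta> \<gamma> j \<mu> p + pd \<mu> (Ai j) p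
     - (\<Sum>i\<in>UNIV. Ai i p * (\<Sum>k\<in>UNIV. eta i k * skew_part \<omega> k j \<mu> p))
     - norm_sq Ai p / 2 * lower_theta \<theta> j \<mu> p)"

lemma sum_lower_theta_wedge: "(\<Sum>j\<in>UNIV. wedge (lower_theta \<theta> j) (\<theta> j) \<mu> \<nu> p) = 0"
  by (simp add: wedge_def lower_theta_def sum_idx4 algebra_simps)

lemma pd_norm_sq:
  assumes "\<And>i. Ai i differentiable (at p)"
  shows "pd \<mu> (\<lambda>p. 1 / 2 * norm_sq Ai p) p = (\<Sum>i\<in>UNIV. \<Sum>k\<in>UNIV. eta i k * (Ai i p * pd \<mu> (Ai k) p))"
proof -
  have d1: "(\<lambda>p. Ai i p * Ai k p) differentiable (at p)" for i k
    using assms by (intro differentiable_mult)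
  have d2: "(\<lambda>p. eta i k * (Ai i p * Ai k p)) differentiable (at p)" for i k
    by (rule differentiable_mult[OF differentiable_const d1])
  have d3: "(\<lambda>p. \<Sum>k\<in>UNIV. eta i k * (Ai i p * Ai k p)) differentiable (at p)" for i
    using d2 by (intro differentiable_sum) simp_all
  have d4: "norm_sq Ai differentiable (at p)"
    unfolding norm_sq_def using d3 by (intro differentiable_sum) simp_all
  have n: "pd \<mu> (norm_sq Ai) p = (\<Sum>i\<in>UNIV. \<Sum>k\<in>UNIV. eta i k * (Ai i p * pd \<mu> (Ai k) p + pd \<mu> (Ai i) p * Ai k p))"
    unfolding norm_sq_def by (simp add: pd_sum d3 d2 pd_cmult d1 pd_mult assms)
  show ?thesis
    unfolding pd_cmult[OF d4] n by (simp add: sum_idx4 algebra_simps)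
qed

lemma cartan_skew:
  "(\<Sum>C\<in>UNIV. cartan \<theta> \<omega> A \<Psi> C B \<mu> p * Qform C D) + (\<Sum>C\<in>UNIV. Qform B C * cartan \<theta> \<omega> A \<Psi> C D \<mu> p) = 0"
proof (cases B)
  case (Mid i)
  then show ?thesis
    by (cases D; cases i) (auto simp: sum_cidx sum_idx4 skew_part_skew eta_commute, (case_tac x2; simp add: skew_part_skew)+)
next
  case Top
  then show ?thesis by (cases D) (auto simp: sum_cidx sum_idx4, (case_tac x2; simp)+)
next
  case Bot
  then show ?thesis by (cases D) (auto simp: sum_cidx sum_idx4, (case_tac x2; simp)+)
qed

lemma cartan_in_o42_complex: "matrix_at (cartan \<theta> \<omega> A \<Psi>) p v \<in> o42_complex"
proof -
  let ?X = "matrix_at (cartan \<theta> \<omega> A \<Psi>) p v"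
  have "(\<Sum>C\<in>UNIV. ?X $ C $ B * Qform C D) + (\<Sum>C\<in>UNIV. Qform B C * ?X $ C $ D) = 0" for B D
  proof -
    have 1: "(\<Sum>C\<in>UNIV. ?X $ C $ B * Qform C D)
        = (\<Sum>\<mu>\<in>UNIV. (\<Sum>C\<in>UNIV. cartan \<theta> \<omega> A \<Psi> C B \<mu> p * Qform C D) * crd \<mu> v)"
      unfolding sum_distrib_right
      by (subst sum.swap) (simp add: matrix_at_def form1_at_def sum_distrib_left sum_distrib_right mult_ac)
    have 2: "(\<Sum>C\<in>UNIV. Qform B C * ?X $ C $ D)
        = (\<Sum>\<mu>\<in>UNIV. (\<Sum>C\<in>UNIV. Qform B C * cartan \<theta> \<omega> A \<Psi> C D \<mu> p) * crd \<mu> v)"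
      unfolding sum_distrib_right
      by (subst sum.swap) (simp add: matrix_at_def form1_at_def sum_distrib_left mult_ac)
    have "(\<Sum>C\<in>UNIV. ?X $ C $ B * Qform C D) + (\<Sum>C\<in>UNIV. Qform B C * ?X $ C $ D)
        = (\<Sum>\<mu>\<in>UNIV. ((\<Sum>C\<in>UNIV. cartan \<theta> \<omega> A \<Psi> C B \<mu> p * Qform C D)
            + (\<Sum>C\<in>UNIV. Qform B C * cartan \<theta> \<omega> A \<Psi> C D \<mu> p)) * crd \<mu> v)"
      unfolding 1 2 by (simp only: distrib_right sum.distrib)
    then show ?thesis by (simp add: cartan_skew)
  qed
  then show ?thesis
    by (simp add: o42_complex_def matrix_matrix_mult_def transpose_def Qmat_def vec_eq_iff)
qed

section \<open>Uniqueness of the normalized forms Psi\<close>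

context smooth_coframe
begin

text \<open>The expression is affine in Psi, so the curvature of omega drops out of the difference
  of two solutions.\<close>

lemma comp2_Omega2_eq:
  fixes \<Psi> :: "idx4 \<Rightarrow> form1" and i j :: idx4
  assumes p: "p \<in> U"
  defines "t \<equiv> \<lambda>i L. case L of Fr l \<Rightarrow> eta i l | _ \<Rightarrow> 0"
    and "d \<equiv> \<lambda>i L. comp1 \<theta> (\<Psi> i) L p"
  shows "comp2 \<theta> (Omega2 \<theta> \<omega> \<Psi> i j) L M p = comp2 \<theta> (curv \<omega> i j) L M p
    + (t i L * d j M - t i M * d j L) + (d i L * t j M - d i M * t j L)
    - eta i j * ((case M of Fr m \<Rightarrow> d m L | _ \<Rightarrow> 0) - (case L of Fr l \<Rightarrow> d l M | _ \<Rightarrow> 0))"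
proof -
  note delta = if_distrib[where f="\<lambda>x. _ * x"] if_distrib[where f="\<lambda>x. x * _"]
  have 1: "(\<Sum>l\<in>UNIV. eta i l * comp2 \<theta> (wedge (\<theta> l) (\<Psi> j)) L M p) = t i L * d j M - t i M * d j L"
    by (cases L; cases M)
      (simp_all add: t_def d_def comp2_wedge comp1_theta[OF p] right_diff_distrib sum_subtractf sum_negf delta cong: if_cong)
  have 2: "(\<Sum>l\<in>UNIV. comp2 \<theta> (wedge (\<Psi> i) (\<theta> l)) L M p * eta j l) = d i L * t j M - d i M * t j L"
    by (cases L; cases M)
      (simp_all add: t_def d_def comp2_wedge comp1_theta[OF p] left_diff_distrib sum_subtractf sum_negf delta mult.commute[of "eta _ _"] cong: if_cong)
  have 3: "(\<Sum>k\<in>UNIV. comp2 \<theta> (wedge (\<Psi> k) (\<theta> k)) L M p)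
      = (case M of Fr m \<Rightarrow> d m L | _ \<Rightarrow> 0) - (case L of Fr l \<Rightarrow> d l M | _ \<Rightarrow> 0)"
    by (cases L; cases M)
      (simp_all add: d_def comp2_wedge comp1_theta[OF p] sum_subtractf sum_negf delta cong: if_cong)
  show ?thesis unfolding comp2_Omega2 1 2 3 ..
qed

text \<open>Each normalization removes one part of the difference d: skewness of the curvature its
  skew part, the trace condition its symmetric part, and the absence of mixed components its
  vertical part.\<close>

lemma normalized_unique:
  assumes n: "normalized U \<theta> \<omega> \<Psi>" and n': "normalized U \<theta> \<omega> \<Psi>'" and p: "p \<in> U"
  shows "\<Psi>' i \<mu> p = \<Psi> i \<mu> p"
proof -
  define d where "d i L = comp1 \<theta> (\<Psi>' i) L p - comp1 \<theta> (\<Psi> i) L p" for i L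
  define t where "t i L = (case L of Fr l \<Rightarrow> eta i l | _ \<Rightarrow> 0)" for i L
  define D where "D i j L M = comp2 \<theta> (Omega2 \<theta> \<omega> \<Psi>' i j) L M p - comp2 \<theta> (Omega2 \<theta> \<omega> \<Psi> i j) L M p" for i j L M
  have D: "D i j L M = (t i L * d j M - t i M * d j L) + (d i L * t j M - d i M * t j L)
    - eta i j * ((case M of Fr m \<Rightarrow> d m L | _ \<Rightarrow> 0) - (case L of Fr l \<Rightarrow> d l M | _ \<Rightarrow> 0))" for i j L M
    unfolding D_def comp2_Omega2_eq[OF p] t_def d_def
    by (cases L; cases M) (simp_all add: algebra_simps)
  have half: "x = (x - y) / 2 \<Longrightarrow> x + y = 0" for x y :: complex
    by (simp add: field_simps eq_neg_iff_add_eq_0)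
  have "D i j (Fr k) (Fr m) + D j i (Fr k) (Fr m) = 0" for i j k m
  proof -
    have "comp2 \<theta> (Omega2 \<theta> \<omega> \<Psi> i j) (Fr k) (Fr m) p + comp2 \<theta> (Omega2 \<theta> \<omega> \<Psi> j i) (Fr k) (Fr m) p = 0"
      using n p unfolding normalized_def by (intro half) blast
    moreover have "comp2 \<theta> (Omega2 \<theta> \<omega> \<Psi>' i j) (Fr k) (Fr m) p + comp2 \<theta> (Omega2 \<theta> \<omega> \<Psi>' j i) (Fr k) (Fr m) p = 0"
      using n' p unfolding normalized_def by (intro half) blast
    ultimately show ?thesis by (simp only: D_def add_diff_add[symmetric]) simp
  qed
  \<comment> \<open>In the part symmetric in i, j only the eta i j term of the difference survives;
    \<open>N0\<close>, \<open>N1\<close> is a pair on which eta is 1.\<close>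
  from this[of N0 N1] have sym: "d m (Fr k) = d k (Fr m)" for k m
    by (simp add: D algebra_simps)
  have tr: "(\<Sum>i\<in>UNIV. \<Sum>k\<in>UNIV. eta i k * D i j (Fr k) (Fr m)) = 0" for j m
  proof -
    have "(\<Sum>i\<in>UNIV. \<Sum>k\<in>UNIV. eta i k * comp2 \<theta> (Omega2 \<theta> \<omega> \<Psi> i j) (Fr k) (Fr m) p) = 0"
      using n p unfolding normalized_def by blast
    moreover have "(\<Sum>i\<in>UNIV. \<Sum>k\<in>UNIV. eta i k * comp2 \<theta> (Omega2 \<theta> \<omega> \<Psi>' i j) (Fr k) (Fr m) p) = 0"
      using n' p unfolding normalized_def by blast
    ultimately show ?thesis by (simp only: D_def right_diff_distrib sum_subtractf) simp
  qed
  have horiz: "d j (Fr m) = 0" for j m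
  proof (rule trace_adjusted_eq_0[of "\<lambda>j m. d j (Fr m)"])
    fix j m
    have "0 = (\<Sum>i\<in>UNIV. \<Sum>k\<in>UNIV. eta i k * (eta i k * d j (Fr m) - eta i m * d j (Fr k)
        - eta j k * d i (Fr m) + eta j m * d i (Fr k)))"
      unfolding tr[of j m, symmetric]
      by (intro sum.cong refl arg_cong[where f = "\<lambda>x. eta _ _ * x"]) (simp add: D t_def sym algebra_simps)
    then show "2 * d j (Fr m) + eta j m * (\<Sum>i\<in>UNIV. \<Sum>k\<in>UNIV. eta i k * d i (Fr k)) = 0"
      using trace_kulkarni[of "\<lambda>i k. d i (Fr k)" j m] by simp
  qed
  have vert: "d j S = 0" if S: "S = Fs \<or> S = Fss" for j S
  proof -
    have "comp2 \<theta> (Omega2 \<theta> \<omega> \<Psi> i j) (Fr k) S p = 0" for i k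
      using n p S unfolding normalized_def by blast
    moreover have "comp2 \<theta> (Omega2 \<theta> \<omega> \<Psi>' i j) (Fr k) S p = 0" for i k
      using n' p S unfolding normalized_def by blast
    ultimately have "D i j (Fr k) S = 0" for i k by (simp add: D_def)
    then have "eta i k * d j S - d i S * eta j k + eta i j * d k S = 0" for i k
      using S by (auto simp: D t_def)
    from this[of Np Nm] this[of N0 N1] show ?thesis by (cases j) auto
  qed
  have "comp1 \<theta> (\<Psi>' i) L p = comp1 \<theta> (\<Psi> i) L p" for L
    using horiz vert by (cases L) (simp_all add: d_def)
  then show ?thesis by (rule form1_eqI[OF p])
qed

text \<open>The coefficients C are left general because the lemma is used for the Weyl tensor and
  again for its conjugate with relabelled indices.\<close>

lemma normalizedI:
  assumes eq: "\<And>p i j \<mu> \<nu>. p \<in> U \<Longrightarrow> Omega2 \<theta> \<omega> \<Psi> i j \<mu> \<nu> p = horizontal_form \<theta> (C i j) \<mu> \<nu> p"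
    and skew12: "\<And>p i j l m. p \<in> U \<Longrightarrow> C i j l m p = - C j i l m p"
    and skew34: "\<And>p i j l m. p \<in> U \<Longrightarrow> C i j l m p = - C i j m l p"
    and trace: "\<And>p j m. p \<in> U \<Longrightarrow> (\<Sum>i\<in>UNIV. \<Sum>k\<in>UNIV. eta i k * C i j k m p) = 0"
  shows "normalized U \<theta> \<omega> \<Psi>"
proof -
  have c: "comp2 \<theta> (Omega2 \<theta> \<omega> \<Psi> i j) L M p = (case (L, M) of (Fr l, Fr m) \<Rightarrow> C i j l m p | _ \<Rightarrow> 0)"
    if p: "p \<in> U" for i j L M p
  proof -
    have "comp2 \<theta> (Omega2 \<theta> \<omega> \<Psi> i j) L M p = comp2 \<theta> (horizontal_form \<theta> (C i j)) L M p"
      by (rule comp2_cong) (rule eq[OF p])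
    also have "\<dots> = (case (L, M) of (Fr l, Fr m) \<Rightarrow> C i j l m p | _ \<Rightarrow> 0)"
      by (rule comp2_horizontal_form[OF p, of "C i j", OF skew34[OF p]])
    finally show ?thesis .
  qed
  have half: "C i j l m p = (C i j l m p - C j i l m p) / 2" if "p \<in> U" for i j l m p
    by (subst skew12[OF that, of j i]) simp
  show ?thesis
    unfolding normalized_def
    by (intro ballI conjI allI; (simp only: c prod.case idx6.case; rule half trace refl)?)
qed

end

section \<open>The gauge transformation from the Levi-Civita to the Weyl connection\<close>

locale weyl_coframe = lc_coframe +
  fixes Ai :: "idx4 \<Rightarrow> J6 \<Rightarrow> complex" and \<omega> :: "idx4 \<Rightarrow> idx4 \<Rightarrow> form1"
  assumes smooth_Ai: "smooth_on U (Ai i)"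
    and weyl: "weyl_connection U \<theta> (weyl_form \<theta> Ai) \<omega>"
begin

abbreviation "A \<equiv> weyl_form \<theta> Ai"
abbreviation "\<Psi> \<equiv> weyl_schouten_form \<theta> \<gamma> \<omega> Ai"

lemma smooth_A: "smooth_form1 U A"
  using smooth_theta unfolding smooth_form1_def weyl_form_def
  by (intro allI smooth_on_sum smooth_on_mult smooth_Ai open_U) blast

lemma smooth_omega: "smooth_form1 U (\<omega> i j)"
  using weyl by (simp add: weyl_connection_def)

lemma smooth_norm_sq: "smooth_on U (norm_sq Ai)"
  unfolding norm_sq_def by (intro smooth_on_sum smooth_on_mult smooth_on_const smooth_Ai open_U)

lemma smooth_lower_theta: "smooth_form1 U (lower_theta \<theta> i)"
  using smooth_theta unfolding smooth_form1_def lower_theta_def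
  by (intro allI smooth_on_sum smooth_on_mult smooth_on_const open_U) blast

lemma smooth_Psi: "smooth_form1 U (\<Psi> i)"
  using smooth_schouten_form smooth_lower_theta smooth_form1_skew_part[OF open_U smooth_omega]
  unfolding smooth_form1_def weyl_schouten_form_def
  by (intro allI smooth_on_add smooth_on_diff smooth_on_sum smooth_on_mult smooth_on_divide smooth_on_const
      smooth_on_pd smooth_norm_sq smooth_Ai open_U) (blast | simp)+

lemma smooth_gauge: "smooth_on U (gauge Ai B C)"
  by (cases B; cases C)
    (auto intro!: smooth_on_const smooth_Ai smooth_on_mult smooth_on_divide smooth_norm_sq smooth_on_sum open_U)

text \<open>The right-hand side is the correction that cancels A \<and> theta_i, the contribution of
  the trace part to the torsion. A skew form with this property is unique by
  \<open>wedge_theta_unique\<close>.\<close>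

lemma skew_part_omega:
  assumes p: "p \<in> U"
  shows "skew_part \<omega> i j \<mu> p = \<gamma> i j \<mu> p + (Ai j p * lower_theta \<theta> i \<mu> p - Ai i p * lower_theta \<theta> j \<mu> p)"
proof -
  let ?d = "\<lambda>i j \<mu> p. skew_part \<omega> i j \<mu> p - (\<gamma> i j \<mu> p + (Ai j p * lower_theta \<theta> i \<mu> p - Ai i p * lower_theta \<theta> j \<mu> p))"
  have \<omega>: "\<omega> i j \<mu> p = skew_part \<omega> i j \<mu> p + eta i j * A \<mu> p" for i j \<mu>
    using weyl p by (simp add: weyl_connection_def)
  have "?d i j \<mu> p = 0"
  proof (rule wedge_theta_unique[OF p, of ?d])
    fix i j \<mu>
    show "?d i j \<mu> p = - ?d j i \<mu> p"
      using gamma_skew[OF p, of i j \<mu>] skew_part_swap[of \<omega> i j \<mu> p] by (simp add: algebra_simps)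
  next
    fix i \<mu> \<nu>
    \<comment> \<open>Vanishing torsion makes both sides the same multiple of d theta^i.\<close>
    have "(\<Sum>k\<in>UNIV. eta i k * (\<Sum>j\<in>UNIV. wedge (\<omega> k j) (\<theta> j) \<mu> \<nu> p))
        = (\<Sum>k\<in>UNIV. eta i k * (\<Sum>j\<in>UNIV. wedge (\<gamma> k j) (\<theta> j) \<mu> \<nu> p))" for i
      using weyl lc p unfolding weyl_connection_def levi_civita_def torsion_free_def sum_distrib_left
      by (metis (no_types, lifting) add_left_cancel)
    then have "(\<Sum>k\<in>UNIV. eta i k * (\<Sum>l\<in>UNIV. eta k l * (\<Sum>j\<in>UNIV. wedge (\<omega> l j) (\<theta> j) \<mu> \<nu> p)))
        = (\<Sum>k\<in>UNIV. eta i k * (\<Sum>l\<in>UNIV. eta k l * (\<Sum>j\<in>UNIV. wedge (\<gamma> l j) (\<theta> j) \<mu> \<nu> p)))" by simp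
    then have 1: "(\<Sum>j\<in>UNIV. wedge (\<omega> i j) (\<theta> j) \<mu> \<nu> p) = (\<Sum>j\<in>UNIV. wedge (\<gamma> i j) (\<theta> j) \<mu> \<nu> p)"
      by (simp only: eta_eta_contract)
    have 2: "(\<Sum>j\<in>UNIV. wedge (\<omega> i j) (\<theta> j) \<mu> \<nu> p) = (\<Sum>j\<in>UNIV. wedge (skew_part \<omega> i j) (\<theta> j) \<mu> \<nu> p)
        + wedge A (lower_theta \<theta> i) \<mu> \<nu> p"
      unfolding wedge_def \<omega> lower_theta_def
      by (simp add: sum.distrib sum_subtractf sum_distrib_left sum_distrib_right algebra_simps)
    \<comment> \<open>The sum of the A_j theta^j is A, and the resulting theta_i \<and> A cancels
      the A \<and> theta_i of fact 2. The last term is 0 because eta is symmetric.\<close>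
    have 3: "(\<Sum>j\<in>UNIV. wedge (?d i j) (\<theta> j) \<mu> \<nu> p) = (\<Sum>j\<in>UNIV. wedge (skew_part \<omega> i j) (\<theta> j) \<mu> \<nu> p)
        - (\<Sum>j\<in>UNIV. wedge (\<gamma> i j) (\<theta> j) \<mu> \<nu> p) - wedge (lower_theta \<theta> i) A \<mu> \<nu> p
        + Ai i p * (\<Sum>j\<in>UNIV. wedge (lower_theta \<theta> j) (\<theta> j) \<mu> \<nu> p)"
      unfolding wedge_def weyl_form_def
      by (simp add: sum.distrib sum_subtractf sum_distrib_left sum_distrib_right algebra_simps)
    show "(\<Sum>j\<in>UNIV. wedge (?d i j) (\<theta> j) \<mu> \<nu> p) = 0"
      unfolding 3 sum_lower_theta_wedge using 1 2 by (simp add: wedge_def algebra_simps)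
  qed
  then show ?thesis by simp
qed

text \<open>Entry by entry: (Top, Mid) is the choice of Psi, (Mid, Mid) is
  \<open>skew_part_omega\<close>, (Top, Top) and (Bot, Bot) say A = A_i theta^i. The entries (Top,
  Bot) and (Mid, Bot) then follow from the derivatives of the norm and of A^i.\<close>

lemma gauge_equation:
  assumes p: "p \<in> U"
  shows "(\<Sum>C\<in>UNIV. gauge Ai B C p * cartan \<theta> \<omega> A \<Psi> C D \<mu> p)
    = (\<Sum>C\<in>UNIV. cartan \<theta> \<gamma> (\<lambda>\<mu> p. 0) (schouten_form \<theta> \<gamma>) B C \<mu> p * gauge Ai C D p)
      + pd \<mu> (gauge Ai B D) p"
proof -
  note delta = if_distrib[where f="\<lambda>x. _ * x"] if_distrib[where f="\<lambda>x. x * _"]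
  note dA = smooth_on_differentiable[OF smooth_Ai p]
  have pdA: "pd \<mu> (\<lambda>p. \<Sum>k\<in>UNIV. eta i k * Ai k p) p = (\<Sum>k\<in>UNIV. eta i k * pd \<mu> (Ai k) p)" for i
  proof -
    have "(\<lambda>p. eta i k * Ai k p) differentiable (at p)" for k
      using dA by (intro differentiable_mult) simp_all
    then show ?thesis by (simp add: pd_sum pd_cmult dA)
  qed
  note unf = weyl_schouten_form_def weyl_form_def norm_sq_def lower_theta_def skew_part_omega[OF p]
    gamma_skew_part[OF p] skew_part_skew
  show ?thesis
  proof (cases B)
    case Top
    show ?thesis
    proof (cases D)
      case (Mid j)
      with Top show ?thesis
        by (simp add: sum_cidx weyl_schouten_form_def lower_theta_def delta cong: if_cong)
    next
      case Bot
      with Top show ?thesis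
        by (simp only: sum_cidx gauge.simps cartan.simps pd_norm_sq[OF dA])
            (simp add: unf sum_idx4 algebra_simps add_divide_distrib diff_divide_distrib)
    qed (use Top in \<open>simp add: sum_cidx weyl_form_def\<close>)
  next
    case (Mid i)
    show ?thesis
    proof (cases D)
      case (Mid j)
      with \<open>B = Mid i\<close> show ?thesis
        by (simp add: sum_cidx) (cases i; cases j; simp add: unf sum_idx4 algebra_simps)
    next
      case Bot
      with Mid show ?thesis
        by (simp add: sum_cidx pdA) (cases i; simp add: unf sum_idx4 algebra_simps)
    qed (use Mid in \<open>simp add: sum_cidx delta cong: if_cong\<close>)
  next
    case Bot
    show ?thesis
    proof (cases D)
      case (Mid j)
      with Bot show ?thesis by (simp add: sum_cidx delta cong: if_cong)
    qed (use Bot in \<open>simp_all add: sum_cidx weyl_form_def sum_idx4\<close>)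
  qed
qed

text \<open>All three are entries of g R' = R g, where R is the Levi-Civita matrix curvature. (Bot,
  Bot) removes the scalar obstruction, (Mid, Mid) says that the Weyl form is unchanged, and (Top,
  Mid) relates the new \<Omega>_j to the divergence.\<close>

lemma curvature_weyl:
  assumes p: "p \<in> U"
  shows "Omega2 \<theta> \<omega> \<Psi> i j \<mu> \<nu> p = horizontal_form \<theta> (Weyl \<theta> \<gamma> i j) \<mu> \<nu> p"
    and "Omega1 \<omega> \<Psi> j \<mu> \<nu> p = horizontal_form \<theta>
      (\<lambda>m n p. divWeyl \<theta> \<gamma> j m n p + (\<Sum>i\<in>UNIV. \<Sum>k\<in>UNIV. eta i k * Ai k p * Weyl \<theta> \<gamma> j i m n p)) \<mu> \<nu> p"
    and "ext_d A \<mu> \<nu> p = (\<Sum>k\<in>UNIV. wedge (\<Psi> k) (\<theta> k) \<mu> \<nu> p)"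
proof -
  let ?W = "\<lambda>i j. horizontal_form \<theta> (Weyl \<theta> \<gamma> i j) \<mu> \<nu> p"
  note delta = if_distrib[where f="\<lambda>x. _ * x"] if_distrib[where f="\<lambda>x. x * _"]
  have gauge: "(\<Sum>C\<in>UNIV. gauge Ai B C p * cartan_curv (cartan \<theta> \<omega> A \<Psi>) C D \<mu> \<nu> p)
    = (\<Sum>C\<in>UNIV. cartan_curv (cartan \<theta> \<gamma> (\<lambda>\<mu> p. 0) (schouten_form \<theta> \<gamma>)) B C \<mu> \<nu> p * gauge Ai C D p)" for B D
    by (rule cartan_curv_gauge[OF open_U p smooth_gauge
          smooth_form1_cartan[OF open_U smooth_theta smooth_form1_zero smooth_schouten_form smooth_gamma]
          smooth_form1_cartan[OF open_U smooth_theta smooth_A smooth_Psi smooth_omega]])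
      (rule gauge_equation)
  note cc = cartan_curv_eq_block[OF open_U p smooth_theta smooth_A smooth_Psi weyl]
  note cc0 = cartan_curv_schouten[OF p]
  show 3: "ext_d A \<mu> \<nu> p = (\<Sum>k\<in>UNIV. wedge (\<Psi> k) (\<theta> k) \<mu> \<nu> p)"
    using gauge[of Bot Bot] unfolding cc cc0 by (simp add: sum_cidx)
  have 2: "Omega2 \<theta> \<omega> \<Psi> i j \<mu> \<nu> p = ?W i j" for i j
  proof -
    have "(\<Sum>k\<in>UNIV. eta i k * Omega2 \<theta> \<omega> \<Psi> k j \<mu> \<nu> p) = (\<Sum>k\<in>UNIV. eta i k * ?W k j)" for i
      using gauge[of "Mid i" "Mid j"] unfolding cc cc0 by (simp add: sum_cidx 3 delta cong: if_cong)
    then have "(\<Sum>k\<in>UNIV. eta i k * (\<Sum>l\<in>UNIV. eta k l * Omega2 \<theta> \<omega> \<Psi> l j \<mu> \<nu> p))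
        = (\<Sum>k\<in>UNIV. eta i k * (\<Sum>l\<in>UNIV. eta k l * ?W l j))" by simp
    then show ?thesis by (simp only: eta_eta_contract)
  qed
  then show "Omega2 \<theta> \<omega> \<Psi> i j \<mu> \<nu> p = ?W i j" .
  have "Omega1 \<omega> \<Psi> j \<mu> \<nu> p + (\<Sum>i\<in>UNIV. Ai i p * (\<Sum>k\<in>UNIV. eta i k * ?W k j))
      = horizontal_form \<theta> (divWeyl \<theta> \<gamma> j) \<mu> \<nu> p"
    using gauge[of Top "Mid j"] unfolding cc cc0
    by (simp add: sum_cidx 2 3 Omega1_schouten_form[OF p] delta cong: if_cong)
  \<comment> \<open>Skewness of the Weyl form turns the subtracted A_i C^i_j into the added A^i C_ji
    of the statement.\<close>
  moreover have "?W k j = - ?W j k" for k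
    unfolding horizontal_form_def by (subst Weyl_skew12[OF p]) (simp add: sum_negf)
  ultimately have "Omega1 \<omega> \<Psi> j \<mu> \<nu> p
      = horizontal_form \<theta> (divWeyl \<theta> \<gamma> j) \<mu> \<nu> p + (\<Sum>i\<in>UNIV. \<Sum>k\<in>UNIV. eta i k * Ai k p * ?W j i)"
    by (simp add: sum_idx4 algebra_simps)
  also have "(\<Sum>i\<in>UNIV. \<Sum>k\<in>UNIV. eta i k * Ai k p * ?W j i)
      = horizontal_form \<theta> (\<lambda>m n p. \<Sum>i\<in>UNIV. \<Sum>k\<in>UNIV. eta i k * Ai k p * Weyl \<theta> \<gamma> j i m n p) \<mu> \<nu> p"
  proof -
    have lin: "horizontal_form \<theta> (\<lambda>m n p. \<Sum>i\<in>I. f i p * C i m n p) \<mu> \<nu> p = (\<Sum>i\<in>I. f i p * horizontal_form \<theta> (C i) \<mu> \<nu> p)"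
      if "finite I" for I :: "idx4 set" and f C
      using that by (induction I rule: finite_induct)
        (simp_all add: horizontal_form_def sum.distrib algebra_simps sum_distrib_left)
    show ?thesis
      unfolding sum_distrib_right[symmetric] by (rule lin[symmetric]) simp
  qed
  finally show "Omega1 \<omega> \<Psi> j \<mu> \<nu> p = horizontal_form \<theta>
      (\<lambda>m n p. divWeyl \<theta> \<gamma> j m n p + (\<Sum>i\<in>UNIV. \<Sum>k\<in>UNIV. eta i k * Ai k p * Weyl \<theta> \<gamma> j i m n p)) \<mu> \<nu> p"
    by (simp add: horizontal_form_def distrib_left distrib_right sum.distrib)
qed

lemma normalized_Psi: "normalized U \<theta> \<omega> \<Psi>"
  by (rule normalizedI[OF curvature_weyl(1) Weyl_skew12 Weyl_skew34 Weyl_trace])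

lemma cartan_curv_weyl:
  assumes p: "p \<in> U"
  shows "cartan_curv (cartan \<theta> \<omega> A \<Psi>) B C \<mu> \<nu> p
    = cartan_curv_block (Omega2 \<theta> \<omega> \<Psi>) (Omega1 \<omega> \<Psi>) B C \<mu> \<nu> p"
  unfolding cartan_curv_eq_block[OF open_U p smooth_theta smooth_A smooth_Psi weyl]
  by (simp add: curvature_weyl(3)[OF p])

end

section \<open>Smoothness and non-degeneracy of the tetrad\<close>

text \<open>The counterpart of \<open>bar4\<close> for coordinates: conjugating the components of a
  real one-form amounts to this relabelling.\<close>

fun barx :: "coord \<Rightarrow> coord" where
  "barx cZ = cZ"
| "barx cW = cWs"
| "barx cWs = cW"
| "barx cR = cR"
| "barx cs = css"
| "barx css = cs"

lemma barx_barx [simp]: "barx (barx \<mu>) = \<mu>"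
  by (cases \<mu>) simp_all

lemma bar4_bar4 [simp]: "bar4 (bar4 i) = i"
  by (cases i) simp_all

lemma sum_barx: "(\<Sum>\<mu>\<in>UNIV. f (barx \<mu>)) = (\<Sum>\<mu>\<in>UNIV. f \<mu>)"
  by (rule sum.reindex_bij_witness[of _ barx barx]) simp_all

lemma sum_bar4: "(\<Sum>i\<in>UNIV. f (bar4 i)) = (\<Sum>i\<in>UNIV. f i)"
  by (rule sum.reindex_bij_witness[of _ bar4 bar4]) simp_all

lemma sum_coord: "(\<Sum>\<mu>\<in>UNIV. f \<mu>) = f cZ + f cW + f cWs + f cR + f cs + f css"
  by (simp add: UNIV_coord add.assoc)

lemma cj_cj [simp]: "cj (cj f) = f"
  by (simp add: cj_def)

lemma cnj_crd: "cnj (crd \<mu> p) = crd (barx \<mu>) p"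
  by (cases p; cases \<mu>) simp_all

lemma bounded_linear_crd: "bounded_linear (crd \<mu>)"
proof -
  have "linear (crd \<mu>)"
    by (rule linearI; cases \<mu>) (auto simp: scaleR_conv_of_real)
  then show ?thesis by (simp add: linear_conv_bounded_linear)
qed

lemma smooth_on_crd: "smooth_on U (crd \<mu>)"
  by (rule smooth_on_bounded_linear[OF bounded_linear_crd])

lemma smooth_on_cj: "open U \<Longrightarrow> smooth_on U f \<Longrightarrow> smooth_on U (cj f)"
  unfolding cj_def by (rule smooth_on_cnj)

lemma pd_cj:
  assumes "f differentiable (at p)"
  shows "pd \<mu> (cj f) p = cnj (pd (barx \<mu>) f p)"
  by (cases \<mu>) (simp_all add: cj_def frechet_derivative_bounded_linear_comp[OF bounded_linear_cnj assms])

lemma smooth_on_vderiv: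
  "open U \<Longrightarrow> (\<And>\<mu>. smooth_on U (X \<mu>)) \<Longrightarrow> smooth_on U f \<Longrightarrow> smooth_on U (vderiv X f)"
  unfolding vderiv_def by (intro smooth_on_sum smooth_on_mult smooth_on_pd)

text \<open>\<open>matrix_inv\<close> is a choice of a two-sided inverse, and such an inverse is
  unique. Rows and columns have different index types here, and both products are given.\<close>

lemma matrix_inv_eqI:
  fixes M :: "'a::semiring_1 ^ 'm ^ 'n" and E :: "'a ^ 'n ^ 'm"
  assumes "M ** E = mat 1" "E ** M = mat 1"
  shows "matrix_inv M = E"
  unfolding matrix_inv_def
proof (rule some_equality)
  fix E' assume E': "M ** E' = mat 1 \<and> E' ** M = mat 1"
  have "E' = E' ** (M ** E)" by (simp add: assms matrix_mul_rid)
  also have "\<dots> = (E' ** M) ** E" by (rule matrix_mul_assoc)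
  also have "\<dots> = E" using E' by (simp add: matrix_mul_lid)
  finally show "E' = E" .
qed (use assms in simp)

lemma dual_frame_eqI:
  assumes "\<And>L M. (\<Sum>\<mu>\<in>UNIV. coframe \<theta> L \<mu> p * E M \<mu>) = (if L = M then 1 else 0)"
    and "\<And>\<mu> \<nu>. (\<Sum>L\<in>UNIV. E L \<mu> * coframe \<theta> L \<nu> p) = (if \<mu> = \<nu> then 1 else 0)"
  shows "dual_frame \<theta> L \<mu> p = E L \<mu>"
proof -
  have "matrix_inv ((\<chi> M \<nu>. coframe \<theta> M \<nu> p) :: complex^coord^idx6) = (\<chi> \<mu> L. E L \<mu>)"
    by (rule matrix_inv_eqI) (simp_all add: matrix_matrix_mult_def mat_def vec_eq_iff assms)
  then show ?thesis by (simp add: dual_frame_def)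
qed

text \<open>D and D^* annihilate all the beta forms and are therefore dual to ds and ds^*. The
  denominators contain 1 - b b^*, the determinant of the block with rows 1, b and b^*, 1 that mixes
  the forms beta^+ and beta^-.\<close>

fun tetrad_dual :: "(J6 \<Rightarrow> complex) \<Rightarrow> (J6 \<Rightarrow> real) \<Rightarrow> idx6 \<Rightarrow> coord \<Rightarrow> J6 \<Rightarrow> complex" where
  "tetrad_dual S \<Phi> Fs \<mu> p = e_s S \<mu> p"
| "tetrad_dual S \<Phi> Fss \<mu> p = e_ss S \<mu> p"
| "tetrad_dual S \<Phi> (Fr N0) \<mu> p = (dcrd cZ \<mu> p - cfun S p * dcrd cR \<mu> p) / complex_of_real (\<Phi> p)"
| "tetrad_dual S \<Phi> (Fr Np) \<mu> p =
     (dcrd cW \<mu> p - cj (bfun S) p * dcrd cWs \<mu> p + (cj (afun S) p * cj (bfun S) p - afun S p) * dcrd cR \<mu> p)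
       / (complex_of_real (\<Phi> p) * alphafun S p * (1 - bbs S p))"
| "tetrad_dual S \<Phi> (Fr Nm) \<mu> p =
     (dcrd cWs \<mu> p - bfun S p * dcrd cW \<mu> p + (afun S p * bfun S p - cj (afun S) p) * dcrd cR \<mu> p)
       / (complex_of_real (\<Phi> p) * alphafun S p * (1 - bbs S p))"
| "tetrad_dual S \<Phi> (Fr N1) \<mu> p = dcrd cR \<mu> p / complex_of_real (\<Phi> p)"

section \<open>Smoothness of the functions T, b, \<alpha>, a and c\<close>

locale jet_pde =
  fixes U :: "J6 set" and S :: "J6 \<Rightarrow> complex"
  assumes open_U: "open U" and smooth_S: "smooth_on U S"
    and S_R: "p \<in> U \<Longrightarrow> 1 - (cmod (pd cR S p))\<^sup>2 > 0"
begin

lemma differentiable_S: "p \<in> U \<Longrightarrow> S differentiable (at p)"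
  by (rule smooth_on_differentiable[OF smooth_S])

lemma denominator_T:
  assumes "p \<in> U"
  shows "1 - pd cR S p * pd cR (cj S) p = complex_of_real (1 - (cmod (pd cR S p))\<^sup>2)"
  using pd_cj[OF differentiable_S[OF assms], of cR] complex_norm_square[of "pd cR S p"] by simp

lemma smooth_T: "smooth_on U (Tfun S)"
  unfolding Tfun_def
proof (intro smooth_on_divide open_U)
  show "1 - pd cR S p * pd cR (cj S) p \<noteq> 0" if "p \<in> U" for p
    using S_R[OF that] unfolding denominator_T[OF that] by (metis less_irrefl of_real_eq_0_iff)
qed (intro smooth_on_add smooth_on_diff smooth_on_mult smooth_on_pd smooth_on_const smooth_on_cnj smooth_on_crd
      smooth_on_cj smooth_S open_U)+

lemma smooth_e_s: "smooth_on U (e_s S \<mu>)"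
proof -
  have "e_s S cZ = crd cW" "e_s S cW = S" "e_s S cWs = crd cR" "e_s S cR = Tfun S"
    "e_s S cs = (\<lambda>p. 1)" "e_s S css = (\<lambda>p. 0)" by (simp_all add: fun_eq_iff)
  then show ?thesis by (cases \<mu>) (simp_all add: smooth_on_crd smooth_S smooth_T smooth_on_const)
qed

lemma smooth_e_ss: "smooth_on U (e_ss S \<mu>)"
proof -
  have "e_ss S cZ = crd cWs" "e_ss S cW = crd cR" "e_ss S cWs = (\<lambda>p. cnj (S p))"
    "e_ss S cR = (\<lambda>p. cnj (Tfun S p))"
    "e_ss S cs = (\<lambda>p. 0)" "e_ss S css = (\<lambda>p. 1)" by (simp_all add: fun_eq_iff)
  then show ?thesis
    by (cases \<mu>) (simp_all add: smooth_on_crd smooth_S smooth_T smooth_on_const smooth_on_cnj open_U)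
qed

lemma smooth_b: "smooth_on U (bfun S)"
  unfolding bfun_def
proof (intro smooth_on_divide open_U)
  fix p assume p: "p \<in> U"
  have "1 + sqrt (1 - (cmod (pd cR S p))\<^sup>2) \<noteq> 0" using S_R[OF p] by (simp add: add_nonneg_eq_0_iff)
  then show "1 + complex_of_real (sqrt (1 - (cmod (pd cR S p))\<^sup>2)) \<noteq> 0"
    by (metis of_real_1 of_real_add of_real_eq_0_iff)
next
  show "smooth_on U (\<lambda>p. - pd cR S p)" by (intro smooth_on_minus smooth_on_pd smooth_S open_U)
  show "smooth_on U (\<lambda>p. 1 + complex_of_real (sqrt (1 - (cmod (pd cR S p))\<^sup>2)))"
    by (intro smooth_on_add smooth_on_const smooth_on_of_real smooth_on_sqrt smooth_on_diff
        smooth_on_cmod_power2 smooth_on_pd smooth_S open_U S_R)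
qed

text \<open>Since its denominator is at least 1, b is bounded by S_R, whose modulus is below 1. This
  keeps 1 - b b^* away from 0, and with it the tetrad nondegenerate.\<close>

lemma cmod_b:
  assumes p: "p \<in> U"
  shows "cmod (bfun S p) < 1"
proof -
  let ?x = "cmod (pd cR S p)" and ?r = "sqrt (1 - (cmod (pd cR S p))\<^sup>2)"
  have "?x\<^sup>2 < 1\<^sup>2" using S_R[OF p] by simp
  then have "?x < 1" by (rule power_less_imp_less_base) simp
  have r: "?r \<ge> 0" using S_R[OF p] by simp
  have "1 + complex_of_real ?r = complex_of_real (1 + ?r)" by simp
  then have "cmod (bfun S p) = ?x / \<bar>1 + ?r\<bar>"
    unfolding bfun_def by (simp only: norm_divide norm_minus_cancel norm_of_real)
  also have "\<dots> \<le> ?x / 1"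
  proof -
    have r1: "1 \<le> \<bar>1 + ?r\<bar>" using r by linarith
    show ?thesis by (rule divide_left_mono[OF r1 norm_ge_zero], unfold mult_1_right, rule less_le_trans[OF zero_less_one r1])
  qed
  finally show ?thesis using \<open>?x < 1\<close> by simp
qed

lemma bbs_eq: "bbs S p = complex_of_real ((cmod (bfun S p))\<^sup>2)"
  using complex_norm_square[of "bfun S p"] by (simp add: bbs_def cj_def)

lemma bbs_ne:
  assumes p: "p \<in> U"
  shows "1 - bbs S p \<noteq> 0" "1 + bbs S p \<noteq> 0"
proof -
  have "(cmod (bfun S p))\<^sup>2 < 1" using cmod_b[OF p] by (simp add: power_less_one_iff)
  then have "1 - (cmod (bfun S p))\<^sup>2 \<noteq> 0" by simp
  then show "1 - bbs S p \<noteq> 0" unfolding bbs_eq by (metis of_real_1 of_real_diff of_real_eq_0_iff)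
  have "1 + (cmod (bfun S p))\<^sup>2 > 0" by (simp add: add_pos_nonneg)
  then have "1 + (cmod (bfun S p))\<^sup>2 \<noteq> 0" by simp
  then show "1 + bbs S p \<noteq> 0" unfolding bbs_eq by (metis of_real_1 of_real_add of_real_eq_0_iff)
qed

lemma smooth_bbs: "smooth_on U (bbs S)"
  unfolding bbs_def by (intro smooth_on_mult smooth_on_cj smooth_b open_U)

lemma smooth_alpha: "smooth_on U (alphafun S)"
  unfolding alphafun_def
  by (intro smooth_on_divide smooth_on_of_real smooth_on_sqrt smooth_on_add smooth_on_diff smooth_on_const
      smooth_on_cmod_power2 smooth_b smooth_bbs open_U bbs_ne) (simp add: add_pos_nonneg)

lemma alpha_ne:
  assumes "p \<in> U"
  shows "alphafun S p \<noteq> 0"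
proof -
  have "sqrt (1 + (cmod (bfun S p))\<^sup>2) \<noteq> 0" by (simp add: add_nonneg_eq_0_iff)
  then show ?thesis using bbs_ne[OF assms] by (simp add: alphafun_def)
qed

lemma smooth_a: "smooth_on U (afun S)"
  unfolding afun_def Let_def
proof (intro smooth_on_divide open_U)
  show "(1 - bfun S p * cj (bfun S) p) ^ 3 \<noteq> 0" if "p \<in> U" for p
    using bbs_ne[OF that] by (simp add: bbs_def)
qed (intro smooth_on_add smooth_on_diff smooth_on_mult smooth_on_power smooth_on_pd smooth_on_const
      smooth_on_cj smooth_S smooth_b smooth_bbs smooth_on_vderiv smooth_e_s smooth_e_ss open_U)+

lemma smooth_c: "smooth_on U (cfun S)"
proof -
  have n: "1 - bfun S p * cj (bfun S) p \<noteq> 0" "1 + bfun S p * cj (bfun S) p \<noteq> 0" if "p \<in> U" for p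
    using bbs_ne[OF that] by (simp_all add: bbs_def)
  \<comment> \<open>The same inequalities in the shape into which simplification brings the
    denominators of \<open>cfun\<close>.\<close>
  have n': "bfun S p * cj (bfun S) p \<noteq> 1" "2 + 2 * (bfun S p * cj (bfun S) p) \<noteq> 0" if "p \<in> U" for p
  proof -
    show "bfun S p * cj (bfun S) p \<noteq> 1" using n(1)[OF that] by auto
    have "2 + 2 * (bfun S p * cj (bfun S) p) = 2 * (1 + bfun S p * cj (bfun S) p)" by simp
    then show "2 + 2 * (bfun S p * cj (bfun S) p) \<noteq> 0" using n(2)[OF that] by (metis mult_eq_0_iff zero_neq_numeral)
  qed
  show ?thesis
    unfolding cfun_def Let_def
    by (intro smooth_on_divide smooth_on_minus smooth_on_add smooth_on_diff smooth_on_mult smooth_on_power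
        smooth_on_pd smooth_on_const smooth_on_cj smooth_S smooth_b smooth_bbs smooth_a smooth_T
        smooth_on_vderiv smooth_e_s smooth_e_ss open_U)
      (simp_all add: n n')
qed

end

section \<open>The tetrad and its explicit dual frame\<close>

locale jet_tetrad = jet_pde +
  fixes \<Phi> :: "J6 \<Rightarrow> real"
  assumes smooth_Phi: "smooth_on U \<Phi>" and Phi_ne: "p \<in> U \<Longrightarrow> \<Phi> p \<noteq> 0"
begin

lemma smooth_dcrd: "smooth_on V (dcrd \<nu> \<mu>)"
  by (simp add: dcrd_def smooth_on_const)

lemma smooth_beta:
  "smooth_on U (beta0 \<mu>)" "smooth_on U (betap S \<mu>)" "smooth_on U (betam S \<mu>)" "smooth_on U (beta1 S \<mu>)"
  unfolding beta0_def betap_def betam_def beta1_def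
  by (intro smooth_on_diff smooth_on_mult smooth_on_crd smooth_dcrd smooth_S smooth_T smooth_on_cnj open_U)+

lemma smooth_tetrad: "smooth_form1 U (tetrad S \<Phi> i)"
proof -
  have P: "smooth_on U (\<lambda>p. complex_of_real (\<Phi> p))" by (intro smooth_on_of_real open_U smooth_Phi)
  have c: "smooth_on U (\<lambda>p. cnj (bfun S p))" "smooth_on U (\<lambda>p. cnj (afun S p))"
    by (intro smooth_on_cnj smooth_b smooth_a open_U)+
  show ?thesis
    unfolding smooth_form1_def
    by (cases i; intro allI; simp only: tetrad.simps[abs_def])
      (intro smooth_on_mult smooth_on_add smooth_beta P c smooth_a smooth_b smooth_c smooth_alpha open_U)+
qed

lemma tetrad_duality:
  assumes p: "p \<in> U"
  shows "(\<Sum>\<mu>\<in>UNIV. coframe (tetrad S \<Phi>) L \<mu> p * tetrad_dual S \<Phi> M \<mu> p) = (if L = M then 1 else 0)" (is ?th1)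
    and "(\<Sum>L\<in>UNIV. tetrad_dual S \<Phi> L \<mu> p * coframe (tetrad S \<Phi>) L \<nu> p) = (if \<mu> = \<nu> then 1 else 0)" (is ?th2)
proof -
  define F al b bs a as c where "F = complex_of_real (\<Phi> p)" and "al = alphafun S p" and "b = bfun S p"
    and "bs = cnj (bfun S p)" and "a = afun S p" and "as = cnj (afun S p)" and "c = cfun S p"
  \<comment> \<open>With the inverses named, the duality relations become polynomial identities
    modulo F f = 1 and F al k (1 - b bs) = 1.\<close>
  define f k where "f = inverse F" and "k = inverse (F * al * (1 - b * bs))"
  have nz: "F \<noteq> 0" "al \<noteq> 0" "1 - b * bs \<noteq> 0"
    using Phi_ne[OF p] alpha_ne[OF p] bbs_ne[OF p] by (simp_all add: F_def al_def b_def bs_def bbs_def cj_def)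
  have f: "F * f = 1" using nz by (simp add: f_def)
  have "F * al * (1 - b * bs) * k = 1"
    unfolding k_def using nz by (intro right_inverse) simp
  then have k: "F * al * k * (1 - b * bs) = 1" by (simp only: mult_ac)
  have dual: "tetrad_dual S \<Phi> (Fr N0) \<mu> p = (dcrd cZ \<mu> p - c * dcrd cR \<mu> p) * f"
    "tetrad_dual S \<Phi> (Fr Np) \<mu> p = (dcrd cW \<mu> p - bs * dcrd cWs \<mu> p + (as * bs - a) * dcrd cR \<mu> p) * k"
    "tetrad_dual S \<Phi> (Fr Nm) \<mu> p = (dcrd cWs \<mu> p - b * dcrd cW \<mu> p + (a * b - as) * dcrd cR \<mu> p) * k"
    "tetrad_dual S \<Phi> (Fr N1) \<mu> p = dcrd cR \<mu> p * f" for \<mu>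
    by (simp_all add: F_def al_def b_def bs_def a_def as_def c_def f_def k_def cj_def bbs_def divide_inverse)
  have tet: "tetrad S \<Phi> N0 \<mu> p = F * beta0 \<mu> p"
    "tetrad S \<Phi> Np \<mu> p = F * al * (betap S \<mu> p + b * betam S \<mu> p)"
    "tetrad S \<Phi> Nm \<mu> p = F * al * (betam S \<mu> p + bs * betap S \<mu> p)"
    "tetrad S \<Phi> N1 \<mu> p = F * (beta1 S \<mu> p + a * betap S \<mu> p + as * betam S \<mu> p + c * beta0 \<mu> p)" for \<mu>
    by (simp_all add: F_def al_def b_def bs_def a_def as_def c_def)
  note [simp del] = tetrad.simps tetrad_dual.simps(3-6)
  note unf = tet beta0_def betap_def betam_def beta1_def dcrd_def
  have th1: "(\<Sum>\<mu>\<in>UNIV. coframe (tetrad S \<Phi>) L \<mu> p * tetrad_dual S \<Phi> (Fr M) \<mu> p) = (if L = Fr M then 1 else 0)" for L M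
  proof (cases L)
    case (Fr i)
    have "(\<Sum>\<mu>\<in>UNIV. coframe (tetrad S \<Phi>) L \<mu> p * tetrad_dual S \<Phi> (Fr M) \<mu> p) = (if i = M then 1 else 0)"
      unfolding Fr
      by (cases i; cases M; simp add: sum_coord unf dual;
          ((thin_tac "i = _", thin_tac "M = _", use f k in algebra) | simp add: algebra_simps)?)
    then show ?thesis using Fr by simp
  qed (cases M; simp add: sum_coord dual dcrd_def)+
  have th1': "(\<Sum>\<mu>\<in>UNIV. coframe (tetrad S \<Phi>) L \<mu> p * tetrad_dual S \<Phi> M \<mu> p) = (if L = M then 1 else 0)"
    if M: "M = Fs \<or> M = Fss" for L M
  proof (cases L)
    case (Fr i)
    then show ?thesis using M by (cases i) (auto simp: sum_coord unf algebra_simps)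
  qed (use M in \<open>auto simp: sum_coord dcrd_def\<close>)
  show ?th1 using th1 th1' by (cases M) blast+
  show ?th2
    by (cases \<mu>; cases \<nu>; simp add: sum_idx6 sum_idx4 unf dual;
        ((thin_tac "\<mu> = _", thin_tac "\<nu> = _", use f k in algebra) | simp add: algebra_simps)?)
qed

lemma dual_frame_tetrad: "p \<in> U \<Longrightarrow> dual_frame (tetrad S \<Phi>) L \<mu> p = tetrad_dual S \<Phi> L \<mu> p"
  by (rule dual_frame_eqI[of _ _ "\<lambda>L \<mu>. tetrad_dual S \<Phi> L \<mu> p"]) (rule tetrad_duality; assumption)+

lemma smooth_tetrad_dual: "smooth_on U (tetrad_dual S \<Phi> L \<mu>)"
proof -
  have P: "smooth_on U (\<lambda>p. complex_of_real (\<Phi> p))" by (intro smooth_on_of_real open_U smooth_Phi)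
  show ?thesis
  proof (cases L)
    case (Fr i)
    then show ?thesis
      using Phi_ne alpha_ne bbs_ne
      by (cases i; simp only: tetrad_dual.simps[abs_def];
          intro smooth_on_divide smooth_on_mult smooth_on_add smooth_on_diff smooth_on_const smooth_dcrd P
            smooth_on_cj smooth_a smooth_b smooth_c smooth_bbs smooth_alpha open_U; simp)
  qed (simp_all add: smooth_e_s smooth_e_ss tetrad_dual.simps[abs_def])
qed

lemma smooth_coframe_tetrad: "smooth_coframe U (tetrad S \<Phi>)"
proof
  show "open U" by (rule open_U)
  show "smooth_form1 U (tetrad S \<Phi> i)" for i by (rule smooth_tetrad)
  show "smooth_on U (dual_frame (tetrad S \<Phi>) L \<mu>)" for L \<mu>
    by (rule smooth_on_cong[OF open_U _ smooth_tetrad_dual]) (simp add: dual_frame_tetrad)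
qed (simp_all add: dual_frame_tetrad tetrad_duality)

end

section \<open>Reality\<close>

lemma cnj_eta [simp]: "cnj (eta i j) = eta i j"
  by (cases i; cases j) simp_all

lemma eta_bar4: "eta (bar4 i) (bar4 j) = eta i j"
  by (cases i; cases j) simp_all

lemma ext_d_conj:
  assumes "\<And>\<mu>. \<alpha> \<mu> differentiable (at p)"
  shows "ext_d (\<lambda>\<mu> q. cnj (\<alpha> (barx \<mu>) q)) \<mu> \<nu> p = cnj (ext_d \<alpha> (barx \<mu>) (barx \<nu>) p)"
proof -
  have "pd \<mu> (\<lambda>q. cnj (\<alpha> (barx \<nu>) q)) p = cnj (pd (barx \<mu>) (\<alpha> (barx \<nu>)) p)" for \<mu> \<nu>
    using pd_cj[OF assms, of \<mu> "barx \<nu>"] by (simp only: cj_def)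
  then show ?thesis by (simp only: ext_d_def complex_cnj_diff)
qed

section \<open>Conjugation of the data of the PDEs and of the tetrad\<close>

context jet_pde
begin

lemma e_ss_eq: "e_ss S \<mu> p = cnj (e_s S (barx \<mu>) p)"
  by (cases \<mu>) (simp_all add: cnj_crd)

lemma cnj_pd: "f differentiable (at p) \<Longrightarrow> cnj (pd \<mu> f p) = pd (barx \<mu>) (cj f) p"
  using pd_cj[of f p "barx \<mu>"] by (simp only: barx_barx)

lemma cnj_DD:
  assumes "f differentiable (at p)"
  shows "cnj (DD S f p) = DDs S (cj f) p"
proof -
  have "DDs S (cj f) p = (\<Sum>\<mu>\<in>UNIV. cnj (e_s S (barx \<mu>) p * pd (barx \<mu>) f p))"
    by (simp only: vderiv_def e_ss_eq pd_cj[OF assms] complex_cnj_mult)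
  also have "\<dots> = cnj (DD S f p)"
    unfolding vderiv_def cnj_sum by (rule sum_barx)
  finally show ?thesis ..
qed

lemma cnj_DDs:
  assumes "f differentiable (at p)"
  shows "cnj (DDs S f p) = DD S (cj f) p"
proof -
  have "DD S (cj f) p = (\<Sum>\<mu>\<in>UNIV. cnj (e_ss S (barx \<mu>) p * pd (barx \<mu>) f p))"
    by (simp only: vderiv_def e_ss_eq barx_barx complex_cnj_cnj complex_cnj_mult pd_cj[OF assms])
  also have "\<dots> = cnj (DDs S f p)"
    unfolding vderiv_def cnj_sum by (rule sum_barx)
  finally show ?thesis ..
qed

lemma cnj_alpha: "cnj (alphafun S p) = alphafun S p"
  by (simp add: alphafun_def bbs_eq)

text \<open>Conjugation exchanges D, S, T, a, b with their starred counterparts and W with W^*; the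
  formula for c is symmetric under this exchange.\<close>

lemma cnj_c:
  assumes p: "p \<in> U"
  shows "cnj (cfun S p) = cfun S p"
proof -
  have d: "S differentiable (at p)" "cj S differentiable (at p)"
    "Tfun S differentiable (at p)" "cj (Tfun S) differentiable (at p)"
    "afun S differentiable (at p)" "cj (afun S) differentiable (at p)"
    by (rule smooth_on_differentiable[OF _ p]; intro smooth_S smooth_T smooth_a smooth_on_cj open_U)+
  have v: "cj f p = cnj (f p)" for f by (simp add: cj_def)
  show ?thesis
    unfolding cfun_def Let_def
    by (simp add: v cnj_pd d cnj_DD cnj_DDs ac_simps del: pd.simps)
qed

lemma cnj_beta:
  "cnj (beta0 \<mu> p) = beta0 (barx \<mu>) p"
  "cnj (betap S \<mu> p) = betam S (barx \<mu>) p"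
  "cnj (betam S \<mu> p) = betap S (barx \<mu>) p"
  "cnj (beta1 S \<mu> p) = beta1 S (barx \<mu>) p"
  by (cases \<mu>; simp add: beta0_def betap_def betam_def beta1_def dcrd_def cnj_crd)+

end

lemma (in jet_tetrad) cnj_tetrad:
  "p \<in> U \<Longrightarrow> cnj (tetrad S \<Phi> i \<mu> p) = tetrad S \<Phi> (bar4 i) (barx \<mu>) p"
  by (cases i) (simp_all add: cnj_beta cnj_alpha cnj_c algebra_simps)

section \<open>Reality of the connection, of Psi and of the matrix of one-forms\<close>

context weyl_coframe
begin

text \<open>The right-hand side involves only theta and A. When these are real, the conjugate of the
  skew part satisfies the same equation, and \<open>wedge_theta_unique\<close> makes the skew part
  real.\<close>

lemma torsion_lower:
  assumes p: "p \<in> U"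
  shows "(\<Sum>j\<in>UNIV. wedge (skew_part \<omega> i j) (\<theta> j) \<mu> \<nu> p)
    = - (\<Sum>k\<in>UNIV. eta i k * ext_d (\<theta> k) \<mu> \<nu> p) - wedge A (lower_theta \<theta> i) \<mu> \<nu> p"
proof -
  have \<omega>: "\<omega> i j \<mu> p = skew_part \<omega> i j \<mu> p + eta i j * A \<mu> p" for i j \<mu>
    using weyl p by (simp add: weyl_connection_def)
  have "ext_d (\<theta> i) \<mu> \<nu> p = (\<Sum>k\<in>UNIV. eta i k * - (\<Sum>j\<in>UNIV. wedge (\<omega> k j) (\<theta> j) \<mu> \<nu> p))" for i
    using weyl p by (simp add: weyl_connection_def torsion_free_def eq_neg_iff_add_eq_0 sum_distrib_left sum_negf)
  then have "(\<Sum>k\<in>UNIV. eta i k * ext_d (\<theta> k) \<mu> \<nu> p) = - (\<Sum>j\<in>UNIV. wedge (\<omega> i j) (\<theta> j) \<mu> \<nu> p)"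
    by (simp only: eta_eta_contract)
  moreover have "(\<Sum>j\<in>UNIV. wedge (\<omega> i j) (\<theta> j) \<mu> \<nu> p) = (\<Sum>j\<in>UNIV. wedge (skew_part \<omega> i j) (\<theta> j) \<mu> \<nu> p)
      + wedge A (lower_theta \<theta> i) \<mu> \<nu> p"
    unfolding wedge_def \<omega> lower_theta_def
    by (simp add: sum.distrib sum_subtractf sum_distrib_left sum_distrib_right algebra_simps)
  ultimately show ?thesis by simp
qed

context
  assumes theta_real: "\<And>p i \<mu>. p \<in> U \<Longrightarrow> cnj (\<theta> i \<mu> p) = \<theta> (bar4 i) (barx \<mu>) p"
    and Ai_real: "\<And>p i. p \<in> U \<Longrightarrow> cnj (Ai i p) = Ai (bar4 i) p"
begin

lemma A_real: "p \<in> U \<Longrightarrow> cnj (A \<mu> p) = A (barx \<mu>) p"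
  unfolding weyl_form_def
  by (simp add: theta_real Ai_real) (rule sum_bar4[of "\<lambda>i. Ai i p * \<theta> i (barx \<mu>) p"])

lemma lower_theta_real: "p \<in> U \<Longrightarrow> cnj (lower_theta \<theta> i \<mu> p) = lower_theta \<theta> (bar4 i) (barx \<mu>) p"
  by (cases i) (simp_all add: lower_theta_def sum_idx4 theta_real)

lemma ext_d_theta_real:
  assumes p: "p \<in> U"
  shows "cnj (ext_d (\<theta> i) \<mu> \<nu> p) = ext_d (\<theta> (bar4 i)) (barx \<mu>) (barx \<nu>) p"
proof -
  have "ext_d (\<theta> (bar4 i)) (barx \<mu>) (barx \<nu>) p = ext_d (\<lambda>\<mu> q. cnj (\<theta> i (barx \<mu>) q)) (barx \<mu>) (barx \<nu>) p"
    by (rule ext_d_cong_open[OF open_U p]) (simp add: theta_real)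
  also have "\<dots> = cnj (ext_d (\<theta> i) \<mu> \<nu> p)"
    by (subst ext_d_conj[OF smooth_form1_differentiable[OF smooth_theta p]]) simp
  finally show ?thesis ..
qed

lemma skew_part_real:
  assumes p: "p \<in> U"
  shows "cnj (skew_part \<omega> i j \<mu> p) = skew_part \<omega> (bar4 i) (bar4 j) (barx \<mu>) p"
proof -
  let ?c = "\<lambda>i j \<mu> q. cnj (skew_part \<omega> (bar4 i) (bar4 j) (barx \<mu>) q)"
  let ?d = "\<lambda>i j \<mu> q. skew_part \<omega> i j \<mu> q - ?c i j \<mu> q"
  have "?d i j \<mu> p = 0" for i j \<mu>
  proof (rule wedge_theta_unique[OF p, of ?d])
    fix i j \<mu>
    show "?d i j \<mu> p = - ?d j i \<mu> p"
      using skew_part_swap[of \<omega> i j \<mu> p] skew_part_swap[of \<omega> "bar4 i" "bar4 j" "barx \<mu>" p] by simp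
  next
    fix i \<mu> \<nu>
    have "(\<Sum>j\<in>UNIV. wedge (?c i j) (\<theta> j) \<mu> \<nu> p)
        = (\<Sum>j\<in>UNIV. cnj (wedge (skew_part \<omega> (bar4 i) (bar4 j)) (\<theta> (bar4 j)) (barx \<mu>) (barx \<nu>) p))"
      by (simp add: wedge_def theta_real[OF p])
    also have "\<dots> = cnj (\<Sum>j\<in>UNIV. wedge (skew_part \<omega> (bar4 i) j) (\<theta> j) (barx \<mu>) (barx \<nu>) p)"
      unfolding cnj_sum
      by (rule sum_bar4[of "\<lambda>j. cnj (wedge (skew_part \<omega> (bar4 i) j) (\<theta> j) (barx \<mu>) (barx \<nu>) p)"])
    also have "\<dots> = (\<Sum>j\<in>UNIV. wedge (skew_part \<omega> i j) (\<theta> j) \<mu> \<nu> p)"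
      unfolding torsion_lower[OF p]
      by (cases i) (simp_all add: wedge_def A_real[OF p] lower_theta_real[OF p] ext_d_theta_real[OF p] sum_idx4)
    finally have "(\<Sum>j\<in>UNIV. wedge (?c i j) (\<theta> j) \<mu> \<nu> p) = (\<Sum>j\<in>UNIV. wedge (skew_part \<omega> i j) (\<theta> j) \<mu> \<nu> p)" .
    moreover have "(\<Sum>j\<in>UNIV. wedge (?d i j) (\<theta> j) \<mu> \<nu> p)
        = (\<Sum>j\<in>UNIV. wedge (skew_part \<omega> i j) (\<theta> j) \<mu> \<nu> p) - (\<Sum>j\<in>UNIV. wedge (?c i j) (\<theta> j) \<mu> \<nu> p)"
      by (simp add: wedge_def sum_subtractf left_diff_distrib)
    ultimately show "(\<Sum>j\<in>UNIV. wedge (?d i j) (\<theta> j) \<mu> \<nu> p) = 0" by simp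
  qed
  from this[of "bar4 i" "bar4 j" "barx \<mu>"] show ?thesis by simp
qed

lemma omega_real:
  assumes p: "p \<in> U"
  shows "cnj (\<omega> i j \<mu> p) = \<omega> (bar4 i) (bar4 j) (barx \<mu>) p"
proof -
  have \<omega>: "\<omega> i j \<mu> p = skew_part \<omega> i j \<mu> p + eta i j * A \<mu> p" for i j \<mu>
    using weyl p by (simp add: weyl_connection_def)
  show ?thesis
    unfolding \<omega>[of i j \<mu>] \<omega>[of "bar4 i" "bar4 j" "barx \<mu>"]
    by (simp only: complex_cnj_add complex_cnj_mult skew_part_real[OF p] A_real[OF p] cnj_eta eta_bar4)
qed

lemma ext_d_omega_real:
  assumes p: "p \<in> U"
  shows "cnj (ext_d (\<omega> i j) \<mu> \<nu> p) = ext_d (\<omega> (bar4 i) (bar4 j)) (barx \<mu>) (barx \<nu>) p"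
proof -
  have "ext_d (\<omega> (bar4 i) (bar4 j)) (barx \<mu>) (barx \<nu>) p
      = ext_d (\<lambda>\<mu> q. cnj (\<omega> i j (barx \<mu>) q)) (barx \<mu>) (barx \<nu>) p"
    by (rule ext_d_cong_open[OF open_U p]) (simp add: omega_real)
  also have "\<dots> = cnj (ext_d (\<omega> i j) \<mu> \<nu> p)"
    by (subst ext_d_conj[OF smooth_form1_differentiable[OF smooth_omega p]]) simp
  finally show ?thesis ..
qed

lemma Omega2_conj:
  assumes p: "p \<in> U"
  shows "Omega2 \<theta> \<omega> (\<lambda>i \<mu> q. cnj (\<Psi> (bar4 i) (barx \<mu>) q)) i j \<mu> \<nu> p
    = cnj (Omega2 \<theta> \<omega> \<Psi> (bar4 i) (bar4 j) (barx \<mu>) (barx \<nu>) p)"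
proof -
  have 1: "cnj (curv \<omega> (bar4 i) (bar4 j) (barx \<mu>) (barx \<nu>) p) = curv \<omega> i j \<mu> \<nu> p"
    by (simp add: curv_def ext_d_omega_real[OF p] wedge_def omega_real[OF p] sum_idx4 algebra_simps)
  show ?thesis
    unfolding Omega2_def complex_cnj_add complex_cnj_diff 1
    by (cases i; cases j) (simp_all add: wedge_def theta_real[OF p] sum_idx4 algebra_simps)
qed

lemma Psi_real:
  assumes p: "p \<in> U"
  shows "cnj (\<Psi> i \<mu> p) = \<Psi> (bar4 i) (barx \<mu>) p"
proof -
  let ?C = "\<lambda>i j l m p. cnj (Weyl \<theta> \<gamma> (bar4 i) (bar4 j) (bar4 l) (bar4 m) p)"
  \<comment> \<open>The conjugate family is normalized too, so it coincides with \<open>\<Psi>\<close>.\<close>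
  have "normalized U \<theta> \<omega> (\<lambda>i \<mu> q. cnj (\<Psi> (bar4 i) (barx \<mu>) q))"
  proof (rule normalizedI[of _ _ ?C])
    fix q i j \<mu> \<nu> assume q: "q \<in> U"
    have "cnj (horizontal_form \<theta> (Weyl \<theta> \<gamma> (bar4 i) (bar4 j)) (barx \<mu>) (barx \<nu>) q) = horizontal_form \<theta> (?C i j) \<mu> \<nu> q"
      by (simp add: horizontal_form_def wedge_def theta_real[OF q] sum_idx4 algebra_simps)
    then show "Omega2 \<theta> \<omega> (\<lambda>i \<mu> q. cnj (\<Psi> (bar4 i) (barx \<mu>) q)) i j \<mu> \<nu> q = horizontal_form \<theta> (?C i j) \<mu> \<nu> q"
      by (simp only: Omega2_conj[OF q] curvature_weyl(1)[OF q])
  next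
    fix q i j l m assume q: "q \<in> U"
    show "?C i j l m q = - ?C j i l m q" by (subst Weyl_skew12[OF q]) simp
    show "?C i j l m q = - ?C i j m l q" by (subst Weyl_skew34) simp
  next
    fix q j m assume q: "q \<in> U"
    have "(\<Sum>i\<in>UNIV. \<Sum>k\<in>UNIV. eta i k * ?C i j k m q)
        = cnj (\<Sum>i\<in>UNIV. \<Sum>k\<in>UNIV. eta i k * Weyl \<theta> \<gamma> i (bar4 j) k (bar4 m) q)"
      by (simp add: sum_idx4)
    then show "(\<Sum>i\<in>UNIV. \<Sum>k\<in>UNIV. eta i k * ?C i j k m q) = 0"
      by (simp add: Weyl_trace)
  qed
  from normalized_unique[OF normalized_Psi this p, of "bar4 i" "barx \<mu>"] show ?thesis by simp
qed

lemma cartan_real: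
  assumes p: "p \<in> U"
  shows "cnj (cartan \<theta> \<omega> A \<Psi> B C \<mu> p) = cartan \<theta> \<omega> A \<Psi> (barc B) (barc C) (barx \<mu>) p"
proof (cases B)
  case (Mid i)
  then show ?thesis
    by (cases C; cases i)
      (simp_all add: theta_real[OF p] Psi_real[OF p] skew_part_real[OF p] sum_idx4)
next
  case Bot
  show ?thesis
  proof (cases C)
    case (Mid j)
    with Bot show ?thesis by (cases j) (simp_all add: theta_real[OF p] sum_idx4)
  qed (use Bot in \<open>simp_all add: A_real[OF p]\<close>)
qed (cases C; simp add: A_real[OF p] Psi_real[OF p])

lemma cartan_in_o42:
  assumes p: "p \<in> U"
  shows "matrix_at (cartan \<theta> \<omega> A \<Psi>) p v \<in> o42"
proof -
  have "cnj (form1_at (cartan \<theta> \<omega> A \<Psi> B C) p v) = form1_at (cartan \<theta> \<omega> A \<Psi> (barc B) (barc C)) p v" for B C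
    unfolding form1_at_def cnj_sum complex_cnj_mult cartan_real[OF p] cnj_crd
    by (rule sum_barx[of "\<lambda>\<mu>. cartan \<theta> \<omega> A \<Psi> (barc B) (barc C) \<mu> p * crd \<mu> v"])
  then show ?thesis
    by (simp add: o42_def cartan_in_o42_complex) (simp add: matrix_at_def)
qed

end

end

theorem mainTheorem4:
  fixes U :: "J6 set" and S :: "J6 \<Rightarrow> complex" and \<Phi> :: "J6 \<Rightarrow> real"
    and Ai :: "idx4 \<Rightarrow> J6 \<Rightarrow> complex"
    and \<theta> :: "idx4 \<Rightarrow> form1" and A :: form1 and \<omega> \<gamma> :: "idx4 \<Rightarrow> idx4 \<Rightarrow> form1"
  assumes "open U"
    and "integrable_pde U S"
    and "\<forall>p\<in>U. Wuenschmann S p = 0"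
    and "smooth_on U \<Phi>" and "\<forall>p\<in>U. \<Phi> p \<noteq> 0"
    and "\<theta> = tetrad S \<Phi>"
    and "\<forall>p\<in>U. \<forall>\<mu> \<nu>. lie_deriv (e_s S) (tetrad_metric \<theta>) \<mu> \<nu> p = 0
                    \<and> lie_deriv (e_ss S) (tetrad_metric \<theta>) \<mu> \<nu> p = 0"
    and "\<forall>i. smooth_on U (Ai i)"
    and "A = weyl_form \<theta> Ai"
    and "weyl_connection U \<theta> A \<omega>"
    and "levi_civita U \<theta> \<gamma>"
  shows "\<exists>\<Psi> :: idx4 \<Rightarrow> form1.
    \<comment> \<open>(i)\<close>
    (\<forall>i. smooth_form1 U (\<Psi> i)) \<and> normalized U \<theta> \<omega> \<Psi> \<and>
    (\<forall>\<Psi>'. (\<forall>i. smooth_form1 U (\<Psi>' i)) \<and> normalized U \<theta> \<omega> \<Psi>' \<longrightarrow>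
        (\<forall>p\<in>U. \<forall>i \<mu>. \<Psi>' i \<mu> p = \<Psi> i \<mu> p)) \<and>
    \<comment> \<open>(ii)\<close>
    (\<forall>p\<in>U. \<forall>i j \<mu> \<nu>. Omega2 \<theta> \<omega> \<Psi> i j \<mu> \<nu> p =
        1/2 * (\<Sum>l\<in>UNIV. \<Sum>m\<in>UNIV. Weyl \<theta> \<gamma> i j l m p * wedge (\<theta> l) (\<theta> m) \<mu> \<nu> p)) \<and>
    (\<forall>p\<in>U. \<forall>i \<mu> \<nu>. Omega1 \<omega> \<Psi> i \<mu> \<nu> p =
        1/2 * (\<Sum>m\<in>UNIV. \<Sum>n\<in>UNIV.
          (divWeyl \<theta> \<gamma> i m n p + (\<Sum>j\<in>UNIV. \<Sum>k\<in>UNIV. eta j k * Ai k p * Weyl \<theta> \<gamma> i j m n p))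
          * wedge (\<theta> m) (\<theta> n) \<mu> \<nu> p)) \<and>
    \<comment> \<open>(iii); the second conjunct concerns the case in which the one-form \<open>A\<close> is real\<close>
    (\<forall>p\<in>U. \<forall>v. matrix_at (cartan \<theta> \<omega> A \<Psi>) p v \<in> o42_complex) \<and>
    ((\<forall>p\<in>U. \<forall>i. cnj (Ai i p) = Ai (bar4 i) p) \<longrightarrow>
        (\<forall>p\<in>U. \<forall>v. matrix_at (cartan \<theta> \<omega> A \<Psi>) p v \<in> o42)) \<and>
    (\<forall>p\<in>U. \<forall>B C \<mu> \<nu>. cartan_curv (cartan \<theta> \<omega> A \<Psi>) B C \<mu> \<nu> p =
        cartan_curv_block (Omega2 \<theta> \<omega> \<Psi>) (Omega1 \<omega> \<Psi>) B C \<mu> \<nu> p)"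
proof -
  interpret jet_tetrad U S \<Phi>
    using assms(1,2,4,5) by unfold_locales (auto simp: integrable_pde_def simp del: pd.simps)
  interpret frame: smooth_coframe U \<theta>
    unfolding assms(6) by (rule smooth_coframe_tetrad)
  interpret frame: weyl_coframe U \<theta> \<gamma> Ai \<omega>
    using assms(8-11) by unfold_locales auto
  have real: "cnj (\<theta> i \<mu> p) = \<theta> (bar4 i) (barx \<mu>) p" if "p \<in> U" for i \<mu> p
    unfolding assms(6) by (rule cnj_tetrad[OF that])
  show ?thesis
    unfolding assms(9)
  proof (intro exI[of _ "weyl_schouten_form \<theta> \<gamma> \<omega> Ai"] conjI allI ballI impI)
    show "smooth_form1 U (weyl_schouten_form \<theta> \<gamma> \<omega> Ai i)" for i by (rule frame.smooth_Psi)
    show "normalized U \<theta> \<omega> (weyl_schouten_form \<theta> \<gamma> \<omega> Ai)" by (rule frame.normalized_Psi)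
    show "\<Psi>' i \<mu> p = weyl_schouten_form \<theta> \<gamma> \<omega> Ai i \<mu> p"
      if "(\<forall>i. smooth_form1 U (\<Psi>' i)) \<and> normalized U \<theta> \<omega> \<Psi>'" "p \<in> U" for \<Psi>' p i \<mu>
      using frame.normalized_unique[OF frame.normalized_Psi _ that(2)] that(1) by blast
  next
    fix p v assume "p \<in> U"
    show "matrix_at (cartan \<theta> \<omega> (weyl_form \<theta> Ai) (weyl_schouten_form \<theta> \<gamma> \<omega> Ai)) p v \<in> o42_complex"
      by (rule cartan_in_o42_complex)
  next
    fix p v assume "\<forall>p\<in>U. \<forall>i. cnj (Ai i p) = Ai (bar4 i) p" and "p \<in> U"
    then show "matrix_at (cartan \<theta> \<omega> (weyl_form \<theta> Ai) (weyl_schouten_form \<theta> \<gamma> \<omega> Ai)) p v \<in> o42"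
      using real by (intro frame.cartan_in_o42) auto
  qed (simp_all only: frame.curvature_weyl(1,2) frame.cartan_curv_weyl horizontal_form_def)
qed

end
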